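(* For every $\mathcal X\in\mathbb D$, with $\mathbf x^n=\big(\mathcal X(\tfrac{\ell}{n}),\mathcal X(\tfrac{2\ell}{n}),\dots,\mathcal X(\tfrac{(n-1)\ell}{n}),\mathcal X(\ell)\big)\in\mathbb R^n$, $$C^*(\mathcal X)=\lim_{n\to+\infty}C^{\infty,n}(\mathbf x^n).$$
   Context: Continuous system. Parameters: lead time $\ell>0$, discount rate $\gamma>0$, drift $\mu\in\mathbb R$, standard deviation $\sigma>0$, unit costs $k^\uparrow,k^\downarrow>0$, and $M>0$. $\Omega$ is the set of continuous functions $\omega:[0,\infty)\to\mathbb R$, $W_t(\omega)=\omega(t)$, $\mathscr F=\sigma(W_t,t\ge0)$, $\mathscr F_t=\sigma(W_s,0\le s\le t)$, and $\mathbb P$ is the probability on $(\Omega,\mathscr F)$ under which $W$ is a Brownian motion started at $0$ with drift $\mu$ and variance $\sigma^2$; $\mathbb E$ is its expectation. The holding cost $h:\mathbb R\to[0,\infty)$ is convex and piecewise $C^2$, $h(0)=0$, $|h'|\le M$. $\mathbb D$ is the set of functions $\mathcal X:[0,\infty)\to\mathbb R$ that are right-continuous with left limits, non-decreasing, and constant on $[\ell,\infty)$. A policy is a pair $\pi=(Y^\uparrow,Y^\downarrow)$ of $(\mathscr F_t)$-adapted non-negative non-decreasing right-continuous processes, with $Y^\uparrow(t)=Y^\downarrow(t)=0$ for $t<0$ (an adjustment at time $0$ counts as a jump at $0$ in integrals $\int_0^\infty\cdot\,dY$). $\Pi$ is the set of policies with $\mathbb E[\int_0^\infty e^{-\gamma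 t}(dY^\uparrow(t)+dY^\downarrow(t))]<\infty$. From initial state $\mathcal X\in\mathbb D$ under $\pi$, the state at time $t$ is $\mathcal X_t(u)=\mathcal X(t+u)+W_t+Y^\uparrow(t+(u\wedge\ell)-\ell)-Y^\downarrow(t)$, $u\ge0$. The cost is $C(\mathcal X,\pi)=\mathbb E[\int_0^\infty e^{-\gamma t}h(\mathcal X_t(0))dt+\int_0^\infty e^{-\gamma t}(k^\uparrow dY^\uparrow(t)+k^\downarrow dY^\downarrow(t))]$, and $C^*(\mathcal X)=\inf_{\pi\in\Pi}C(\mathcal X,\pi)$. Periodic review system with $n$ periods per lead time. For $a>0$ let $\mathcal N_a$ be normal with mean $a\mu$ and variance $a\sigma^2$. Put $\alpha=e^{-\gamma\ell/n}$, $h^n(x)=\mathbb E[\int_0^{\ell/n}e^{-\gamma s}h(x+\mathcal N_{\ell/n})ds]$, $w_t=W_{(t+1)\ell/n}-W_{t\ell/n}$, and $\mathbf e=(1,\dots,1)$. States are $\mathbf x=(x_0,\dots,x_{n-1})\in\mathbb R^n$. For a horizon $T$ define $C^{T,n}_T\equiv0$ and, for $0\le t\le T-1$, $C^{T,n}_t(\mathbf x)=\min_{y^\uparrow,y^\downarrow\ge0}c^{T,n}_t(\mathbf x,y^\uparrow,y^\downarrow)$ with $$c^{T,n}_t(\mathbf x,y^\uparrow,y^\downarrow)=k^\uparrow y^\uparrow+k^\downarrow y^\downarrow+\alpha\,\mathbb E\big[C^{T,n}_{t+1}\big((x_1,\dots,x_{n-1},x_{n-1}+y^\uparrow)-y^\downarrow\mathbf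 e+w_t\mathbf e\big)+h^n(x_0-y^\downarrow)\big].$$ Finally $C^{\infty,n}(\mathbf x)=\lim_{T\to\infty}C^{T,n}_0(\mathbf x)$, which is finite and is the optimal cost of the infinite-horizon periodic system. *)

theory Defs
  imports "HOL-Probability.Probability"
begin

text \<open>
  Paths, states and policies are real-valued and all costs are non-negative, so costs and their
  expectations are taken in \<^typ>\<open>ennreal\<close> as (always defined) non-negative integrals.
\<close>

subsection \<open>Path space and Brownian motion\<close>

text \<open>Paths are normalised outside \<open>[0,\<infinity>)\<close>, so that elements of \<open>path_space\<close> are exactly the
  continuous functions on \<open>[0,\<infinity>)\<close>; the coordinate process \<open>W\<^sub>t\<close> is evaluation at \<open>t\<close>.\<close>

definition path_space :: "(real \<Rightarrow> real) set" where
  "path_space = {\<omega> \<in> {0..} \<rightarrow>\<^sub>E UNIV. continuous_on {0..} \<omega>}"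

definition path_sigma :: "real set \<Rightarrow> (real \<Rightarrow> real) measure" where
  "path_sigma I =
     sigma path_space {{\<omega> \<in> path_space. \<omega> s \<in> B} | s B. s \<in> I \<and> B \<in> sets borel}"

definition path_filtration :: "real \<Rightarrow> (real \<Rightarrow> real) measure" where
  "path_filtration t = path_sigma {0..t}"

definition brownian_law :: "real \<Rightarrow> real \<Rightarrow> (real \<Rightarrow> real) measure \<Rightarrow> bool" where
  "brownian_law \<mu> \<sigma> P \<longleftrightarrow>
     prob_space P \<and> space P = path_space \<and> sets P = sets (path_sigma {0..}) \<and>
     (AE \<omega> in P. \<omega> 0 = 0) \<and>
     (\<forall>s t. 0 \<le> s \<and> s < t \<longrightarrow>
        distributed P lborel (\<lambda>\<omega>. \<omega> t - \<omega> s) (normal_density ((t - s) * \<mu>) (sqrt (t - s) * \<sigma>))) \<and>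
     (\<forall>(\<tau> :: nat \<Rightarrow> real) m. 0 \<le> \<tau> 0 \<and> strict_mono \<tau> \<longrightarrow>
        prob_space.indep_vars P (\<lambda>_. borel) (\<lambda>i \<omega>. \<omega> (\<tau> (Suc i)) - \<omega> (\<tau> i)) {..<m})"

subsection \<open>Holding cost\<close>

definition C2_on_interval :: "real \<Rightarrow> real \<Rightarrow> (real \<Rightarrow> real) \<Rightarrow> bool" where
  "C2_on_interval a b f \<longleftrightarrow>
     (\<exists>f' f''. (\<forall>x\<in>{a..b}. (f has_real_derivative f' x) (at x within {a..b})) \<and>
               (\<forall>x\<in>{a..b}. (f' has_real_derivative f'' x) (at x within {a..b})) \<and>
               continuous_on {a..b} f'')"

text \<open>The set \<open>S\<close> of breakpoints is locally finite; the function is \<open>C\<^sup>2\<close> up to and including the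
  (one-sided) endpoints of every piece.\<close>

definition piecewise_C2 :: "(real \<Rightarrow> real) \<Rightarrow> bool" where
  "piecewise_C2 f \<longleftrightarrow>
     (\<exists>S. (\<forall>a b. finite (S \<inter> {a..b})) \<and>
          (\<forall>a b. a < b \<and> S \<inter> {a<..<b} = {} \<longrightarrow> C2_on_interval a b f))"

text \<open>The bound on the derivative is imposed wherever the derivative exists.\<close>

definition holding_cost :: "real \<Rightarrow> (real \<Rightarrow> real) \<Rightarrow> bool" where
  "holding_cost M h \<longleftrightarrow>
     (\<forall>x. 0 \<le> h x) \<and> convex_on UNIV h \<and> piecewise_C2 h \<and> h 0 = 0 \<and>
     (\<forall>x. h differentiable (at x) \<longrightarrow> \<bar>deriv h x\<bar> \<le> M)"

subsection \<open>The continuous system\<close>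

text \<open>Only the values on \<open>[0,\<infinity>)\<close> of a member are relevant.\<close>

definition initial_states :: "real \<Rightarrow> (real \<Rightarrow> real) set" where
  "initial_states l =
     {X. (\<forall>u\<ge>0. continuous (at_right u) X) \<and>
         (\<forall>u>0. \<exists>L. (X \<longlongrightarrow> L) (at_left u)) \<and>
         mono_on {0..} X \<and>
         (\<forall>u\<ge>l. X u = X l)}"

definition adjustment_process :: "(real \<Rightarrow> (real \<Rightarrow> real) \<Rightarrow> real) \<Rightarrow> bool" where
  "adjustment_process Y \<longleftrightarrow>
     (\<forall>t\<ge>0. Y t \<in> borel_measurable (path_filtration t)) \<and>
     (\<forall>\<omega>\<in>path_space.
        (\<forall>t<0. Y t \<omega> = 0) \<and>
        (\<forall>t. 0 \<le> Y t \<omega>) \<and>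
        mono (\<lambda>t. Y t \<omega>) \<and>
        (\<forall>t. continuous (at_right t) (\<lambda>t. Y t \<omega>)))"

text \<open>The Stieltjes measure of a path \<open>y\<close> that vanishes on \<open>(-\<infinity>,0)\<close> has mass \<open>y 0\<close> at \<open>0\<close>, so an
  adjustment at time \<open>0\<close> is counted.\<close>

definition discounted_adjustment :: "real \<Rightarrow> (real \<Rightarrow> real) \<Rightarrow> ennreal" where
  "discounted_adjustment \<gamma> y =
     (\<integral>\<^sup>+ t\<in>{0..}. ennreal (exp (- \<gamma> * t)) \<partial>(interval_measure y))"

type_synonym policy = "(real \<Rightarrow> (real \<Rightarrow> real) \<Rightarrow> real) \<times> (real \<Rightarrow> (real \<Rightarrow> real) \<Rightarrow> real)"

definition policies :: "real \<Rightarrow> (real \<Rightarrow> real) measure \<Rightarrow> policy set" where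
  "policies \<gamma> P =
     {(Yup, Ydn). adjustment_process Yup \<and> adjustment_process Ydn \<and>
        (\<integral>\<^sup>+ \<omega>. discounted_adjustment \<gamma> (\<lambda>t. Yup t \<omega>) +
                discounted_adjustment \<gamma> (\<lambda>t. Ydn t \<omega>) \<partial>P) < \<infinity>}"

definition state ::
  "real \<Rightarrow> (real \<Rightarrow> real) \<Rightarrow> policy \<Rightarrow> (real \<Rightarrow> real) \<Rightarrow> real \<Rightarrow> real \<Rightarrow> real" where
  "state l X = (\<lambda>(Yup, Ydn) \<omega> t u. X (t + u) + \<omega> t + Yup (t + min u l - l) \<omega> - Ydn t \<omega>)"

definition policy_cost ::
  "real \<Rightarrow> real \<Rightarrow> real \<Rightarrow> real \<Rightarrow> (real \<Rightarrow> real) \<Rightarrow> (real \<Rightarrow> real) measure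
     \<Rightarrow> (real \<Rightarrow> real) \<Rightarrow> policy \<Rightarrow> ennreal" where
  "policy_cost l \<gamma> kup kdn h P X = (\<lambda>(Yup, Ydn).
     \<integral>\<^sup>+ \<omega>. (\<integral>\<^sup>+ t\<in>{0..}. ennreal (exp (- \<gamma> * t) * h (state l X (Yup, Ydn) \<omega> t 0)) \<partial>lborel)
            + (ennreal kup * discounted_adjustment \<gamma> (\<lambda>t. Yup t \<omega>)
               + ennreal kdn * discounted_adjustment \<gamma> (\<lambda>t. Ydn t \<omega>)) \<partial>P)"

definition optimal_cost ::
  "real \<Rightarrow> real \<Rightarrow> real \<Rightarrow> real \<Rightarrow> (real \<Rightarrow> real) \<Rightarrow> (real \<Rightarrow> real) measure
     \<Rightarrow> (real \<Rightarrow> real) \<Rightarrow> ennreal" where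
  "optimal_cost l \<gamma> kup kdn h P X = (INF \<pi>\<in>policies \<gamma> P. policy_cost l \<gamma> kup kdn h P X \<pi>)"

subsection \<open>The periodic review system with \<open>n\<close> periods per lead time\<close>

text \<open>States in \<open>\<real>\<^sup>n\<close> are functions in \<open>{..<n} \<rightarrow>\<^sub>E UNIV\<close>.\<close>

definition normal_law :: "real \<Rightarrow> real \<Rightarrow> real \<Rightarrow> real measure" where
  "normal_law \<mu> \<sigma> a = density lborel (normal_density (a * \<mu>) (sqrt a * \<sigma>))"

definition period_holding_cost ::
  "real \<Rightarrow> real \<Rightarrow> real \<Rightarrow> real \<Rightarrow> (real \<Rightarrow> real) \<Rightarrow> nat \<Rightarrow> real \<Rightarrow> ennreal" where
  "period_holding_cost l \<gamma> \<mu> \<sigma> h n x =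
     (\<integral>\<^sup>+ z. (\<integral>\<^sup>+ s\<in>{0..l / real n}. ennreal (exp (- \<gamma> * s) * h (x + z)) \<partial>lborel)
        \<partial>(normal_law \<mu> \<sigma> (l / real n)))"

definition period_demand :: "real \<Rightarrow> nat \<Rightarrow> nat \<Rightarrow> (real \<Rightarrow> real) \<Rightarrow> real" where
  "period_demand l n t \<omega> = \<omega> ((real t + 1) * l / real n) - \<omega> (real t * l / real n)"

definition next_state ::
  "nat \<Rightarrow> (nat \<Rightarrow> real) \<Rightarrow> real \<Rightarrow> real \<Rightarrow> real \<Rightarrow> nat \<Rightarrow> real" where
  "next_state n x yup ydn w =
     (\<lambda>i\<in>{..<n}. (if i = n - 1 then x (n - 1) + yup else x (i + 1)) - ydn + w)"

definition period_cost ::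
  "real \<Rightarrow> real \<Rightarrow> real \<Rightarrow> real \<Rightarrow> real \<Rightarrow> real \<Rightarrow> (real \<Rightarrow> real) \<Rightarrow> (real \<Rightarrow> real) measure
     \<Rightarrow> nat \<Rightarrow> nat \<Rightarrow> ((nat \<Rightarrow> real) \<Rightarrow> ennreal) \<Rightarrow> (nat \<Rightarrow> real) \<Rightarrow> real \<Rightarrow> real \<Rightarrow> ennreal" where
  "period_cost l \<gamma> \<mu> \<sigma> kup kdn h P n t V x yup ydn =
     ennreal (kup * yup + kdn * ydn) + ennreal (exp (- \<gamma> * l / real n)) *
       (\<integral>\<^sup>+ \<omega>. V (next_state n x yup ydn (period_demand l n t \<omega>))
              + period_holding_cost l \<gamma> \<mu> \<sigma> h n (x 0 - ydn) \<partial>P)"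

function finite_horizon_cost ::
  "real \<Rightarrow> real \<Rightarrow> real \<Rightarrow> real \<Rightarrow> real \<Rightarrow> real \<Rightarrow> (real \<Rightarrow> real) \<Rightarrow> (real \<Rightarrow> real) measure
     \<Rightarrow> nat \<Rightarrow> nat \<Rightarrow> nat \<Rightarrow> (nat \<Rightarrow> real) \<Rightarrow> ennreal" where
  "finite_horizon_cost l \<gamma> \<mu> \<sigma> kup kdn h P n T t =
     (if t < T
      then (\<lambda>x. INF (yup, ydn)\<in>{0..} \<times> {0..}.
              period_cost l \<gamma> \<mu> \<sigma> kup kdn h P n t
                (finite_horizon_cost l \<gamma> \<mu> \<sigma> kup kdn h P n T (Suc t)) x yup ydn)
      else (\<lambda>x. 0))"
  by pat_completeness auto
termination
  by (relation "Wellfounded.measure (\<lambda>(l, \<gamma>, \<mu>, \<sigma>, kup, kdn, h, P, n, T, t). T - t)") auto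

declare finite_horizon_cost.simps [simp del]

definition infinite_horizon_cost ::
  "real \<Rightarrow> real \<Rightarrow> real \<Rightarrow> real \<Rightarrow> real \<Rightarrow> real \<Rightarrow> (real \<Rightarrow> real) \<Rightarrow> (real \<Rightarrow> real) measure
     \<Rightarrow> nat \<Rightarrow> (nat \<Rightarrow> real) \<Rightarrow> ennreal" where
  "infinite_horizon_cost l \<gamma> \<mu> \<sigma> kup kdn h P n x =
     lim (\<lambda>T. finite_horizon_cost l \<gamma> \<mu> \<sigma> kup kdn h P n T 0 x)"

definition sampled_state :: "real \<Rightarrow> nat \<Rightarrow> (real \<Rightarrow> real) \<Rightarrow> nat \<Rightarrow> real" where
  "sampled_state l n X = (\<lambda>i\<in>{..<n}. X (real (i + 1) * l / real n))"

end

theory Submission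
  imports Defs "HOL-Real_Asymp.Real_Asymp"
begin

text \<open>
  The periodic optimal cost is squeezed between the continuous optimal cost and the cost of an
  arbitrary continuous policy, up to errors that vanish with the period \<open>\<delta> = l / n\<close>.  Both
  inequalities are obtained by translating controls: a plan of the periodic system acts on the
  continuous system as a pair of step processes, and a continuous policy, observed only at the
  multiples of \<open>\<delta>\<close>, is a plan of the periodic system.

  For the translation to lose little, both costs are written as the expectation of a discounted
  integral \<open>\<integral> exp (- \<gamma> u) r(u) du\<close> over the same time axis.  On the continuous side the Stieltjes
  integral of an adjustment process \<open>Y\<close> equals \<open>\<gamma>\<close> times the discounted integral of \<open>Y\<close> itself
  (\<open>discounted_adjustment_eq\<close>), so that \<open>policy_cost_eq\<close> has a rate \<open>r\<close> that is a function of the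
  current values of the processes.  On the discrete side (\<open>plan_cost_eq_discounted\<close>) the rate at
  time \<open>u\<close> is computed from the inventory level frozen at the last review time.  The holding cost is
  \<open>M\<close>-Lipschitz, so the two rates differ by at most \<open>M\<close> times the variation of the initial state, of
  the Brownian path and of the controls over one or two periods.  A monotone function \<open>f\<close> that
  vanishes before time \<open>0\<close> satisfies \<open>\<integral> exp (- \<gamma> u) (f u - f (u - c)) du =
  (1 - exp (- \<gamma> c)) \<integral> exp (- \<gamma> u) f u du\<close>, which controls the initial state and the adjustments of
  a policy with finite discounted effort; a Brownian increment over one period has mean absolute
  value of order \<open>sqrt \<delta>\<close>.

  It remains to identify the dynamic programming value with the best expected cost of a plan that
  may use the whole past of the Brownian path.  The lower bound \<open>limit_value_le_plan\<close> is a
  verification argument: the demand of a period is independent of the path up to its beginning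
  (\<open>nn_integral_increment\<close>), so every adapted order costs at least the minimum in the Bellman
  operator.  For the upper bound \<open>near_optimal_plan\<close> an order that nearly attains the minimum for
  the limit value is selected measurably in each period.  This needs that the limit value satisfies
  the Bellman inequality, where the limit in the horizon is exchanged with the minimum over orders
  by compactness (\<open>limit_value_attained\<close>), and that all value functions are Lipschitz with the
  common constant \<open>M / \<gamma>\<close>, which makes them measurable and lets rational orders suffice.
\<close>

section \<open>Lipschitz holding costs and discounted integrals\<close>

text \<open>The slope bound is only given where \<open>h\<close> is differentiable.  Between breakpoints the mean value
  theorem applies, and the finitely many breakpoints between two arguments are removed one at a
  time, by induction on their number.\<close>

lemma holding_cost_lipschitz:
  assumes "holding_cost M h"
  shows "\<bar>h x - h y\<bar> \<le> M * \<bar>x - y\<bar>"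
proof -
  have "piecewise_C2 h" using assms by (simp add: holding_cost_def)
  then obtain S where S: "(\<forall>a b. finite (S \<inter> {a..b})) \<and>
      (\<forall>a b. a < b \<and> S \<inter> {a<..<b} = {} \<longrightarrow> C2_on_interval a b h)"
    unfolding piecewise_C2_def by (rule exE)
  have fin: "finite (S \<inter> {a..b})" for a b using S by simp
  have pieces: "C2_on_interval a b h" if "a < b" "S \<inter> {a<..<b} = {}" for a b
    using S that by simp
  have deriv_bound: "\<bar>deriv h z\<bar> \<le> M" if "h differentiable (at z)" for z
    using assms that by (auto simp: holding_cost_def)
  have piece: "\<bar>h b - h a\<bar> \<le> M * (b - a)" if ab: "a < b" "S \<inter> {a<..<b} = {}" for a b
  proof -
    obtain h' where h': "\<And>z. z \<in> {a..b} \<Longrightarrow> (h has_real_derivative h' z) (at z within {a..b})"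
      using pieces[OF ab] unfolding C2_on_interval_def by blast
    have cont: "continuous_on {a..b} h"
      using h' by (intro DERIV_continuous_on) auto
    have inner: "(h has_real_derivative h' z) (at z)" if "a < z" "z < b" for z
      using h'[of z] that at_within_Icc_at[of a z b] by auto
    obtain d z where z: "a < z" "z < b" "DERIV h z :> d" "h b - h a = (b - a) * d"
      using MVT[OF \<open>a < b\<close> cont] inner real_differentiable_def by blast
    have "\<bar>d\<bar> \<le> M"
      using deriv_bound[of z] DERIV_imp_deriv[OF z(3)] z(3) real_differentiable_def by auto
    then show ?thesis
      using \<open>a < b\<close> by (simp add: z(4) abs_mult mult.commute mult_right_mono)
  qed
  have step: "a < b \<Longrightarrow> card (S \<inter> {a<..<b}) = m \<Longrightarrow> \<bar>h b - h a\<bar> \<le> M * (b - a)" for a b m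
  proof (induction m arbitrary: a b rule: less_induct)
    case (less m)
    have finI: "finite (S \<inter> {a<..<b})"
      by (rule finite_subset[OF _ fin[of a b]]) auto
    show ?case
    proof (cases "S \<inter> {a<..<b} = {}")
      case True then show ?thesis using piece less.prems by blast
    next
      case False
      then obtain c where c: "c \<in> S" "a < c" "c < b" by auto
      have "card (S \<inter> {a<..<c}) < m" "card (S \<inter> {c<..<b}) < m"
        using c less.prems finI by (auto intro!: psubset_card_mono)
      then have "\<bar>h c - h a\<bar> \<le> M * (c - a)" "\<bar>h b - h c\<bar> \<le> M * (b - c)"
        using less.IH c by blast+
      then show ?thesis by (simp add: algebra_simps)
    qed
  qed
  show ?thesis
  proof (cases x y rule: linorder_cases)
    case less then show ?thesis using step[OF less refl] by (simp add: abs_minus_commute)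
  next
    case greater then show ?thesis using step[OF greater refl] by simp
  qed simp
qed

definition discounted :: "real \<Rightarrow> (real \<Rightarrow> ennreal) \<Rightarrow> ennreal" where
  "discounted \<gamma> f = (\<integral>\<^sup>+ u\<in>{0..}. ennreal (exp (- \<gamma> * u)) * f u \<partial>lborel)"

lemma discounted_mono:
  assumes "\<And>u. 0 \<le> u \<Longrightarrow> f u \<le> g u"
  shows "discounted \<gamma> f \<le> discounted \<gamma> g"
  unfolding discounted_def
  by (intro nn_integral_mono) (auto simp: indicator_def intro!: mult_left_mono assms)

lemma discounted_cong:
  assumes "\<And>u. 0 \<le> u \<Longrightarrow> f u = g u"
  shows "discounted \<gamma> f = discounted \<gamma> g"
  using assms by (intro antisym discounted_mono) auto

lemma discounted_add:
  assumes [measurable]: "f \<in> borel_measurable borel" "g \<in> borel_measurable borel"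
  shows "discounted \<gamma> (\<lambda>u. f u + g u) = discounted \<gamma> f + discounted \<gamma> g"
  unfolding discounted_def
  by (subst nn_integral_add[symmetric]) (auto intro!: nn_integral_cong simp: algebra_simps)

lemma discounted_cmult:
  assumes [measurable]: "f \<in> borel_measurable borel"
  shows "discounted \<gamma> (\<lambda>u. c * f u) = c * discounted \<gamma> f"
  unfolding discounted_def
  by (subst nn_integral_cmult[symmetric]) (auto intro!: nn_integral_cong simp: algebra_simps)

lemma discounted_indicator_atLeast:
  assumes "0 < \<gamma>" "0 \<le> a"
  shows "discounted \<gamma> (\<lambda>u. c * indicator {a..} u) = c * ennreal (exp (- \<gamma> * a) / \<gamma>)"
proof -
  have "(\<integral>\<^sup>+ u. ennreal (exp (- \<gamma> * u)) * indicator {a..} u \<partial>lborel)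
      = ennreal (0 - (- exp (- \<gamma> * a) / \<gamma>))"
  proof (rule nn_integral_FTC_atLeast)
    show "((\<lambda>u. - exp (- \<gamma> * u) / \<gamma>) \<longlongrightarrow> 0) at_top"
      using \<open>0 < \<gamma>\<close> by real_asymp
  qed (use \<open>0 < \<gamma>\<close> in \<open>auto intro!: derivative_eq_intros\<close>)
  moreover have "discounted \<gamma> (\<lambda>u. c * indicator {a..} u)
      = c * (\<integral>\<^sup>+ u. ennreal (exp (- \<gamma> * u)) * indicator {a..} u \<partial>lborel)"
    unfolding discounted_def using \<open>0 \<le> a\<close>
    by (subst nn_integral_cmult[symmetric])
      (auto intro!: nn_integral_cong simp: algebra_simps indicator_def)
  ultimately show ?thesis by simp
qed

lemma discounted_const:
  assumes "0 < \<gamma>"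
  shows "discounted \<gamma> (\<lambda>u. c) = c * ennreal (1 / \<gamma>)"
  using discounted_indicator_atLeast[OF assms, of 0 c]
  by (subst discounted_cong[of _ "\<lambda>u. c * indicator {0..} u"]) auto

lemma discounted_shift:
  assumes [measurable]: "f \<in> borel_measurable borel" and "0 \<le> c" and zero: "\<And>u. u < 0 \<Longrightarrow> f u = 0"
  shows "discounted \<gamma> (\<lambda>u. f (u - c)) = ennreal (exp (- \<gamma> * c)) * discounted \<gamma> f"
proof -
  have "discounted \<gamma> (\<lambda>u. f (u - c))
      = (\<integral>\<^sup>+ u. ennreal (exp (- \<gamma> * (u - c)) * exp (- \<gamma> * c)) * f (u - c) \<partial>lborel)"
    unfolding discounted_def using \<open>0 \<le> c\<close> zero
    by (auto intro!: nn_integral_cong simp: indicator_def exp_add[symmetric] algebra_simps)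
  also have "\<dots> = (\<integral>\<^sup>+ u. ennreal (exp (- \<gamma> * u) * exp (- \<gamma> * c)) * f u \<partial>lborel)"
    by (subst lborel_distr_plus[where c="-c", symmetric], subst nn_integral_distr) auto
  also have "\<dots> = ennreal (exp (- \<gamma> * c)) * discounted \<gamma> f"
    unfolding discounted_def using zero
    by (subst nn_integral_cmult[symmetric])
      (auto intro!: nn_integral_cong simp: indicator_def ennreal_mult mult_ac not_le)
  finally show ?thesis .
qed

text \<open>Shifting \<open>f\<close> by \<open>c\<close> multiplies its discounted integral by \<open>exp (- \<gamma> * c)\<close>, because \<open>f\<close> vanishes
  on the negative axis.  Finiteness makes it legitimate to subtract the two integrals.
  The common shift by \<open>b\<close> contributes a further factor \<open>exp (- \<gamma> * b) \<le> 1\<close>.\<close>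

lemma discounted_increment:
  fixes f :: "real \<Rightarrow> real"
  assumes [measurable]: "f \<in> borel_measurable borel" and "0 \<le> c" "0 < \<gamma>" "0 \<le> b"
    and zero: "\<And>u. u < 0 \<Longrightarrow> f u = 0" and mono: "mono f" and fin: "discounted \<gamma> (\<lambda>u. f u) < \<infinity>"
  shows "discounted \<gamma> (\<lambda>u. ennreal (f (u - b) - f (u - b - c)))
      \<le> ennreal (1 - exp (- \<gamma> * c)) * discounted \<gamma> (\<lambda>u. f u)"
proof -
  let ?I = "discounted \<gamma> (\<lambda>u. ennreal (f u))"
  have nonneg: "0 \<le> f u" for u
    using monoD[OF mono, of "min u (-1)" u] zero[of "min u (-1)"] by simp
  have [measurable]: "(\<lambda>u. f (u - x)) \<in> borel_measurable borel" for x
    by measurable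
  have "discounted \<gamma> (\<lambda>u. ennreal (f (u - b) - f (u - b - c))) + discounted \<gamma> (\<lambda>u. ennreal (f (u - (b + c))))
      = discounted \<gamma> (\<lambda>u. ennreal (f (u - b)))"
  proof (subst discounted_add[symmetric])
    have "ennreal (f (u - b) - f (u - b - c)) + ennreal (f (u - (b + c))) = ennreal (f (u - b))" for u
      using monoD[OF mono, of "u - b - c" "u - b"] \<open>0 \<le> c\<close> nonneg
      by (subst ennreal_plus[symmetric]) (auto simp: diff_diff_eq)
    then show "discounted \<gamma> (\<lambda>u. ennreal (f (u - b) - f (u - b - c)) + ennreal (f (u - (b + c))))
        = discounted \<gamma> (\<lambda>u. ennreal (f (u - b)))" by simp
  qed auto
  then have "discounted \<gamma> (\<lambda>u. ennreal (f (u - b) - f (u - b - c))) + ennreal (exp (- \<gamma> * (b + c))) * ?I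
      = ennreal (exp (- \<gamma> * b)) * ?I"
    using discounted_shift[of "\<lambda>u. ennreal (f u)" "b + c" \<gamma>] discounted_shift[of "\<lambda>u. ennreal (f u)" b \<gamma>]
      zero \<open>0 \<le> b\<close> \<open>0 \<le> c\<close> by simp
  moreover obtain i where i: "?I = ennreal i" "0 \<le> i"
    using fin by (cases ?I) auto
  moreover obtain d where d: "discounted \<gamma> (\<lambda>u. ennreal (f (u - b) - f (u - b - c))) = ennreal d" "0 \<le> d"
    using calculation by (cases "discounted \<gamma> (\<lambda>u. ennreal (f (u - b) - f (u - b - c)))")
       (auto simp: ennreal_mult[symmetric])
  ultimately have "ennreal (d + exp (- \<gamma> * (b + c)) * i) = ennreal (exp (- \<gamma> * b) * i)"
    by (simp add: ennreal_mult ennreal_plus)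
  then have "d + exp (- \<gamma> * (b + c)) * i = exp (- \<gamma> * b) * i"
    using d i by (subst (asm) ennreal_inj) auto
  then have "d = exp (- \<gamma> * b) * ((1 - exp (- \<gamma> * c)) * i)"
    by (simp add: algebra_simps exp_add[symmetric])
  also have "\<dots> \<le> 1 * ((1 - exp (- \<gamma> * c)) * i)"
    using \<open>0 < \<gamma>\<close> \<open>0 \<le> b\<close> \<open>0 \<le> c\<close> i by (intro mult_right_mono) auto
  finally show ?thesis
    unfolding d i using \<open>0 < \<gamma>\<close> \<open>0 \<le> c\<close> i
    by (subst ennreal_mult[symmetric]) (auto intro!: ennreal_leI)
qed

text \<open>Integration by parts: \<open>exp (- \<gamma> * t)\<close> is the integral of \<open>\<gamma> * exp (- \<gamma> * u)\<close> over \<open>u \<ge> t\<close>, and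
  by Tonelli's theorem the mass of \<open>{0..u}\<close>, which is \<open>y u\<close>, appears inside.\<close>

lemma discounted_adjustment_eq:
  assumes "0 < \<gamma>" and zero: "\<And>t. t < 0 \<Longrightarrow> y t = 0" and mono: "mono y"
    and rc: "\<And>t. continuous (at_right t) y"
  shows "discounted_adjustment \<gamma> y = ennreal \<gamma> * discounted \<gamma> (\<lambda>u. ennreal (y u))"
proof -
  let ?m = "interval_measure y"
  have monoD': "\<And>s t. s \<le> t \<Longrightarrow> y s \<le> y t" using mono by (rule monoD)
  have [measurable]: "y \<in> borel_measurable borel" using mono by (rule borel_measurable_mono)
  interpret m: sigma_finite_measure ?m
    using sigma_finite_interval_measure[of y] monoD' rc by blast
  \<comment> \<open>Masses are known on half-open intervals, which exhaust the negative axis.\<close>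
  have "emeasure ?m (\<Union>k::nat. {- real k - 1 <.. - 1 / (real k + 1)}) = 0"
  proof (rule emeasure_UN_eq_0)
    fix k :: nat
    have "- real k - 1 \<le> - 1 / (real k + 1)"
      by (simp add: divide_simps) (simp add: algebra_simps)
    then show "emeasure ?m {- real k - 1 <.. - 1 / (real k + 1)} = 0"
      using zero[of "- 1 / (real k + 1)"] zero[of "- real k - 1"]
      by (subst emeasure_interval_measure_Ioc) (auto intro: monoD' rc)
  qed auto
  moreover have "{..<0} \<subseteq> (\<Union>k::nat. {- real k - 1 <.. - 1 / (real k + 1)})"
  proof
    fix t :: real assume "t \<in> {..<0}"
    then have "0 < - t" by simp
    obtain k1 :: nat where k1: "inverse (real (Suc k1)) < - t"
      using reals_Archimedean[OF \<open>0 < - t\<close>] by blast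
    obtain k2 :: nat where k2: "- t < real k2" using reals_Archimedean2 by blast
    let ?k = "max k1 k2"
    have "1 / (real ?k + 1) \<le> inverse (real (Suc k1))"
      by (simp add: divide_simps)
    then have "t \<in> {- real ?k - 1 <.. - 1 / (real ?k + 1)}"
      using k1 k2 by (auto simp: add.commute)
    then show "t \<in> (\<Union>k::nat. {- real k - 1 <.. - 1 / (real k + 1)})" by blast
  qed
  ultimately have null: "emeasure ?m {..<0} = 0"
    using emeasure_mono[of "{..<0}" "\<Union>k::nat. {- real k - 1 <.. - 1 / (real k + 1)}" ?m] by auto
  have mass: "emeasure ?m {0..u} = ennreal (y u)" if "0 \<le> u" for u
  proof -
    have "emeasure ?m {0..u} = emeasure ?m {-1<..u}"
    proof (rule emeasure_eq_AE)
      have "AE t in ?m. t \<notin> {..<0}"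
        by (rule AE_not_in) (auto simp: null_sets_def null)
      then show "AE t in ?m. (t \<in> {0..u}) = (t \<in> {-1<..u})"
        by eventually_elim auto
    qed auto
    then show ?thesis
      using that zero[of "-1"] by (simp add: emeasure_interval_measure_Ioc monoD' rc)
  qed
  have tail: "ennreal (exp (- \<gamma> * t))
      = ennreal \<gamma> * (\<integral>\<^sup>+ u. ennreal (exp (- \<gamma> * u)) * indicator {t..} u \<partial>lborel)" if "0 \<le> t" for t
    using discounted_indicator_atLeast[OF \<open>0 < \<gamma>\<close> that, of 1] \<open>0 < \<gamma>\<close> that
    unfolding discounted_def
    by (subst nn_integral_cong[where v="\<lambda>u. ennreal (exp (- (\<gamma> * u))) * indicator {t..} u * indicator {0..} u"])
      (auto simp: ennreal_mult[symmetric] indicator_def)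
  have "discounted_adjustment \<gamma> y
     = (\<integral>\<^sup>+ t. (\<integral>\<^sup>+ u. ennreal \<gamma> * (ennreal (exp (- \<gamma> * u)) * indicator {t..} u * indicator {0..} t) \<partial>lborel) \<partial>?m)"
    unfolding discounted_adjustment_def
  proof (rule nn_integral_cong)
    fix t :: real
    have "(\<integral>\<^sup>+ u. ennreal \<gamma> * (ennreal (exp (- \<gamma> * u)) * indicator {t..} u * indicator {0..} t) \<partial>lborel)
        = ennreal \<gamma> * (\<integral>\<^sup>+ u. ennreal (exp (- \<gamma> * u)) * indicator {t..} u \<partial>lborel) * indicator {0..} t"
      by (subst nn_integral_cmult, simp, subst nn_integral_multc) (simp_all add: mult.assoc)
    then show "ennreal (exp (- \<gamma> * t)) * indicator {0..} t
        = (\<integral>\<^sup>+ u. ennreal \<gamma> * (ennreal (exp (- \<gamma> * u)) * indicator {t..} u * indicator {0..} t) \<partial>lborel)"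
      using tail[of t] by (cases "0 \<le> t") auto
  qed
  also have "\<dots> = (\<integral>\<^sup>+ u. (\<integral>\<^sup>+ t. ennreal \<gamma> * (ennreal (exp (- \<gamma> * u)) * indicator {t..} u * indicator {0..} t) \<partial>?m) \<partial>lborel)"
  proof -
    interpret pair_sigma_finite ?m lborel ..
    have "{p \<in> space (borel \<Otimes>\<^sub>M borel). fst p \<le> (snd p :: real)} \<in> sets (borel \<Otimes>\<^sub>M borel)"
      by (rule borel_measurable_le) measurable
    then have [measurable]: "(\<lambda>p::real\<times>real. indicator {fst p..} (snd p) :: ennreal) \<in> borel_measurable (borel \<Otimes>\<^sub>M borel)"
      by (subst measurable_cong[where g="indicator {p \<in> space (borel \<Otimes>\<^sub>M borel). fst p \<le> snd p}"])
        (auto simp: indicator_def space_pair_measure)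
    show ?thesis
      by (rule Fubini'[symmetric]) (simp add: split_beta', measurable)
  qed
  also have "\<dots> = (\<integral>\<^sup>+ u. ennreal \<gamma> * (ennreal (exp (- \<gamma> * u)) * ennreal (y u) * indicator {0..} u) \<partial>lborel)"
  proof (rule nn_integral_cong)
    fix u :: real
    have "(\<integral>\<^sup>+ t. ennreal \<gamma> * (ennreal (exp (- \<gamma> * u)) * indicator {t..} u * indicator {0..} t) \<partial>?m)
       = (\<integral>\<^sup>+ t. ennreal \<gamma> * ennreal (exp (- \<gamma> * u)) * indicator {0..u} t \<partial>?m)"
      by (auto intro!: nn_integral_cong simp: indicator_def)
    also have "\<dots> = ennreal \<gamma> * ennreal (exp (- \<gamma> * u)) * emeasure ?m {0..u}"
      by (simp add: nn_integral_cmult)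
    also have "\<dots> = ennreal \<gamma> * (ennreal (exp (- \<gamma> * u)) * ennreal (y u) * indicator {0..} u)"
      using mass[of u] by (cases "0 \<le> u") (auto simp: mult.assoc)
    finally show "(\<integral>\<^sup>+ t. ennreal \<gamma> * (ennreal (exp (- \<gamma> * u)) * indicator {t..} u * indicator {0..} t) \<partial>?m)
       = ennreal \<gamma> * (ennreal (exp (- \<gamma> * u)) * ennreal (y u) * indicator {0..} u)" .
  qed
  also have "\<dots> = ennreal \<gamma> * discounted \<gamma> (\<lambda>u. ennreal (y u))"
    unfolding discounted_def by (subst nn_integral_cmult) auto
  finally show ?thesis .
qed

section \<open>Brownian motion: measurability and independence of increments\<close>

text \<open>Evaluation at the next point of the grid of mesh \<open>1 / (k + 1)\<close> strictly to the right of \<open>t\<close> is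
  jointly measurable, since the grid is countable, and it converges by right-continuity.\<close>

lemma right_continuous_jointly_measurable:
  fixes f :: "real \<Rightarrow> 'a \<Rightarrow> real"
  assumes meas: "\<And>t. f t \<in> borel_measurable M"
    and rc: "\<And>\<omega> t. \<omega> \<in> space M \<Longrightarrow> continuous (at_right t) (\<lambda>t. f t \<omega>)"
  shows "(\<lambda>p. f (fst p) (snd p)) \<in> borel_measurable (borel \<Otimes>\<^sub>M M)"
proof (rule borel_measurable_LIMSEQ_real)
  define g where "g k p = f (real_of_int (\<lfloor>real (Suc k) * fst p\<rfloor> + 1) / real (Suc k)) (snd p)"
    for k and p :: "real \<times> 'a"
  show "g k \<in> borel_measurable (borel \<Otimes>\<^sub>M M)" for k
    unfolding g_def
    by (rule measurable_compose_countable[where f="\<lambda>i p. f (real_of_int (i + 1) / real (Suc k)) (snd p)"])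
      (auto intro!: measurable_compose[OF measurable_snd meas])
  fix p :: "real \<times> 'a" assume p: "p \<in> space (borel \<Otimes>\<^sub>M M)"
  let ?t = "fst p"
  let ?r = "\<lambda>k. real_of_int (\<lfloor>real (Suc k) * ?t\<rfloor> + 1) / real (Suc k)"
  have above: "?t < ?r k" for k
  proof -
    have "real (Suc k) * ?t < real_of_int (\<lfloor>real (Suc k) * ?t\<rfloor> + 1)" by linarith
    then show ?thesis by (subst pos_less_divide_eq) (auto simp: mult.commute)
  qed
  have below: "?r k \<le> ?t + inverse (real (Suc k))" for k
  proof -
    have "real_of_int (\<lfloor>real (Suc k) * ?t\<rfloor> + 1) \<le> real (Suc k) * ?t + 1" by linarith
    then have "?r k \<le> (real (Suc k) * ?t + 1) / real (Suc k)" by (intro divide_right_mono) auto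
    also have "\<dots> = ?t + inverse (real (Suc k))" by (simp add: add_divide_distrib inverse_eq_divide del: of_nat_Suc)
    finally show ?thesis .
  qed
  have "?r \<longlonglongrightarrow> ?t"
  proof (rule tendsto_sandwich[where f="\<lambda>_. ?t" and h="\<lambda>k. ?t + inverse (real (Suc k))"])
    show "(\<lambda>k. ?t + inverse (real (Suc k))) \<longlonglongrightarrow> ?t"
      using tendsto_add[OF tendsto_const LIMSEQ_inverse_real_of_nat, of ?t] by simp
    show "\<forall>\<^sub>F k in sequentially. ?t \<le> ?r k" using less_imp_le[OF above] by (rule always_eventually[OF allI])
    show "\<forall>\<^sub>F k in sequentially. ?r k \<le> ?t + inverse (real (Suc k))" using below by (rule always_eventually[OF allI])
  qed simp
  then have "filterlim ?r (at_right ?t) sequentially"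
    unfolding filterlim_at using above less_imp_neq[OF above, symmetric] by (auto simp del: of_nat_Suc)
  moreover have "((\<lambda>t. f t (snd p)) \<longlongrightarrow> f ?t (snd p)) (at_right ?t)"
    using rc[of "snd p" ?t] p by (auto simp: space_pair_measure continuous_within)
  ultimately show "(\<lambda>k. g k p) \<longlonglongrightarrow> f (fst p) (snd p)"
    unfolding g_def by (auto intro: filterlim_compose)
qed

lemma nn_integral_abs_normal_le:
  assumes "0 < s" and D: "distributed M lborel X (normal_density m s)"
  shows "(\<integral>\<^sup>+ \<omega>. ennreal \<bar>X \<omega>\<bar> \<partial>M) \<le> ennreal (\<bar>m\<bar> + s)"
proof -
  have hb: "has_bochner_integral lborel (\<lambda>x. normal_density m s x * \<bar>x - m\<bar>) (sqrt (2 / pi) * s)"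
    using normal_moment_abs_odd[OF \<open>0 < s\<close>, of m 0] by (simp add: mult.commute)
  have "(\<integral>\<^sup>+ x. ennreal (normal_density m s x) * ennreal \<bar>x - m\<bar> \<partial>lborel) = ennreal (sqrt (2 / pi) * s)"
    using nn_integral_eq_integral[OF integrable.intros[OF hb]] has_bochner_integral_integral_eq[OF hb]
    by (simp add: ennreal_mult)
  also have "\<dots> \<le> ennreal s"
  proof -
    have "2 / pi \<le> 1" using pi_ge_two by simp
    then have "sqrt (2 / pi) \<le> 1" by simp
    then show ?thesis using \<open>0 < s\<close> by (intro ennreal_leI) (simp add: mult_left_le_one_le)
  qed
  finally have centred: "(\<integral>\<^sup>+ x. ennreal (normal_density m s x) * ennreal \<bar>x - m\<bar> \<partial>lborel) \<le> ennreal s" .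
  interpret N: prob_space "density lborel (normal_density m s)"
    using \<open>0 < s\<close> by (rule prob_space_normal_density)
  have mass: "(\<integral>\<^sup>+ x. ennreal (normal_density m s x) \<partial>lborel) = 1"
    using N.emeasure_space_1 by (simp add: emeasure_density)
  have "(\<integral>\<^sup>+ \<omega>. ennreal \<bar>X \<omega>\<bar> \<partial>M) = (\<integral>\<^sup>+ x. ennreal (normal_density m s x) * ennreal \<bar>x\<bar> \<partial>lborel)"
    by (rule distributed_nn_integral[OF D, symmetric]) simp
  also have "\<dots> \<le> (\<integral>\<^sup>+ x. ennreal \<bar>m\<bar> * ennreal (normal_density m s x)
      + ennreal (normal_density m s x) * ennreal \<bar>x - m\<bar> \<partial>lborel)"
  proof (rule nn_integral_mono)
    fix x :: real
    have "normal_density m s x * \<bar>x\<bar> \<le> normal_density m s x * (\<bar>m\<bar> + \<bar>x - m\<bar>)"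
      by (intro mult_left_mono) auto
    then show "ennreal (normal_density m s x) * ennreal \<bar>x\<bar>
        \<le> ennreal \<bar>m\<bar> * ennreal (normal_density m s x) + ennreal (normal_density m s x) * ennreal \<bar>x - m\<bar>"
      by (simp add: ennreal_mult[symmetric] ennreal_plus[symmetric] ennreal_leI algebra_simps
          del: ennreal_plus)
  qed
  also have "\<dots> \<le> ennreal \<bar>m\<bar> + ennreal s"
    using centred by (subst nn_integral_add) (auto simp: nn_integral_cmult mass)
  finally show ?thesis using \<open>0 < s\<close> by simp
qed

lemma space_path_sigma [simp]: "space (path_sigma I) = path_space"
  unfolding path_sigma_def by (rule space_measure_of) auto

lemma sets_path_sigma:
  "sets (path_sigma I) = sigma_sets path_space {{\<omega> \<in> path_space. \<omega> s \<in> B} | s B. s \<in> I \<and> B \<in> sets borel}"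
  unfolding path_sigma_def by (rule sets_measure_of) auto

lemma sets_path_sigma_mono: "I \<subseteq> J \<Longrightarrow> sets (path_sigma I) \<subseteq> sets (path_sigma J)"
  unfolding sets_path_sigma by (rule sigma_sets_mono') auto

lemma space_path_filtration [simp]: "space (path_filtration t) = path_space"
  by (simp add: path_filtration_def)

lemma coordinate_measurable: "s \<in> I \<Longrightarrow> (\<lambda>\<omega>. \<omega> s) \<in> borel_measurable (path_sigma I)"
proof (rule measurableI)
  fix B :: "real set" assume "B \<in> sets borel" "s \<in> I"
  then show "(\<lambda>\<omega>. \<omega> s) -` B \<inter> space (path_sigma I) \<in> sets (path_sigma I)"
    unfolding sets_path_sigma by (intro sigma_sets.Basic) auto
qed auto

lemma path_filtration_measurable_mono:
  assumes "f \<in> measurable (path_filtration s) N" "s \<le> t"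
  shows "f \<in> measurable (path_filtration t) N"
  using assms measurable_mono[OF order_refl refl, of "path_filtration s" "path_filtration t" N]
    sets_path_sigma_mono[of "{0..s}" "{0..t}"] by (auto simp: path_filtration_def)

locale brownian_motion =
  fixes \<mu> \<sigma> :: real and P :: "(real \<Rightarrow> real) measure"
  assumes sigma_pos: "0 < \<sigma>" and law: "brownian_law \<mu> \<sigma> P"
begin

sublocale prob_space P
  using law by (simp add: brownian_law_def)

lemma space_P [simp]: "space P = path_space"
  using law by (simp add: brownian_law_def)

lemma emeasure_path_space [simp]: "emeasure P path_space = 1"
  using emeasure_space_1 by simp

lemma sets_P: "sets P = sets (path_sigma {0..})"
  using law by (simp add: brownian_law_def)

lemma start_AE: "AE \<omega> in P. \<omega> 0 = 0"
  using law by (simp add: brownian_law_def)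

lemma increment_distributed:
  "0 \<le> s \<Longrightarrow> s < t \<Longrightarrow>
    distributed P lborel (\<lambda>\<omega>. \<omega> t - \<omega> s) (normal_density ((t - s) * \<mu>) (sqrt (t - s) * \<sigma>))"
  using law by (auto simp: brownian_law_def)

lemma path_filtration_measurable_P:
  assumes "f \<in> measurable (path_filtration t) N"
  shows "f \<in> measurable P N"
  using assms measurable_mono[OF order_refl refl, of "path_filtration t" P N]
    sets_path_sigma_mono[of "{0..t}" "{0..}"] by (auto simp: path_filtration_def sets_P)

lemma coordinate_measurable_P: "0 \<le> t \<Longrightarrow> (\<lambda>\<omega>. \<omega> t) \<in> borel_measurable P"
  by (rule path_filtration_measurable_P[of _ t]) (simp add: path_filtration_def coordinate_measurable)

lemma increment_measurable:
  "0 \<le> s \<Longrightarrow> 0 \<le> t \<Longrightarrow> (\<lambda>\<omega>. \<omega> t - \<omega> s) \<in> borel_measurable P"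
  by (intro borel_measurable_diff coordinate_measurable_P)

lemma path_jointly_measurable: "(\<lambda>p. snd p (max 0 (fst p))) \<in> borel_measurable (borel \<Otimes>\<^sub>M P)"
proof (rule right_continuous_jointly_measurable)
  fix \<omega> :: "real \<Rightarrow> real" and t :: real assume "\<omega> \<in> space P"
  then have "continuous_on {0..} \<omega>" by (auto simp: path_space_def)
  then have "continuous_on UNIV (\<lambda>t. \<omega> (max 0 t))"
    by (rule continuous_on_compose2) (auto intro!: continuous_intros)
  then show "continuous (at_right t) (\<lambda>t. \<omega> (max 0 t))"
    by (simp add: continuous_on_eq_continuous_at continuous_at_imp_continuous_at_within)
qed (simp add: coordinate_measurable_P)

lemma expected_abs_increment_le:
  assumes "0 \<le> s" "s \<le> t" "t - s \<le> d"
  shows "(\<integral>\<^sup>+ \<omega>. ennreal \<bar>\<omega> t - \<omega> s\<bar> \<partial>P) \<le> ennreal (\<bar>\<mu>\<bar> * d + sqrt d * \<sigma>)"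
proof (cases "s = t")
  case False
  then have "s < t" using assms by simp
  have "(\<integral>\<^sup>+ \<omega>. ennreal \<bar>\<omega> t - \<omega> s\<bar> \<partial>P) \<le> ennreal (\<bar>(t - s) * \<mu>\<bar> + sqrt (t - s) * \<sigma>)"
    using \<open>s < t\<close> sigma_pos
    by (intro nn_integral_abs_normal_le[OF _ increment_distributed[OF \<open>0 \<le> s\<close> \<open>s < t\<close>]]) simp
  also have "\<dots> \<le> ennreal (\<bar>\<mu>\<bar> * d + sqrt d * \<sigma>)"
    using assms sigma_pos
    by (intro ennreal_leI add_mono mult_right_mono) (auto simp: abs_mult mult.commute[of _ "\<bar>\<mu>\<bar>"] intro!: mult_left_mono)
  finally show ?thesis .
qed simp

text \<open>An intersection-stable generator of the filtration at time \<open>s\<close>, on which independence can be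
  checked.\<close>

definition cylinders :: "real \<Rightarrow> (real \<Rightarrow> real) set set" where
  "cylinders s = {{\<omega> \<in> path_space. \<forall>r\<in>R. \<omega> r \<in> B r} | R B.
      finite R \<and> R \<subseteq> {0..s} \<and> (\<forall>r. B r \<in> sets borel)}"

lemma Int_stable_cylinders: "Int_stable (cylinders s)"
proof (rule Int_stableI)
  fix a b assume "a \<in> cylinders s" "b \<in> cylinders s"
  then obtain R1 B1 R2 B2 where
    a: "a = {\<omega> \<in> path_space. \<forall>r\<in>R1. \<omega> r \<in> B1 r}" "finite R1" "R1 \<subseteq> {0..s}" "\<forall>r. B1 r \<in> sets borel" and
    b: "b = {\<omega> \<in> path_space. \<forall>r\<in>R2. \<omega> r \<in> B2 r}" "finite R2" "R2 \<subseteq> {0..s}" "\<forall>r. B2 r \<in> sets borel"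
    unfolding cylinders_def by blast
  define B where "B r = (if r \<in> R1 then B1 r else UNIV) \<inter> (if r \<in> R2 then B2 r else UNIV)" for r
  have "a \<inter> b = {\<omega> \<in> path_space. \<forall>r\<in>R1 \<union> R2. \<omega> r \<in> B r}"
    unfolding a(1) b(1) B_def by auto
  moreover have "\<forall>r. B r \<in> sets borel"
    using a b by (auto simp: B_def)
  ultimately show "a \<inter> b \<in> cylinders s"
    unfolding cylinders_def using a(2,3) b(2,3)
    by (intro CollectI exI[of _ "R1 \<union> R2"] exI[of _ B]) simp
qed

lemma path_filtration_subset_cylinders:
  "sets (path_filtration s) \<subseteq> sigma_sets path_space (cylinders s)"
  unfolding path_filtration_def sets_path_sigma
proof (rule sigma_sets_mono')
  show "{{\<omega> \<in> path_space. \<omega> r \<in> B} |r B. r \<in> {0..s} \<and> B \<in> sets borel} \<subseteq> cylinders s"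
  proof
    fix A assume "A \<in> {{\<omega> \<in> path_space. \<omega> r \<in> B} |r B. r \<in> {0..s} \<and> B \<in> sets borel}"
    then obtain r B where "A = {\<omega> \<in> path_space. \<omega> r \<in> B}" "r \<in> {0..s}" "B \<in> sets borel" by blast
    then show "A \<in> cylinders s"
      unfolding cylinders_def
      by (intro CollectI exI[of _ "{r}"] exI[of _ "\<lambda>_. B"]) auto
  qed
qed

lemma cylinder_event:
  assumes "A \<in> cylinders s" shows "A \<in> events"
proof -
  obtain R B where A: "A = {\<omega> \<in> path_space. \<forall>r\<in>R. \<omega> r \<in> B r}" and R: "finite R" "R \<subseteq> {0..s}"
    and B: "\<And>r. B r \<in> sets borel"
    using assms unfolding cylinders_def by blast
  have "{\<omega> \<in> space P. \<forall>r\<in>R. \<omega> r \<in> B r} \<in> events"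
  proof (rule sets.sets_Collect_finite_All[OF _ R(1)])
    fix r assume "r \<in> R"
    then have "(\<lambda>\<omega>. \<omega> r) \<in> borel_measurable P" using R(2) by (intro coordinate_measurable_P) auto
    from measurable_sets[OF this B[of r]] show "{\<omega> \<in> space P. \<omega> r \<in> B r} \<in> events"
      by (simp add: vimage_def Int_def conj_commute)
  qed
  then show ?thesis by (simp add: A)
qed

text \<open>The times of the cylinder, completed by \<open>0\<close> and \<open>s\<close> and followed by \<open>t\<close>, form a partition along
  which the increments are independent.  Almost surely \<open>\<omega> 0 = 0\<close>, and then the values at the
  partition points are sums of the increments before the last one, so the cylinder agrees almost
  surely with an event determined by these increments.\<close>

lemma cylinder_indep_increment:
  assumes "A \<in> cylinders s" "0 \<le> s" "s < t" and C: "C \<in> sets borel"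
  shows "prob (A \<inter> {\<omega> \<in> path_space. \<omega> t - \<omega> s \<in> C}) = prob A * prob {\<omega> \<in> path_space. \<omega> t - \<omega> s \<in> C}"
proof -
  obtain R0 B0 where A: "A = {\<omega> \<in> path_space. \<forall>r\<in>R0. \<omega> r \<in> B0 r}" and R0: "finite R0" "R0 \<subseteq> {0..s}"
    and B0: "\<And>r. B0 r \<in> sets borel"
    using assms(1) unfolding cylinders_def by blast
  define R where "R = insert 0 (insert s R0)"
  define B where "B r = (if r \<in> R0 then B0 r else UNIV)" for r
  have R: "finite R" "R \<subseteq> {0..s}" "0 \<in> R" "s \<in> R" using R0 \<open>0 \<le> s\<close> by (auto simp: R_def)
  have "0 < card R" using R by (auto simp: card_gt_0_iff)
  have B: "B r \<in> sets borel" for r using B0 by (simp add: B_def)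
  define L where "L = sorted_list_of_set R"
  define m where "m = length L - 1"
  have L: "set L = R" "sorted_wrt (<) L" "length L = Suc m"
    using R(1) \<open>0 < card R\<close> by (simp_all add: L_def m_def)
  have L_mono: "L ! i < L ! j" if "i < j" "j \<le> m" for i j
    using sorted_wrt_nth_less[OF L(2) \<open>i < j\<close>] L(3) \<open>j \<le> m\<close> by simp
  have L_in: "L ! i \<in> {0..s}" if "i \<le> m" for i
    using L R that by (metis nth_mem less_Suc_eq_le subsetD)
  obtain i0 where i0: "i0 \<le> m" "L ! i0 = 0"
    using R(3) L by (metis in_set_conv_nth less_Suc_eq_le)
  obtain i1 where i1: "i1 \<le> m" "L ! i1 = s"
    using R(4) L by (metis in_set_conv_nth less_Suc_eq_le)
  have L0: "L ! 0 = 0"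
    using i0 L_mono[of 0 i0] L_in[of 0] by (cases i0) auto
  have Lm: "L ! m = s"
    using i1 L_mono[of i1 m] L_in[of m] by (cases "i1 = m") auto
  \<comment> \<open>A partition is an infinite sequence, so it is continued arbitrarily beyond \<open>t\<close>.\<close>
  define \<tau> where "\<tau> i = (if i \<le> m then L ! i else t + real (i - Suc m))" for i
  have "strict_mono \<tau>"
  proof (rule strict_monoI_Suc)
    fix i
    consider "Suc i \<le> m" | "i = m" | "m < i" by linarith
    then show "\<tau> i < \<tau> (Suc i)"
      by cases (use Lm \<open>s < t\<close> in \<open>auto simp: \<tau>_def L_mono\<close>)
  qed
  moreover have "0 \<le> \<tau> 0" by (simp add: \<tau>_def L0)
  ultimately have ind: "indep_vars (\<lambda>_. borel) (\<lambda>i \<omega>. \<omega> (\<tau> (Suc i)) - \<omega> (\<tau> i)) {..<Suc m}"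
    using law by (auto simp: brownian_law_def)
  define D where "D = (\<lambda>i \<omega>. \<omega> (\<tau> (Suc i)) - \<omega> (\<tau> i) :: real)"
  define S where "S = {v \<in> space (PiM {..<m} (\<lambda>_. borel :: real measure)). \<forall>j\<in>{..m}. (\<Sum>i<j. v i) \<in> B (L ! j)}"
  define A' where "A' = {\<omega> \<in> path_space. \<forall>j\<in>{..m}. \<omega> (L ! j) - \<omega> 0 \<in> B (L ! j)}"
  have "indep_var (PiM {..<m} (\<lambda>_. borel)) (\<lambda>\<omega>. restrict (\<lambda>i. D i \<omega>) {..<m})
      (PiM {m} (\<lambda>_. borel)) (\<lambda>\<omega>. restrict (\<lambda>i. D i \<omega>) {m})"
    by (rule indep_var_restrict[OF ind[folded D_def]]) auto
  moreover have "S \<in> sets (PiM {..<m} (\<lambda>_. borel))"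
    unfolding S_def
  proof (rule sets.sets_Collect_finite_All)
    fix j assume "j \<in> {..m}"
    then have "(\<lambda>v. \<Sum>i<j. v i) \<in> borel_measurable (PiM {..<m} (\<lambda>_. borel :: real measure))"
      by (intro borel_measurable_sum measurable_component_singleton) auto
    from measurable_sets[OF this B[of "L ! j"]]
    show "{v \<in> space (PiM {..<m} (\<lambda>_. borel)). (\<Sum>i<j. v i) \<in> B (L ! j)} \<in> sets (PiM {..<m} (\<lambda>_. borel))"
      by (simp add: vimage_def Int_def conj_commute)
  qed simp
  moreover have "{v \<in> space (PiM {m} (\<lambda>_. borel :: real measure)). v m \<in> C} \<in> sets (PiM {m} (\<lambda>_. borel))"
    using measurable_sets[OF measurable_component_singleton[of m "{m}" "\<lambda>_. borel :: real measure"] C]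
    by (simp add: vimage_def Int_def conj_commute)
  ultimately have "prob ((\<lambda>\<omega>. (restrict (\<lambda>i. D i \<omega>) {..<m}, restrict (\<lambda>i. D i \<omega>) {m})) -`
        (S \<times> {v \<in> space (PiM {m} (\<lambda>_. borel :: real measure)). v m \<in> C}) \<inter> space P)
     = prob ((\<lambda>\<omega>. restrict (\<lambda>i. D i \<omega>) {..<m}) -` S \<inter> space P)
       * prob ((\<lambda>\<omega>. restrict (\<lambda>i. D i \<omega>) {m}) -` {v \<in> space (PiM {m} (\<lambda>_. borel :: real measure)). v m \<in> C} \<inter> space P)"
    by (rule indep_varD)
  moreover have incr: "(\<lambda>\<omega>. restrict (\<lambda>i. D i \<omega>) {m}) -` {v \<in> space (PiM {m} (\<lambda>_. borel :: real measure)). v m \<in> C} \<inter> space P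
     = {\<omega> \<in> path_space. \<omega> t - \<omega> s \<in> C}"
    by (auto simp: D_def \<tau>_def Lm space_PiM)
  moreover have past: "(\<lambda>\<omega>. restrict (\<lambda>i. D i \<omega>) {..<m}) -` S \<inter> space P = A'"
  proof -
    have tele: "(\<Sum>i<j. D i \<omega>) = \<omega> (L ! j) - \<omega> 0" if "j \<le> m" for j \<omega>
      using that
    proof (induction j)
      case 0 then show ?case by (simp add: L0)
    next
      case (Suc j) then show ?case by (simp add: D_def \<tau>_def)
    qed
    have "(\<Sum>i<j. restrict (\<lambda>i. D i \<omega>) {..<m} i) = \<omega> (L ! j) - \<omega> 0" if "j \<le> m" for j \<omega>
      using that by (subst tele[symmetric]) (auto intro!: sum.cong)
    then show ?thesis by (auto simp: S_def A'_def space_PiM)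
  qed
  moreover have "(\<lambda>\<omega>. (restrict (\<lambda>i. D i \<omega>) {..<m}, restrict (\<lambda>i. D i \<omega>) {m})) -`
        (S \<times> {v \<in> space (PiM {m} (\<lambda>_. borel :: real measure)). v m \<in> C}) \<inter> space P
      = A' \<inter> {\<omega> \<in> path_space. \<omega> t - \<omega> s \<in> C}"
    unfolding incr[symmetric] past[symmetric] by blast
  ultimately have A'_ind: "prob (A' \<inter> {\<omega> \<in> path_space. \<omega> t - \<omega> s \<in> C}) = prob A' * prob {\<omega> \<in> path_space. \<omega> t - \<omega> s \<in> C}"
    by simp
  have "\<omega> \<in> A \<longleftrightarrow> \<omega> \<in> A'" if "\<omega> 0 = 0" for \<omega>
  proof -
    have "(\<forall>r\<in>R0. \<omega> r \<in> B0 r) \<longleftrightarrow> (\<forall>r\<in>R. \<omega> r \<in> B r)" by (auto simp: R_def B_def)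
    also have "\<dots> \<longleftrightarrow> (\<forall>j\<le>m. \<omega> (L ! j) \<in> B (L ! j))"
      using L by (metis in_set_conv_nth less_Suc_eq_le)
    finally show ?thesis using that unfolding A A'_def by auto
  qed
  then have AE: "AE \<omega> in P. \<omega> \<in> A \<longleftrightarrow> \<omega> \<in> A'" using start_AE by auto
  have Cev: "{\<omega> \<in> path_space. \<omega> t - \<omega> s \<in> C} \<in> events"
  proof -
    have "(\<lambda>\<omega>. \<omega> t - \<omega> s) \<in> borel_measurable P"
      using \<open>0 \<le> s\<close> \<open>s < t\<close> by (intro increment_measurable) auto
    from measurable_sets[OF this C] show ?thesis by (simp add: vimage_def Int_def conj_commute)
  qed
  have A'ev: "A' \<in> events"
  proof -
    have "{\<omega> \<in> space P. \<forall>j\<in>{..m}. \<omega> (L ! j) - \<omega> 0 \<in> B (L ! j)} \<in> events"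
    proof (rule sets.sets_Collect_finite_All)
      fix j assume "j \<in> {..m}"
      then have "(\<lambda>\<omega>. \<omega> (L ! j) - \<omega> 0) \<in> borel_measurable P"
        using L_in[of j] by (intro increment_measurable) auto
      from measurable_sets[OF this B[of "L ! j"]]
      show "{\<omega> \<in> space P. \<omega> (L ! j) - \<omega> 0 \<in> B (L ! j)} \<in> events"
        by (simp add: vimage_def Int_def conj_commute)
    qed simp
    then show ?thesis unfolding A'_def space_P .
  qed
  have Aev: "A \<in> events" by (rule cylinder_event[OF assms(1)])
  have "prob A = prob A'"
    by (rule measure_eq_AE[OF AE Aev A'ev])
  moreover have "prob (A \<inter> {\<omega> \<in> path_space. \<omega> t - \<omega> s \<in> C}) = prob (A' \<inter> {\<omega> \<in> path_space. \<omega> t - \<omega> s \<in> C})"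
    using AE Aev A'ev Cev by (intro measure_eq_AE) auto
  ultimately show ?thesis using A'_ind by simp
qed

lemma id_measurable_path_filtration: "(\<lambda>\<omega>. \<omega>) \<in> measurable P (path_filtration s)"
  by (rule path_filtration_measurable_P[of _ s]) (simp add: measurable_ident[unfolded id_def])

lemma filtration_indep_increment:
  assumes "0 \<le> s" "s < t" and A: "A \<in> sets (path_filtration s)" and C: "C \<in> sets borel"
  shows "prob (A \<inter> ((\<lambda>\<omega>. \<omega> t - \<omega> s) -` C \<inter> space P)) = prob A * prob ((\<lambda>\<omega>. \<omega> t - \<omega> s) -` C \<inter> space P)"
proof -
  let ?G = "{(\<lambda>\<omega>. \<omega> t - \<omega> s) -` C \<inter> space P | C. C \<in> sets borel}"
  have rv: "(\<lambda>\<omega>. \<omega> t - \<omega> s) \<in> borel_measurable P"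
    using assms by (intro increment_measurable) auto
  have "indep_set (cylinders s) ?G"
  proof (rule indep_setI)
    fix a b assume a: "a \<in> cylinders s" and "b \<in> ?G"
    then obtain C where C: "C \<in> sets borel" "b = (\<lambda>\<omega>. \<omega> t - \<omega> s) -` C \<inter> space P" by blast
    then have "b = {\<omega> \<in> path_space. \<omega> t - \<omega> s \<in> C}" by auto
    then show "prob (a \<inter> b) = prob a * prob b"
      using cylinder_indep_increment[OF a assms(1,2) C(1)] by simp
  qed (use cylinder_event measurable_sets[OF rv] in auto)
  moreover have "Int_stable ?G"
  proof (rule Int_stableI)
    fix a b assume "a \<in> ?G" "b \<in> ?G"
    then obtain C D where "C \<in> sets borel" "a = (\<lambda>\<omega>. \<omega> t - \<omega> s) -` C \<inter> space P"
      "D \<in> sets borel" "b = (\<lambda>\<omega>. \<omega> t - \<omega> s) -` D \<inter> space P" by blast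
    then show "a \<inter> b \<in> ?G" by (intro CollectI exI[of _ "C \<inter> D"]) auto
  qed
  ultimately have "indep_set (sigma_sets (space P) (cylinders s)) (sigma_sets (space P) ?G)"
    by (rule indep_set_sigma_sets[OF _ Int_stable_cylinders])
  then show ?thesis
  proof (rule indep_setD)
    show "A \<in> sigma_sets (space P) (cylinders s)"
      using A path_filtration_subset_cylinders by auto
    show "(\<lambda>\<omega>. \<omega> t - \<omega> s) -` C \<inter> space P \<in> sigma_sets (space P) ?G"
      using C by (intro sigma_sets.Basic) blast
  qed
qed

text \<open>The disintegration form of independence: the pair of the path seen up to \<open>s\<close> and of the next
  increment has a product law, so the increment can be integrated out first with the path frozen.\<close>

lemma nn_integral_increment:
  assumes "0 \<le> s" "0 < d"
    and f [measurable]: "f \<in> borel_measurable (path_filtration s \<Otimes>\<^sub>M borel)"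
  shows "(\<integral>\<^sup>+ \<omega>. f (\<omega>, \<omega> (s + d) - \<omega> s) \<partial>P)
    = (\<integral>\<^sup>+ \<omega>. (\<integral>\<^sup>+ z. f (\<omega>, z) \<partial>normal_law \<mu> \<sigma> d) \<partial>P)"
proof -
  let ?F = "path_filtration s" and ?w = "\<lambda>\<omega>. \<omega> (s + d) - \<omega> s :: real"
  have id [measurable]: "(\<lambda>\<omega>. \<omega>) \<in> measurable P ?F" by (rule id_measurable_path_filtration)
  have w [measurable]: "?w \<in> borel_measurable P" using assms by (intro increment_measurable) auto
  interpret w: prob_space "distr P borel ?w" by (rule prob_space_distr) simp
  interpret F: prob_space "distr P ?F (\<lambda>\<omega>. \<omega>)" by (rule prob_space_distr) (rule id)
  have eq: "distr P ?F (\<lambda>\<omega>. \<omega>) \<Otimes>\<^sub>M distr P borel ?w = distr P (?F \<Otimes>\<^sub>M borel) (\<lambda>\<omega>. (\<omega>, ?w \<omega>))"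
  proof (rule pair_measure_eqI)
    fix A C assume "A \<in> sets (distr P ?F (\<lambda>\<omega>. \<omega>))" "C \<in> sets (distr P borel ?w)"
    then have A: "A \<in> sets ?F" and C: "C \<in> sets borel" by auto
    have [simp]: "A \<inter> path_space = A" using sets.sets_into_space[OF A] by auto
    have A': "A \<in> events" using measurable_sets[OF id A] by simp
    have "emeasure (distr P ?F (\<lambda>\<omega>. \<omega>)) A * emeasure (distr P borel ?w) C
        = ennreal (prob A * prob (?w -` C \<inter> space P))"
      using A C by (simp add: emeasure_distr emeasure_eq_measure ennreal_mult)
    also have "\<dots> = ennreal (prob (A \<inter> (?w -` C \<inter> space P)))"
      using filtration_indep_increment[OF \<open>0 \<le> s\<close> _ A C, of "s + d"] \<open>0 < d\<close> by simp
    also have "A \<inter> (?w -` C \<inter> space P) = (\<lambda>\<omega>. (\<omega>, ?w \<omega>)) -` (A \<times> C) \<inter> space P"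
      by auto
    also have "ennreal (prob \<dots>) = emeasure (distr P (?F \<Otimes>\<^sub>M borel) (\<lambda>\<omega>. (\<omega>, ?w \<omega>))) (A \<times> C)"
      using A C by (subst emeasure_distr) (auto simp: emeasure_eq_measure)
    finally show "emeasure (distr P ?F (\<lambda>\<omega>. \<omega>)) A * emeasure (distr P borel ?w) C
        = emeasure (distr P (?F \<Otimes>\<^sub>M borel) (\<lambda>\<omega>. (\<omega>, ?w \<omega>))) (A \<times> C)" .
  next
    show "sets (distr P ?F (\<lambda>\<omega>. \<omega>) \<Otimes>\<^sub>M distr P borel ?w) = sets (distr P (?F \<Otimes>\<^sub>M borel) (\<lambda>\<omega>. (\<omega>, ?w \<omega>)))"
      by (simp cong: sets_pair_measure_cong)
  qed (rule F.sigma_finite_measure_axioms w.sigma_finite_measure_axioms)+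
  have "distr P lborel ?w = normal_law \<mu> \<sigma> d"
    using increment_distributed[of s "s + d"] assms
    by (simp add: distributed_def normal_law_def)
  moreover have "distr P lborel ?w = distr P borel ?w" by (rule distr_cong) auto
  ultimately have normal: "distr P borel ?w = normal_law \<mu> \<sigma> d" by simp
  have "(\<integral>\<^sup>+ \<omega>. f (\<omega>, ?w \<omega>) \<partial>P) = (\<integral>\<^sup>+ p. f p \<partial>distr P (?F \<Otimes>\<^sub>M borel) (\<lambda>\<omega>. (\<omega>, ?w \<omega>)))"
    by (subst nn_integral_distr) auto
  also have "\<dots> = (\<integral>\<^sup>+ \<omega>. (\<integral>\<^sup>+ z. f (\<omega>, z) \<partial>distr P borel ?w) \<partial>distr P ?F (\<lambda>\<omega>. \<omega>))"
    unfolding eq[symmetric] by (rule w.nn_integral_fst[symmetric]) (use f in \<open>simp cong: measurable_cong_sets\<close>)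
  also have "\<dots> = (\<integral>\<^sup>+ \<omega>. (\<integral>\<^sup>+ z. f (\<omega>, z) \<partial>distr P borel ?w) \<partial>P)"
    by (subst nn_integral_distr) (auto intro!: w.borel_measurable_nn_integral)
  finally show ?thesis by (simp add: normal)
qed

end

section \<open>The dynamic program of the periodic system\<close>

locale inventory = brownian_motion +
  fixes l \<gamma> kup kdn M :: real and h :: "real \<Rightarrow> real"
  assumes l_pos: "0 < l" and \<gamma>_pos: "0 < \<gamma>" and kup_pos: "0 < kup" and kdn_pos: "0 < kdn"
    and M_pos: "0 < M" and holding: "holding_cost M h"
begin

lemma h_nonneg [simp]: "0 \<le> h x"
  using holding by (simp add: holding_cost_def)

lemma h_le: "h x \<le> h y + M * \<bar>x - y\<bar>"
  using holding_cost_lipschitz[OF holding, of x y] by linarith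

lemma h_measurable [measurable]: "h \<in> borel_measurable borel"
proof (rule borel_measurable_continuous_onI)
  have "M-lipschitz_on UNIV h"
    using holding_cost_lipschitz[OF holding] M_pos by (intro lipschitz_onI) (auto simp: dist_real_def)
  then show "continuous_on UNIV h" by (rule lipschitz_on_continuous_on)
qed

end

locale periodic_system = inventory +
  fixes n :: nat
  assumes n_pos: "0 < n"
begin

definition period :: real where "period = l / real n"

definition \<alpha> :: real where "\<alpha> = exp (- \<gamma> * period)"

abbreviation states :: "(nat \<Rightarrow> real) measure" where "states \<equiv> PiM {..<n} (\<lambda>_. borel)"

abbreviation demand_law :: "real measure" where "demand_law \<equiv> normal_law \<mu> \<sigma> period"

lemma period_pos: "0 < period"
  using l_pos n_pos by (simp add: period_def)

lemma \<alpha>_bounds: "0 < \<alpha>" "\<alpha> < 1"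
  using period_pos \<gamma>_pos by (simp_all add: \<alpha>_def)

lemma \<alpha>_power: "\<alpha> ^ t = exp (- \<gamma> * (real t * period))"
  by (simp add: \<alpha>_def exp_of_nat_mult[symmetric] algebra_simps)

sublocale demand: prob_space demand_law
  unfolding normal_law_def using sigma_pos period_pos by (intro prob_space_normal_density) simp

lemma sets_demand_law [measurable_cong]: "sets demand_law = sets borel"
  by (simp add: normal_law_def)

definition period_hold :: "real \<Rightarrow> ennreal" where
  "period_hold z = ennreal ((1 - \<alpha>) / \<gamma> * h z)"

lemma period_hold_measurable [measurable]: "period_hold \<in> borel_measurable borel"
  unfolding period_hold_def by measurable

definition stage_value ::
  "((nat \<Rightarrow> real) \<Rightarrow> ennreal) \<Rightarrow> (nat \<Rightarrow> real) \<Rightarrow> real \<Rightarrow> real \<Rightarrow> ennreal" where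
  "stage_value V x yu yd = ennreal (kup * yu + kdn * yd) + ennreal \<alpha> *
     (\<integral>\<^sup>+ z. V (next_state n x yu yd z) + period_hold (x 0 - yd + z) \<partial>demand_law)"

definition bellman :: "((nat \<Rightarrow> real) \<Rightarrow> ennreal) \<Rightarrow> (nat \<Rightarrow> real) \<Rightarrow> ennreal" where
  "bellman V x = (INF (yu, yd)\<in>{0..} \<times> {0..}. stage_value V x yu yd)"

text \<open>The class of value functions that the Bellman operator preserves.  The Lipschitz condition is with
  respect to the maximum norm on the first \<open>n\<close> coordinates; with \<open>r = 0\<close> it also says that no other
  coordinate matters.\<close>

definition regular :: "((nat \<Rightarrow> real) \<Rightarrow> ennreal) \<Rightarrow> bool" where
  "regular V \<longleftrightarrow> V \<in> borel_measurable states \<and>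
     (\<forall>x x' r. (\<forall>i<n. \<bar>x i - x' i\<bar> \<le> r) \<longrightarrow> V x \<le> V x' + ennreal (M / \<gamma> * r))"

lemma regular_measurable [measurable_dest]: "regular V \<Longrightarrow> V \<in> borel_measurable states"
  by (simp add: regular_def)

lemma regularD: "regular V \<Longrightarrow> (\<And>i. i < n \<Longrightarrow> \<bar>x i - x' i\<bar> \<le> r) \<Longrightarrow> V x \<le> V x' + ennreal (M / \<gamma> * r)"
  by (simp add: regular_def)

lemma next_state_measurable [measurable (raw)]:
  assumes z: "z \<in> measurable N states"
    and [measurable]: "a \<in> borel_measurable N" "b \<in> borel_measurable N" "w \<in> borel_measurable N"
  shows "(\<lambda>\<omega>. next_state n (z \<omega>) (a \<omega>) (b \<omega>) (w \<omega>)) \<in> measurable N states"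
  unfolding next_state_def
proof (rule measurable_restrict)
  fix i assume "i \<in> {..<n}"
  have [measurable]: "(\<lambda>\<omega>. z \<omega> j) \<in> borel_measurable N" if "j < n" for j
    using measurable_compose[OF z measurable_component_singleton[of j]] that by simp
  show "(\<lambda>\<omega>. (if i = n - 1 then z \<omega> (n - 1) + a \<omega> else z \<omega> (i + 1)) - b \<omega> + w \<omega>) \<in> borel_measurable N"
    using \<open>i \<in> {..<n}\<close> by (cases "i = n - 1") auto
qed

lemma component_measurable:
  assumes z: "z \<in> measurable N states"
  shows "(\<lambda>\<omega>. z \<omega> 0) \<in> borel_measurable N"
  using measurable_compose[OF z measurable_component_singleton[of 0]] n_pos by simp

lemma next_state_measurable_demand: "(\<lambda>z. next_state n x yu yd z) \<in> measurable demand_law states"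
proof -
  have "(\<lambda>z. next_state n (restrict x {..<n}) yu yd z) \<in> measurable demand_law states"
    by (rule next_state_measurable) (auto simp: space_PiM measurable_ident_sets sets_demand_law)
  moreover have "next_state n (restrict x {..<n}) yu yd z = next_state n x yu yd z" for z
    using n_pos by (auto simp: next_state_def fun_eq_iff)
  ultimately show ?thesis by simp
qed

lemma stage_value_mono:
  "(\<And>x. V x \<le> W x) \<Longrightarrow> stage_value V x yu yd \<le> stage_value W x yu yd"
  unfolding stage_value_def by (intro add_left_mono mult_left_mono nn_integral_mono add_right_mono) auto

lemma period_cost_eq:
  assumes V: "regular V"
  shows "period_cost l \<gamma> \<mu> \<sigma> kup kdn h P n t V x yu yd = stage_value V x yu yd"
proof -
  have end_time: "(real t + 1) * l / real n = real t * l / real n + period"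
    by (simp add: period_def distrib_right add_divide_distrib)
  have hold: "(\<integral>\<^sup>+ s\<in>{0..l / real n}. ennreal (exp (- \<gamma> * s) * h y) \<partial>lborel) = period_hold y" for y
  proof -
    have "(\<integral>\<^sup>+ s. ennreal (exp (- \<gamma> * s) * h y) * indicator {0..period} s \<partial>lborel)
        = ennreal ((- exp (- \<gamma> * period) / \<gamma> * h y) - (- exp (- \<gamma> * 0) / \<gamma> * h y))"
      using \<gamma>_pos period_pos
      by (intro nn_integral_FTC_Icc) (auto intro!: derivative_eq_intros)
    also have "(- exp (- \<gamma> * period) / \<gamma> * h y) - (- exp (- \<gamma> * 0) / \<gamma> * h y) = (1 - \<alpha>) / \<gamma> * h y"
      by (simp add: \<alpha>_def diff_divide_distrib algebra_simps)
    finally show ?thesis by (simp add: period_hold_def period_def)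
  qed
  have [measurable]: "(\<lambda>z. V (next_state n x yu yd z)) \<in> borel_measurable borel"
    using measurable_compose[OF next_state_measurable_demand regular_measurable[OF V]]
    by (simp cong: measurable_cong_sets add: sets_demand_law)
  have dem [measurable]: "period_demand l n t \<in> borel_measurable P"
    unfolding period_demand_def[abs_def] using l_pos
    by (intro borel_measurable_diff coordinate_measurable_P) auto
  have "(\<integral>\<^sup>+ \<omega>. V (next_state n x yu yd (period_demand l n t \<omega>)) \<partial>P)
      = (\<integral>\<^sup>+ \<omega>. (\<integral>\<^sup>+ z. V (next_state n x yu yd z) \<partial>demand_law) \<partial>P)"
    unfolding period_demand_def end_time
    using nn_integral_increment[of "real t * l / real n" period "\<lambda>p. V (next_state n x yu yd (snd p))"]
      l_pos period_pos by simp
  then have V_eq: "(\<integral>\<^sup>+ \<omega>. V (next_state n x yu yd (period_demand l n t \<omega>)) \<partial>P)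
      = (\<integral>\<^sup>+ z. V (next_state n x yu yd z) \<partial>demand_law)"
    by (simp add: emeasure_space_1)
  have hold_eq: "period_holding_cost l \<gamma> \<mu> \<sigma> h n (x 0 - yd) = (\<integral>\<^sup>+ z. period_hold (x 0 - yd + z) \<partial>demand_law)"
    unfolding period_holding_cost_def hold by (simp add: period_def)
  show ?thesis
    unfolding period_cost_def stage_value_def hold_eq
    by (subst nn_integral_add, simp, simp, subst nn_integral_add)
      (auto simp: V_eq emeasure_space_1 \<alpha>_def period_def)
qed

text \<open>The constant \<open>M / \<gamma>\<close> reproduces itself: the continuation contributes \<open>\<alpha> * M / \<gamma>\<close> and the holding
  cost of the next period \<open>\<alpha> * (1 - \<alpha>) * M / \<gamma>\<close>, and \<open>\<alpha> * (2 - \<alpha>) \<le> 1\<close>.  Hence the constant is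
  uniform in the horizon and survives in the limit.\<close>

lemma stage_value_lipschitz:
  assumes V: "regular V" and r: "\<And>i. i < n \<Longrightarrow> \<bar>x i - x' i\<bar> \<le> r"
    and y: "0 \<le> yu" "0 \<le> yd" "0 \<le> yu'" "0 \<le> yd'"
  shows "stage_value V x yu yd \<le> stage_value V x' yu' yd'
      + ennreal (M / \<gamma> * r + (kup + M / \<gamma>) * \<bar>yu - yu'\<bar> + (kdn + M / \<gamma>) * \<bar>yd - yd'\<bar>)"
proof -
  let ?s = "r + \<bar>yu - yu'\<bar> + \<bar>yd - yd'\<bar>"
  have "0 \<le> r" using r[OF n_pos] by linarith
  then have "0 \<le> ?s" by simp
  define c where "c = (1 - \<alpha>) / \<gamma>"
  have q: "0 \<le> c" unfolding c_def using \<alpha>_bounds \<gamma>_pos by simp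
  have pointwise: "V (next_state n x yu yd z) + period_hold (x 0 - yd + z)
      \<le> (V (next_state n x' yu' yd' z) + period_hold (x' 0 - yd' + z)) + ennreal ((2 - \<alpha>) * (M / \<gamma>) * ?s)" for z
  proof -
    have "\<bar>next_state n x yu yd z i - next_state n x' yu' yd' z i\<bar> \<le> ?s" if "i < n" for i
    proof (cases "i = n - 1")
      case True
      then have "next_state n x yu yd z i = x (n - 1) + yu - yd + z" "next_state n x' yu' yd' z i = x' (n - 1) + yu' - yd' + z"
        using n_pos by (simp_all add: next_state_def)
      then show ?thesis using r[of "n - 1"] n_pos by linarith
    next
      case False
      then have "next_state n x yu yd z i = x (i + 1) - yd + z" "next_state n x' yu' yd' z i = x' (i + 1) - yd' + z"
        using that by (simp_all add: next_state_def)
      then show ?thesis using r[of "i + 1"] that False by linarith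
    qed
    then have 1: "V (next_state n x yu yd z) \<le> V (next_state n x' yu' yd' z) + ennreal (M / \<gamma> * ?s)"
      by (rule regularD[OF V])
    have "h (x 0 - yd + z) \<le> h (x' 0 - yd' + z) + M * \<bar>(x 0 - yd + z) - (x' 0 - yd' + z)\<bar>" by (rule h_le)
    also have "\<dots> \<le> h (x' 0 - yd' + z) + M * ?s"
      using r[OF n_pos] M_pos by (intro add_left_mono mult_left_mono) auto
    finally have "c * h (x 0 - yd + z) \<le> c * (h (x' 0 - yd' + z) + M * ?s)"
      by (rule mult_left_mono) (rule q)
    then have "period_hold (x 0 - yd + z) \<le> ennreal (c * h (x' 0 - yd' + z) + c * (M * ?s))"
      unfolding period_hold_def c_def[symmetric] by (intro ennreal_leI) (simp add: distrib_left)
    then have 2: "period_hold (x 0 - yd + z) \<le> period_hold (x' 0 - yd' + z) + ennreal (c * (M * ?s))"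
      unfolding period_hold_def c_def[symmetric] using q M_pos \<open>0 \<le> ?s\<close> by (subst (asm) ennreal_plus) auto
    have "ennreal (M / \<gamma> * ?s) + ennreal (c * (M * ?s)) = ennreal (M / \<gamma> * ?s + c * (M * ?s))"
      using q M_pos \<gamma>_pos \<open>0 \<le> ?s\<close> by (subst ennreal_plus) auto
    also have "M / \<gamma> * ?s + c * (M * ?s) = (2 - \<alpha>) * (M / \<gamma>) * ?s"
      using \<gamma>_pos by (simp add: c_def field_simps)
    finally have "ennreal (M / \<gamma> * ?s) + ennreal (c * (M * ?s)) = ennreal ((2 - \<alpha>) * (M / \<gamma>) * ?s)" .
    then show ?thesis
      using add_mono[OF 1 2] by (simp add: ac_simps)
  qed
  have [measurable]: "(\<lambda>z. V (next_state n x' yu' yd' z)) \<in> borel_measurable demand_law"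
    using measurable_compose[OF next_state_measurable_demand regular_measurable[OF V]] .
  let ?I = "\<integral>\<^sup>+ z. V (next_state n x' yu' yd' z) + period_hold (x' 0 - yd' + z) \<partial>demand_law"
  have "(\<integral>\<^sup>+ z. V (next_state n x yu yd z) + period_hold (x 0 - yd + z) \<partial>demand_law)
      \<le> (\<integral>\<^sup>+ z. (V (next_state n x' yu' yd' z) + period_hold (x' 0 - yd' + z)) + ennreal ((2 - \<alpha>) * (M / \<gamma>) * ?s) \<partial>demand_law)"
    by (intro nn_integral_mono pointwise)
  also have "\<dots> = ?I + ennreal ((2 - \<alpha>) * (M / \<gamma>) * ?s)"
    by (subst nn_integral_add) (auto simp: demand.emeasure_space_1)
  finally have "ennreal \<alpha> * (\<integral>\<^sup>+ z. V (next_state n x yu yd z) + period_hold (x 0 - yd + z) \<partial>demand_law)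
      \<le> ennreal \<alpha> * ?I + ennreal (\<alpha> * ((2 - \<alpha>) * (M / \<gamma>) * ?s))"
    using \<alpha>_bounds by (subst ennreal_mult') (auto simp: distrib_left[symmetric] intro!: mult_left_mono)
  also have "\<dots> \<le> ennreal \<alpha> * ?I + ennreal (M / \<gamma> * ?s)"
  proof -
    have "\<alpha> * (2 - \<alpha>) \<le> 1" using sum_squares_ge_zero[of "1 - \<alpha>" 0] by (simp add: algebra_simps)
    then have "(\<alpha> * (2 - \<alpha>)) * (M / \<gamma> * ?s) \<le> 1 * (M / \<gamma> * ?s)"
      using M_pos \<gamma>_pos \<open>0 \<le> ?s\<close> by (intro mult_right_mono) auto
    then show ?thesis by (intro add_left_mono ennreal_leI) (simp add: mult.assoc)
  qed
  finally have 3: "ennreal \<alpha> * (\<integral>\<^sup>+ z. V (next_state n x yu yd z) + period_hold (x 0 - yd + z) \<partial>demand_law)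
      \<le> ennreal \<alpha> * ?I + ennreal (M / \<gamma> * ?s)" .
  have "kup * yu + kdn * yd \<le> (kup * yu' + kdn * yd') + (kup * \<bar>yu - yu'\<bar> + kdn * \<bar>yd - yd'\<bar>)"
  proof -
    have "kup * yu \<le> kup * (yu' + \<bar>yu - yu'\<bar>)" "kdn * yd \<le> kdn * (yd' + \<bar>yd - yd'\<bar>)"
      using kup_pos kdn_pos by (auto intro!: mult_left_mono)
    then show ?thesis by (simp add: algebra_simps)
  qed
  then have 4: "ennreal (kup * yu + kdn * yd)
      \<le> ennreal (kup * yu' + kdn * yd') + ennreal (kup * \<bar>yu - yu'\<bar> + kdn * \<bar>yd - yd'\<bar>)"
    using y kup_pos kdn_pos by (subst ennreal_plus[symmetric]) (auto intro!: ennreal_leI simp del: ennreal_plus)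
  have 5: "ennreal (kup * \<bar>yu - yu'\<bar> + kdn * \<bar>yd - yd'\<bar>) + ennreal (M / \<gamma> * ?s)
      = ennreal (M / \<gamma> * r + (kup + M / \<gamma>) * \<bar>yu - yu'\<bar> + (kdn + M / \<gamma>) * \<bar>yd - yd'\<bar>)"
    using kup_pos kdn_pos M_pos \<gamma>_pos mult_nonneg_nonneg[OF _ \<open>0 \<le> ?s\<close>, of "M / \<gamma>"]
    by (subst ennreal_plus[symmetric]) (auto simp: ring_distribs ac_simps simp del: ennreal_plus intro!: arg_cong[where f=ennreal])
  show ?thesis
    using add_mono[OF 4 3] unfolding stage_value_def 5[symmetric] by (simp only: ac_simps)
qed

lemma stage_value_measurable:
  assumes V [measurable]: "regular V"
    and z [measurable]: "z \<in> measurable N states"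
    and [measurable]: "a \<in> borel_measurable N" "b \<in> borel_measurable N"
  shows "(\<lambda>\<omega>. stage_value V (z \<omega>) (a \<omega>) (b \<omega>)) \<in> borel_measurable N"
proof -
  have z0 [measurable]: "(\<lambda>p. z (fst p) 0) \<in> borel_measurable (N \<Otimes>\<^sub>M borel)"
    by (rule component_measurable) measurable
  have [measurable]: "(\<lambda>p. V (next_state n (z (fst p)) (a (fst p)) (b (fst p)) (snd p))) \<in> borel_measurable (N \<Otimes>\<^sub>M borel)"
    by (intro measurable_compose[OF next_state_measurable regular_measurable[OF V]]) measurable
  have "(\<lambda>p. period_hold (z (fst p) 0 - b (fst p) + snd p)) \<in> borel_measurable (N \<Otimes>\<^sub>M borel)"
    by (intro measurable_compose[OF _ period_hold_measurable]) measurable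
  then have "(\<lambda>p. V (next_state n (z (fst p)) (a (fst p)) (b (fst p)) (snd p)) + period_hold (z (fst p) 0 - b (fst p) + snd p))
      \<in> borel_measurable (N \<Otimes>\<^sub>M borel)"
    by (intro borel_measurable_add) simp_all
  then have "(\<lambda>p. V (next_state n (z (fst p)) (a (fst p)) (b (fst p)) (snd p)) + period_hold (z (fst p) 0 - b (fst p) + snd p))
      \<in> borel_measurable (N \<Otimes>\<^sub>M demand_law)"
    by (simp cong: measurable_cong_sets sets_pair_measure_cong add: sets_demand_law)
  then have [measurable]: "(\<lambda>\<omega>. \<integral>\<^sup>+ d. V (next_state n (z \<omega>) (a \<omega>) (b \<omega>) d) + period_hold (z \<omega> 0 - b \<omega> + d) \<partial>demand_law)
      \<in> borel_measurable N"
    by (intro demand.borel_measurable_nn_integral) (simp add: split_beta')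
  show ?thesis unfolding stage_value_def by measurable
qed

text \<open>An enumeration of all pairs of non-negative rational orders, indexed by a single natural number so
  that the least nearly minimising index can be selected measurably.\<close>

definition order_up :: "nat \<Rightarrow> real" where "order_up k = \<bar>of_rat (fst (from_nat k :: rat \<times> rat))\<bar>"
definition order_down :: "nat \<Rightarrow> real" where "order_down k = \<bar>of_rat (snd (from_nat k :: rat \<times> rat))\<bar>"

lemma order_nonneg [simp]: "0 \<le> order_up k" "0 \<le> order_down k"
  by (simp_all add: order_up_def order_down_def)

lemma orders_dense:
  assumes "0 \<le> yu" "0 \<le> yd" "0 < e"
  obtains k where "\<bar>order_up k - yu\<bar> < e" "\<bar>order_down k - yd\<bar> < e"
proof -
  obtain p q :: rat where p: "yu < of_rat p" "of_rat p < yu + e" and q: "yd < of_rat q" "of_rat q < yd + e"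
    using of_rat_dense[of yu "yu + e"] of_rat_dense[of yd "yd + e"] \<open>0 < e\<close> by auto
  show thesis
  proof (rule that)
    show "\<bar>order_up (to_nat (p, q)) - yu\<bar> < e" "\<bar>order_down (to_nat (p, q)) - yd\<bar> < e"
      unfolding order_up_def order_down_def from_nat_to_nat fst_conv snd_conv using p q assms(1,2) by linarith+
  qed
qed

lemma stage_value_approx:
  assumes V: "regular V" and "0 \<le> yu" "0 \<le> yd" "0 < e"
  obtains k where "stage_value V x (order_up k) (order_down k) \<le> stage_value V x yu yd + ennreal e"
proof -
  let ?L = "(kup + M / \<gamma>) + (kdn + M / \<gamma>)"
  have "0 < kup + M / \<gamma>" "0 < kdn + M / \<gamma>" using kup_pos kdn_pos M_pos \<gamma>_pos by (simp_all add: add_pos_pos)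
  then have L: "0 < ?L" by simp
  obtain k where k: "\<bar>order_up k - yu\<bar> < e / ?L" "\<bar>order_down k - yd\<bar> < e / ?L"
    using orders_dense[of yu yd "e / ?L"] assms L by auto
  have "(kup + M / \<gamma>) * \<bar>order_up k - yu\<bar> + (kdn + M / \<gamma>) * \<bar>order_down k - yd\<bar>
      \<le> (kup + M / \<gamma>) * (e / ?L) + (kdn + M / \<gamma>) * (e / ?L)"
    using k \<open>0 < kup + M / \<gamma>\<close> \<open>0 < kdn + M / \<gamma>\<close> by (intro add_mono mult_left_mono) auto
  also have "\<dots> = e" using L by (simp only: distrib_right[symmetric]) simp
  finally have "stage_value V x (order_up k) (order_down k) \<le> stage_value V x yu yd + ennreal e"
    using stage_value_lipschitz[OF V, of x x 0 "order_up k" "order_down k" yu yd] assms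
    by (auto intro: order_trans add_left_mono ennreal_leI)
  then show thesis by (rule that)
qed

lemma bellman_eq_INF_orders:
  assumes V: "regular V"
  shows "bellman V x = (INF k. stage_value V x (order_up k) (order_down k))"
proof (rule antisym)
  show "bellman V x \<le> (INF k. stage_value V x (order_up k) (order_down k))"
    unfolding bellman_def
    by (rule INF_greatest, rule INF_lower2[where i="(order_up _, order_down _)"]) auto
  show "(INF k. stage_value V x (order_up k) (order_down k)) \<le> bellman V x"
    unfolding bellman_def
  proof (rule INF_greatest, clarsimp)
    fix yu yd :: real assume y: "0 \<le> yu" "0 \<le> yd"
    show "(INF k. stage_value V x (order_up k) (order_down k)) \<le> stage_value V x yu yd"
    proof (rule ennreal_le_epsilon)
      fix e :: real assume "0 < e"
      then obtain k where "stage_value V x (order_up k) (order_down k) \<le> stage_value V x yu yd + ennreal e"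
        using stage_value_approx[OF V y] by blast
      then show "(INF k. stage_value V x (order_up k) (order_down k)) \<le> stage_value V x yu yd + ennreal e"
        by (intro INF_lower2[of k]) auto
    qed
  qed
qed

lemma regular_bellman:
  assumes V: "regular V"
  shows "regular (bellman V)"
  unfolding regular_def
proof (intro conjI allI impI)
  have "(\<lambda>x. INF k. stage_value V x (order_up k) (order_down k)) \<in> borel_measurable states"
    by (intro borel_measurable_INF stage_value_measurable[OF V]) auto
  then show "bellman V \<in> borel_measurable states"
    by (subst measurable_cong[OF bellman_eq_INF_orders[OF V]])
  fix x x' :: "nat \<Rightarrow> real" and r assume r: "\<forall>i<n. \<bar>x i - x' i\<bar> \<le> r"
  have "(INF k. stage_value V x (order_up k) (order_down k))
      \<le> (INF k. stage_value V x' (order_up k) (order_down k) + ennreal (M / \<gamma> * r))"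
    using stage_value_lipschitz[OF V, of x x' r "order_up k" "order_down k" "order_up k" "order_down k" for k] r
    by (intro INF_mono) auto
  also have "\<dots> = (INF k. stage_value V x' (order_up k) (order_down k)) + ennreal (M / \<gamma> * r)"
    by (rule INF_ennreal_add_const)
  finally show "bellman V x \<le> bellman V x' + ennreal (M / \<gamma> * r)"
    unfolding bellman_eq_INF_orders[OF V] .
qed

lemma bellman_mono: "(\<And>x. V x \<le> W x) \<Longrightarrow> bellman V x \<le> bellman W x"
  unfolding bellman_def by (rule INF_mono) (auto intro: stage_value_mono)

definition horizon_value :: "nat \<Rightarrow> (nat \<Rightarrow> real) \<Rightarrow> ennreal" where
  "horizon_value T = (bellman ^^ T) (\<lambda>_. 0)"

lemma horizon_value_Suc: "horizon_value (Suc T) = bellman (horizon_value T)"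
  by (simp add: horizon_value_def)

lemma horizon_value_0 [simp]: "horizon_value 0 x = 0"
  by (simp add: horizon_value_def)

lemma regular_horizon_value: "regular (horizon_value T)"
proof (induction T)
  case 0 then show ?case by (simp add: horizon_value_def regular_def)
next
  case (Suc T) then show ?case by (simp add: horizon_value_Suc regular_bellman)
qed

lemma horizon_value_le_Suc: "horizon_value T x \<le> horizon_value (Suc T) x"
proof (induction T arbitrary: x)
  case (Suc T)
  then show ?case unfolding horizon_value_Suc[of T] horizon_value_Suc[of "Suc T"] by (rule bellman_mono)
qed simp

lemma incseq_horizon_value: "incseq (\<lambda>T. horizon_value T x)"
  by (rule incseq_SucI) (rule horizon_value_le_Suc)

lemma finite_horizon_cost_eq:
  assumes "t \<le> T"
  shows "finite_horizon_cost l \<gamma> \<mu> \<sigma> kup kdn h P n T t = horizon_value (T - t)"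
  using assms
proof (induction t rule: inc_induct)
  case base
  then show ?case by (simp add: finite_horizon_cost.simps fun_eq_iff)
next
  case (step t)
  then have "T - t = Suc (T - Suc t)" by simp
  moreover have "finite_horizon_cost l \<gamma> \<mu> \<sigma> kup kdn h P n T (Suc t) = horizon_value (T - Suc t)"
    by (rule step.IH)
  ultimately show ?case
    using step(2)
    by (subst finite_horizon_cost.simps)
      (auto simp: period_cost_eq[OF regular_horizon_value] horizon_value_Suc bellman_def[abs_def]
        intro!: ext INF_cong)
qed

definition limit_value :: "(nat \<Rightarrow> real) \<Rightarrow> ennreal" where
  "limit_value x = (SUP T. horizon_value T x)"

lemma infinite_horizon_cost_eq:
  "infinite_horizon_cost l \<gamma> \<mu> \<sigma> kup kdn h P n x = limit_value x"
  unfolding infinite_horizon_cost_def limit_value_def finite_horizon_cost_eq[OF le0] diff_zero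
  by (rule limI, rule LIMSEQ_SUP, rule incseq_horizon_value)

lemma regular_limit_value: "regular limit_value"
  unfolding regular_def
proof (intro conjI allI impI)
  show "limit_value \<in> borel_measurable states"
    unfolding limit_value_def[abs_def]
    by (intro borel_measurable_SUP regular_measurable[OF regular_horizon_value]) simp
  fix x x' :: "nat \<Rightarrow> real" and r assume r: "\<forall>i<n. \<bar>x i - x' i\<bar> \<le> r"
  show "limit_value x \<le> limit_value x' + ennreal (M / \<gamma> * r)"
    unfolding limit_value_def
  proof (rule SUP_least)
    fix T
    have "horizon_value T x \<le> horizon_value T x' + ennreal (M / \<gamma> * r)"
      using r by (intro regularD[OF regular_horizon_value]) auto
    also have "\<dots> \<le> (SUP T. horizon_value T x') + ennreal (M / \<gamma> * r)"
      by (intro add_right_mono SUP_upper) simp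
    finally show "horizon_value T x \<le> (SUP T. horizon_value T x') + ennreal (M / \<gamma> * r)" .
  qed
qed

text \<open>Monotone convergence in the horizon, for a fixed order.\<close>

lemma stage_value_limit_value:
  "stage_value limit_value x yu yd = (SUP T. stage_value (horizon_value T) x yu yd)"
proof -
  have meas: "(\<lambda>z. horizon_value T (next_state n x yu yd z)) \<in> borel_measurable demand_law" for T
    using measurable_compose[OF next_state_measurable_demand regular_measurable[OF regular_horizon_value]] .
  have [measurable]: "(\<lambda>z. period_hold (x 0 - yd + z)) \<in> borel_measurable demand_law"
    by measurable
  have "(\<integral>\<^sup>+ z. limit_value (next_state n x yu yd z) + period_hold (x 0 - yd + z) \<partial>demand_law)
     = (\<integral>\<^sup>+ z. (SUP T. horizon_value T (next_state n x yu yd z) + period_hold (x 0 - yd + z)) \<partial>demand_law)"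
    unfolding limit_value_def by (subst ennreal_SUP_add_left) auto
  also have "\<dots> = (SUP T. \<integral>\<^sup>+ z. horizon_value T (next_state n x yu yd z) + period_hold (x 0 - yd + z) \<partial>demand_law)"
    using meas incseq_horizon_value
    by (intro nn_integral_monotone_convergence_SUP)
      (auto simp: incseq_def le_fun_def intro!: add_right_mono borel_measurable_add)
  finally show ?thesis
    unfolding stage_value_def by (simp add: SUP_mult_left_ennreal ennreal_SUP_add_right)
qed

text \<open>The orders that are nearly optimal for horizon \<open>T\<close> cost at most \<open>limit_value x + 1\<close>, so they stay
  in a compact set because unit costs are positive.  A limit point \<open>y'\<close> works: for fixed \<open>S\<close>, the
  orders chosen for the horizons \<open>T \<ge> S\<close> have stage value at most \<open>limit_value x + 1 / (T + 1)\<close>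
  under the value for horizon \<open>S\<close>.  By continuity in the order, the stage value of \<open>y'\<close> for
  horizon \<open>S\<close> is at most \<open>limit_value x\<close>, and \<open>S\<close> can then tend to infinity.\<close>

lemma limit_value_attained:
  obtains yu yd where "0 \<le> yu" "0 \<le> yd" "stage_value limit_value x yu yd \<le> limit_value x"
proof (cases "limit_value x = \<infinity>")
  case True
  then show thesis using that[of 0 0] by simp
next
  case False
  then obtain v where v: "limit_value x = ennreal v" "0 \<le> v"
    by (cases "limit_value x") auto
  have "\<exists>y. 0 \<le> fst y \<and> 0 \<le> snd y \<and>
      stage_value (horizon_value T) x (fst y) (snd y) \<le> limit_value x + ennreal (1 / real (Suc T))" for T
  proof -
    have "bellman (horizon_value T) x \<le> limit_value x"
      unfolding limit_value_def horizon_value_Suc[symmetric] by (rule SUP_upper) simp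
    also have "limit_value x < limit_value x + ennreal (1 / real (Suc T))"
    proof -
      have "ennreal v < ennreal (v + 1 / real (Suc T))" using v by (intro ennreal_lessI) (auto simp: add_nonneg_pos)
      also have "\<dots> = limit_value x + ennreal (1 / real (Suc T))" unfolding v(1) using v(2) by (intro ennreal_plus) auto
      finally show ?thesis unfolding v(1) .
    qed
    finally obtain k where "stage_value (horizon_value T) x (order_up k) (order_down k)
        < limit_value x + ennreal (1 / real (Suc T))"
      unfolding bellman_eq_INF_orders[OF regular_horizon_value] INF_less_iff by blast
    then show ?thesis
      by (intro exI[of _ "(order_up k, order_down k)"]) (simp add: less_imp_le)
  qed
  then obtain y where y: "\<And>T. 0 \<le> fst (y T)" "\<And>T. 0 \<le> snd (y T)"
    "\<And>T. stage_value (horizon_value T) x (fst (y T)) (snd (y T)) \<le> limit_value x + ennreal (1 / real (Suc T))"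
    by metis
  have bound: "kup * fst (y T) + kdn * snd (y T) \<le> v + 1" for T
  proof -
    have "ennreal (kup * fst (y T) + kdn * snd (y T)) \<le> stage_value (horizon_value T) x (fst (y T)) (snd (y T))"
      unfolding stage_value_def by simp
    also have "\<dots> \<le> limit_value x + ennreal (1 / real (Suc T))" by (rule y(3))
    also have "\<dots> \<le> limit_value x + ennreal 1" by (intro add_left_mono ennreal_leI) simp
    also have "\<dots> = ennreal (v + 1)" using v by (simp add: ennreal_plus)
    finally show ?thesis using v by (subst (asm) ennreal_le_iff) auto
  qed
  have "compact ({0..(v + 1) / kup} \<times> {0..(v + 1) / kdn})"
    by (intro compact_Times) auto
  moreover have "y T \<in> {0..(v + 1) / kup} \<times> {0..(v + 1) / kdn}" for T
  proof -
    have "kup * fst (y T) \<le> v + 1" "kdn * snd (y T) \<le> v + 1"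
      using bound[of T] y(1,2)[of T] kup_pos kdn_pos
      by (smt (verit) mult_nonneg_nonneg)+
    then show ?thesis
      using y(1,2)[of T] kup_pos kdn_pos by (auto simp: mem_Times_iff field_simps)
  qed
  ultimately obtain y' r where y': "y' \<in> {0..(v + 1) / kup} \<times> {0..(v + 1) / kdn}"
    and r: "strict_mono r" "(y \<circ> r) \<longlonglongrightarrow> y'"
    unfolding compact_def by meson
  have "stage_value (horizon_value S) x (fst y') (snd y') \<le> limit_value x" for S
  proof (rule LIMSEQ_le_const[rotated])
    let ?b = "\<lambda>k. limit_value x + ennreal (1 / real (Suc (r k)))
      + ennreal ((kup + M / \<gamma>) * \<bar>fst y' - fst (y (r k))\<bar> + (kdn + M / \<gamma>) * \<bar>snd y' - snd (y (r k))\<bar>)"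
    show "\<exists>N. \<forall>k\<ge>N. stage_value (horizon_value S) x (fst y') (snd y') \<le> ?b k"
    proof (intro exI allI impI)
      fix k assume "S \<le> k"
      then have "S \<le> r k" using strict_mono_imp_increasing[OF r(1), of k] by simp
      then have "horizon_value S x \<le> horizon_value (r k) x" for x
        using incseq_horizon_value by (auto simp: incseq_def)
      then have "stage_value (horizon_value S) x (fst (y (r k))) (snd (y (r k))) \<le> limit_value x + ennreal (1 / real (Suc (r k)))"
        using y(3)[of "r k"] stage_value_mono order_trans by blast
      then show "stage_value (horizon_value S) x (fst y') (snd y') \<le> ?b k"
        using stage_value_lipschitz[OF regular_horizon_value[of S], of x x 0 "fst y'" "snd y'" "fst (y (r k))" "snd (y (r k))"] y' y(1,2)
        by (auto simp: mem_Times_iff intro: order_trans add_right_mono)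
    qed
    have "(\<lambda>k. 1 / real (Suc (r k))) \<longlonglongrightarrow> 0"
      using LIMSEQ_subseq_LIMSEQ[OF LIMSEQ_inverse_real_of_nat r(1)] by (simp add: o_def inverse_eq_divide)
    moreover have "(\<lambda>k. fst (y (r k))) \<longlonglongrightarrow> fst y'" "(\<lambda>k. snd (y (r k))) \<longlonglongrightarrow> snd y'"
      using tendsto_fst[OF r(2)] tendsto_snd[OF r(2)] by (simp_all add: o_def)
    then have "(\<lambda>k. (kup + M / \<gamma>) * \<bar>fst y' - fst (y (r k))\<bar> + (kdn + M / \<gamma>) * \<bar>snd y' - snd (y (r k))\<bar>)
        \<longlonglongrightarrow> (kup + M / \<gamma>) * \<bar>fst y' - fst y'\<bar> + (kdn + M / \<gamma>) * \<bar>snd y' - snd y'\<bar>"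
      by (intro tendsto_add tendsto_mult tendsto_const tendsto_rabs tendsto_diff)
    ultimately have "?b \<longlonglongrightarrow> limit_value x + ennreal 0
        + ennreal ((kup + M / \<gamma>) * \<bar>fst y' - fst y'\<bar> + (kdn + M / \<gamma>) * \<bar>snd y' - snd y'\<bar>)"
      by (intro tendsto_add[OF tendsto_add[OF tendsto_const]] tendsto_ennrealI)
    then show "?b \<longlonglongrightarrow> limit_value x" by simp
  qed
  then have "stage_value limit_value x (fst y') (snd y') \<le> limit_value x"
    unfolding stage_value_limit_value by (rule SUP_least)
  then show thesis using that[of "fst y'" "snd y'"] y' by (auto simp: mem_Times_iff)
qed

definition near_best :: "real \<Rightarrow> (nat \<Rightarrow> real) \<Rightarrow> nat" where
  "near_best e x = (LEAST k. stage_value limit_value x (order_up k) (order_down k) \<le> limit_value x + ennreal e)"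

lemma near_best:
  assumes "0 < e"
  shows "stage_value limit_value x (order_up (near_best e x)) (order_down (near_best e x)) \<le> limit_value x + ennreal e"
proof -
  obtain yu yd where y: "0 \<le> yu" "0 \<le> yd" "stage_value limit_value x yu yd \<le> limit_value x"
    by (rule limit_value_attained)
  obtain k where "stage_value limit_value x (order_up k) (order_down k) \<le> stage_value limit_value x yu yd + ennreal e"
    by (rule stage_value_approx[OF regular_limit_value y(1,2) assms])
  then have "stage_value limit_value x (order_up k) (order_down k) \<le> limit_value x + ennreal e"
    using y(3) by (meson add_right_mono order_trans)
  then show ?thesis unfolding near_best_def by (rule LeastI)
qed

lemma near_best_measurable: "near_best e \<in> measurable states (count_space UNIV)"
proof -
  have "{x \<in> space states. stage_value limit_value x (order_up k) (order_down k) \<le> limit_value x + ennreal e}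
      \<in> sets states" for k
    by (intro borel_measurable_le stage_value_measurable[OF regular_limit_value] borel_measurable_add
        regular_measurable[OF regular_limit_value]) auto
  then show ?thesis
    unfolding near_best_def[abs_def] by (intro measurable_Least) (simp add: pred_def)
qed

end

section \<open>Adapted plans and the value of the dynamic program\<close>

lemma discounted_indicator_interval:
  assumes "0 < \<gamma>" "0 \<le> a" "a \<le> b"
  shows "discounted \<gamma> (\<lambda>u. c * indicator {a..<b} u) = c * ennreal ((exp (- \<gamma> * a) - exp (- \<gamma> * b)) / \<gamma>)"
proof -
  have eb: "exp (- \<gamma> * b) \<le> exp (- \<gamma> * a)" using assms by simp
  have "discounted \<gamma> (\<lambda>u. indicator {a..<b} u) + ennreal (exp (- \<gamma> * b) / \<gamma>) = ennreal (exp (- \<gamma> * a) / \<gamma>)"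
  proof -
    have "discounted \<gamma> (indicator {a..<b}) + discounted \<gamma> (indicator {b..}) = discounted \<gamma> (indicator {a..})"
      using \<open>a \<le> b\<close> by (subst discounted_add[symmetric]) (auto intro!: discounted_cong simp: indicator_def)
    then show ?thesis
      using discounted_indicator_atLeast[of \<gamma> a 1] discounted_indicator_atLeast[of \<gamma> b 1] assms by simp
  qed
  then have "discounted \<gamma> (\<lambda>u. indicator {a..<b} u) = ennreal (exp (- \<gamma> * a) / \<gamma>) - ennreal (exp (- \<gamma> * b) / \<gamma>)"
    by (metis ennreal_add_diff_cancel_right ennreal_neq_top)
  also have "\<dots> = ennreal ((exp (- \<gamma> * a) - exp (- \<gamma> * b)) / \<gamma>)"
    using assms by (subst ennreal_minus) (auto simp: diff_divide_distrib)
  finally show ?thesis by (subst discounted_cmult) auto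
qed

lemma discounted_suminf:
  assumes [measurable]: "\<And>t. f t \<in> borel_measurable borel"
  shows "discounted \<gamma> (\<lambda>u. \<Sum>t. f t u) = (\<Sum>t. discounted \<gamma> (f t))"
  unfolding discounted_def
  by (subst nn_integral_suminf[symmetric]) (auto simp: ennreal_suminf_cmult ennreal_suminf_multc)

lemma initial_state_late: "X \<in> initial_states l \<Longrightarrow> l \<le> u \<Longrightarrow> X u = X l"
  unfolding initial_states_def by blast

context periodic_system
begin

definition demand :: "nat \<Rightarrow> (real \<Rightarrow> real) \<Rightarrow> real" where
  "demand t \<omega> = \<omega> (real t * period + period) - \<omega> (real t * period)"

text \<open>Orders may depend on the whole path up to the review time, and not only on the current state.\<close>

definition adapted :: "(nat \<Rightarrow> (real \<Rightarrow> real) \<Rightarrow> real) \<Rightarrow> bool" where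
  "adapted a \<longleftrightarrow> (\<forall>t. a t \<in> borel_measurable (path_filtration (real t * period)) \<and>
     (\<forall>\<omega>\<in>path_space. 0 \<le> a t \<omega>))"

primrec plan_state ::
  "(nat \<Rightarrow> real) \<Rightarrow> (nat \<Rightarrow> (real \<Rightarrow> real) \<Rightarrow> real) \<Rightarrow> (nat \<Rightarrow> (real \<Rightarrow> real) \<Rightarrow> real)
     \<Rightarrow> nat \<Rightarrow> (real \<Rightarrow> real) \<Rightarrow> nat \<Rightarrow> real" where
  "plan_state x a b 0 \<omega> = x"
| "plan_state x a b (Suc t) \<omega> = next_state n (plan_state x a b t \<omega>) (a t \<omega>) (b t \<omega>) (demand t \<omega>)"

definition stage_cost ::
  "(nat \<Rightarrow> real) \<Rightarrow> (nat \<Rightarrow> (real \<Rightarrow> real) \<Rightarrow> real) \<Rightarrow> (nat \<Rightarrow> (real \<Rightarrow> real) \<Rightarrow> real)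
     \<Rightarrow> nat \<Rightarrow> (real \<Rightarrow> real) \<Rightarrow> ennreal" where
  "stage_cost x a b t \<omega> = ennreal (kup * a t \<omega> + kdn * b t \<omega>)
     + ennreal \<alpha> * period_hold (plan_state x a b t \<omega> 0 - b t \<omega> + demand t \<omega>)"

lemma demand_measurable: "demand t \<in> borel_measurable (path_filtration (real (Suc t) * period))"
  unfolding demand_def[abs_def] path_filtration_def using period_pos
  by (intro borel_measurable_diff coordinate_measurable) (auto simp: algebra_simps)

lemma step_measurable:
  assumes z: "z \<in> measurable (path_filtration (real t * period)) states"
    and a: "a \<in> borel_measurable (path_filtration (real t * period))"
    and b: "b \<in> borel_measurable (path_filtration (real t * period))"
  shows "(\<lambda>\<omega>. next_state n (z \<omega>) (a \<omega>) (b \<omega>) (demand t \<omega>))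
      \<in> measurable (path_filtration (real (Suc t) * period)) states"
proof -
  have le: "real t * period \<le> real (Suc t) * period" using period_pos by (intro mult_right_mono) auto
  show ?thesis
    by (intro next_state_measurable demand_measurable path_filtration_measurable_mono[OF _ le] assms)
qed

lemma plan_state_measurable:
  assumes "x \<in> space states" "adapted a" "adapted b"
  shows "plan_state x a b t \<in> measurable (path_filtration (real t * period)) states"
proof (induction t)
  case 0
  have "plan_state x a b 0 = (\<lambda>_. x)" by (simp add: fun_eq_iff)
  then show ?case using assms(1) by simp
next
  case (Suc t)
  have "plan_state x a b (Suc t) = (\<lambda>\<omega>. next_state n (plan_state x a b t \<omega>) (a t \<omega>) (b t \<omega>) (demand t \<omega>))"
    by (simp add: fun_eq_iff)
  then show ?case
    using step_measurable[OF Suc, of "a t" "b t"] assms(2,3) by (simp only: adapted_def)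
qed

lemma stage_cost_measurable:
  assumes "x \<in> space states" "adapted a" "adapted b"
  shows "stage_cost x a b t \<in> borel_measurable P"
proof -
  have [measurable]: "a t \<in> borel_measurable P" "b t \<in> borel_measurable P" "demand t \<in> borel_measurable P"
    using assms(2,3) path_filtration_measurable_P[OF demand_measurable]
    by (auto simp: adapted_def intro: path_filtration_measurable_P)
  have [measurable]: "(\<lambda>\<omega>. plan_state x a b t \<omega> 0) \<in> borel_measurable P"
    by (rule component_measurable[OF path_filtration_measurable_P[OF plan_state_measurable[OF assms]]])
  show ?thesis unfolding stage_cost_def[abs_def] by measurable
qed

text \<open>State and order are functions of the path up to the review time, so the demand inside
  \<open>stage_value\<close> may be replaced by the actual increment of the path.\<close>

lemma nn_integral_stage_value:
  assumes V: "regular V" and x: "x \<in> space states" and a: "adapted a" and b: "adapted b"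
  shows "(\<integral>\<^sup>+ \<omega>. stage_value V (plan_state x a b t \<omega>) (a t \<omega>) (b t \<omega>) \<partial>P)
    = (\<integral>\<^sup>+ \<omega>. stage_cost x a b t \<omega> + ennreal \<alpha> * V (plan_state x a b (Suc t) \<omega>) \<partial>P)"
proof -
  let ?s = "real t * period"
  let ?F = "path_filtration ?s"
  let ?z = "plan_state x a b t"
  have z: "?z \<in> measurable ?F states" by (rule plan_state_measurable[OF x a b])
  have at: "a t \<in> borel_measurable ?F" and bt: "b t \<in> borel_measurable ?F"
    using a b by (auto simp: adapted_def)
  define f where "f p = ennreal (kup * a t (fst p) + kdn * b t (fst p)) + ennreal \<alpha> *
    (V (next_state n (?z (fst p)) (a t (fst p)) (b t (fst p)) (snd p))
      + period_hold (?z (fst p) 0 - b t (fst p) + snd p))" for p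
  have z': "(\<lambda>p. ?z (fst p)) \<in> measurable (?F \<Otimes>\<^sub>M borel) states"
    and [measurable]: "(\<lambda>p. a t (fst p)) \<in> borel_measurable (?F \<Otimes>\<^sub>M borel)"
      "(\<lambda>p. b t (fst p)) \<in> borel_measurable (?F \<Otimes>\<^sub>M borel)"
    using z at bt by (auto intro: measurable_compose[OF measurable_fst])
  note [measurable] = component_measurable[OF z']
  have [measurable]: "(\<lambda>p. V (next_state n (?z (fst p)) (a t (fst p)) (b t (fst p)) (snd p))) \<in> borel_measurable (?F \<Otimes>\<^sub>M borel)"
    by (intro measurable_compose[OF next_state_measurable regular_measurable[OF V]] z') measurable
  have f: "f \<in> borel_measurable (?F \<Otimes>\<^sub>M borel)" unfolding f_def[abs_def] by measurable
  have "(\<integral>\<^sup>+ \<omega>. f (\<omega>, demand t \<omega>) \<partial>P) = (\<integral>\<^sup>+ \<omega>. (\<integral>\<^sup>+ d. f (\<omega>, d) \<partial>demand_law) \<partial>P)"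
    unfolding demand_def using period_pos by (intro nn_integral_increment f) auto
  moreover have "(\<integral>\<^sup>+ d. f (\<omega>, d) \<partial>demand_law) = stage_value V (?z \<omega>) (a t \<omega>) (b t \<omega>)" for \<omega>
  proof -
    have [measurable]: "(\<lambda>d. V (next_state n (?z \<omega>) (a t \<omega>) (b t \<omega>) d)) \<in> borel_measurable demand_law"
      using measurable_compose[OF next_state_measurable_demand regular_measurable[OF V]] .
    have [measurable]: "(\<lambda>d. period_hold (?z \<omega> 0 - b t \<omega> + d)) \<in> borel_measurable demand_law"
      by measurable
    show ?thesis
      unfolding f_def stage_value_def fst_conv snd_conv
      by (subst nn_integral_add, simp, simp, subst nn_integral_cmult) (auto simp: demand.emeasure_space_1)
  qed
  ultimately show ?thesis
    by (simp add: f_def stage_cost_def distrib_left ac_simps)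
qed

text \<open>Verification: the cost of the first \<open>k\<close> periods plus the discounted value of the remaining
  periods does not fall below the initial value, by induction on \<open>k\<close>.\<close>

lemma horizon_value_le_plan:
  assumes x: "x \<in> space states" and a: "adapted a" and b: "adapted b"
  shows "horizon_value T x \<le> (\<integral>\<^sup>+ \<omega>. (\<Sum>t. ennreal (\<alpha> ^ t) * stage_cost x a b t \<omega>) \<partial>P)"
proof -
  let ?z = "plan_state x a b"
  note [measurable] = stage_cost_measurable[OF x a b]
  have [measurable]: "(\<lambda>\<omega>. horizon_value m (?z k \<omega>)) \<in> borel_measurable P" for m k
    by (rule measurable_compose[OF path_filtration_measurable_P[OF plan_state_measurable[OF x a b]]
        regular_measurable[OF regular_horizon_value]])
  have "k \<le> T \<Longrightarrow> horizon_value T x \<le> (\<integral>\<^sup>+ \<omega>. (\<Sum>t<k. ennreal (\<alpha> ^ t) * stage_cost x a b t \<omega>)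
      + ennreal (\<alpha> ^ k) * horizon_value (T - k) (?z k \<omega>) \<partial>P)" for k
  proof (induction k)
    case 0 then show ?case by simp
  next
    case (Suc k)
    let ?W = "horizon_value (T - Suc k)"
    have eq: "T - k = Suc (T - Suc k)" using Suc.prems by simp
    have "(\<integral>\<^sup>+ \<omega>. ennreal (\<alpha> ^ k) * horizon_value (T - k) (?z k \<omega>) \<partial>P)
        \<le> (\<integral>\<^sup>+ \<omega>. ennreal (\<alpha> ^ k) * stage_value ?W (?z k \<omega>) (a k \<omega>) (b k \<omega>) \<partial>P)"
    proof (intro nn_integral_mono mult_left_mono)
      fix \<omega> assume "\<omega> \<in> space P"
      then show "horizon_value (T - k) (?z k \<omega>) \<le> stage_value ?W (?z k \<omega>) (a k \<omega>) (b k \<omega>)"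
        unfolding eq horizon_value_Suc bellman_def using a b
        by (intro INF_lower2[of "(a k \<omega>, b k \<omega>)"]) (auto simp: adapted_def)
    qed simp
    also have "\<dots> = ennreal (\<alpha> ^ k) * (\<integral>\<^sup>+ \<omega>. stage_value ?W (?z k \<omega>) (a k \<omega>) (b k \<omega>) \<partial>P)"
      using a b by (intro nn_integral_cmult stage_value_measurable regular_horizon_value
          path_filtration_measurable_P[OF plan_state_measurable[OF x a b]])
        (auto simp: adapted_def intro: path_filtration_measurable_P)
    also have "\<dots> = (\<integral>\<^sup>+ \<omega>. ennreal (\<alpha> ^ k) * (stage_cost x a b k \<omega> + ennreal \<alpha> * ?W (?z (Suc k) \<omega>)) \<partial>P)"
      unfolding nn_integral_stage_value[OF regular_horizon_value x a b]
      by (intro nn_integral_cmult[symmetric]) (simp del: plan_state.simps)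
    also have "\<dots> = (\<integral>\<^sup>+ \<omega>. ennreal (\<alpha> ^ k) * stage_cost x a b k \<omega>
        + ennreal (\<alpha> ^ Suc k) * ?W (?z (Suc k) \<omega>) \<partial>P)"
      using \<alpha>_bounds by (intro nn_integral_cong)
        (simp add: distrib_left mult.assoc[symmetric] ennreal_mult[symmetric] mult.commute del: plan_state.simps)
    finally have step: "(\<integral>\<^sup>+ \<omega>. ennreal (\<alpha> ^ k) * horizon_value (T - k) (?z k \<omega>) \<partial>P)
        \<le> (\<integral>\<^sup>+ \<omega>. ennreal (\<alpha> ^ k) * stage_cost x a b k \<omega> + ennreal (\<alpha> ^ Suc k) * ?W (?z (Suc k) \<omega>) \<partial>P)" .
    have "horizon_value T x \<le> (\<integral>\<^sup>+ \<omega>. (\<Sum>t<k. ennreal (\<alpha> ^ t) * stage_cost x a b t \<omega>) \<partial>P)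
        + (\<integral>\<^sup>+ \<omega>. ennreal (\<alpha> ^ k) * horizon_value (T - k) (?z k \<omega>) \<partial>P)"
    proof -
      have "(\<integral>\<^sup>+ \<omega>. (\<Sum>t<k. ennreal (\<alpha> ^ t) * stage_cost x a b t \<omega>) + ennreal (\<alpha> ^ k) * horizon_value (T - k) (?z k \<omega>) \<partial>P)
          = (\<integral>\<^sup>+ \<omega>. (\<Sum>t<k. ennreal (\<alpha> ^ t) * stage_cost x a b t \<omega>) \<partial>P)
            + (\<integral>\<^sup>+ \<omega>. ennreal (\<alpha> ^ k) * horizon_value (T - k) (?z k \<omega>) \<partial>P)"
        by (intro nn_integral_add) simp_all
      then show ?thesis using Suc.IH Suc.prems by simp
    qed
    also have "\<dots> \<le> (\<integral>\<^sup>+ \<omega>. (\<Sum>t<k. ennreal (\<alpha> ^ t) * stage_cost x a b t \<omega>) \<partial>P)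
        + (\<integral>\<^sup>+ \<omega>. ennreal (\<alpha> ^ k) * stage_cost x a b k \<omega> + ennreal (\<alpha> ^ Suc k) * ?W (?z (Suc k) \<omega>) \<partial>P)"
      by (intro add_left_mono step)
    also have "\<dots> = (\<integral>\<^sup>+ \<omega>. (\<Sum>t<k. ennreal (\<alpha> ^ t) * stage_cost x a b t \<omega>)
        + (ennreal (\<alpha> ^ k) * stage_cost x a b k \<omega> + ennreal (\<alpha> ^ Suc k) * ?W (?z (Suc k) \<omega>)) \<partial>P)"
      by (intro nn_integral_add[symmetric]) (simp_all del: plan_state.simps)
    finally show ?case by (simp add: add.assoc del: plan_state.simps)
  qed
  from this[of T] have "horizon_value T x \<le> (\<integral>\<^sup>+ \<omega>. (\<Sum>t<T. ennreal (\<alpha> ^ t) * stage_cost x a b t \<omega>) \<partial>P)"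
    by simp
  also have "\<dots> \<le> (\<integral>\<^sup>+ \<omega>. (\<Sum>t. ennreal (\<alpha> ^ t) * stage_cost x a b t \<omega>) \<partial>P)"
    by (intro nn_integral_mono sum_le_suminf) auto
  finally show ?thesis .
qed

lemma limit_value_le_plan:
  assumes "x \<in> space states" "adapted a" "adapted b"
  shows "limit_value x \<le> (\<integral>\<^sup>+ \<omega>. (\<Sum>t. ennreal (\<alpha> ^ t) * stage_cost x a b t \<omega>) \<partial>P)"
  unfolding limit_value_def by (intro SUP_least horizon_value_le_plan assms)

primrec greedy_state :: "(nat \<Rightarrow> real) \<Rightarrow> (nat \<Rightarrow> real) \<Rightarrow> nat \<Rightarrow> (real \<Rightarrow> real) \<Rightarrow> nat \<Rightarrow> real" where
  "greedy_state e x 0 \<omega> = x"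
| "greedy_state e x (Suc t) \<omega> = next_state n (greedy_state e x t \<omega>)
     (order_up (near_best (e t) (greedy_state e x t \<omega>)))
     (order_down (near_best (e t) (greedy_state e x t \<omega>))) (demand t \<omega>)"

text \<open>In period \<open>t\<close> the plan takes an order whose stage value exceeds the limit value by at most
  \<open>\<epsilon> / 2 ^ (t + 1)\<close>.  Costs are non-negative, so the value left over after \<open>N\<close> periods can be dropped
  before \<open>N\<close> tends to infinity, and the losses add up to \<open>\<epsilon>\<close>.\<close>

lemma near_optimal_plan:
  assumes x: "x \<in> space states" and "0 < \<epsilon>"
  obtains a b where "adapted a" "adapted b"
    "(\<integral>\<^sup>+ \<omega>. (\<Sum>t. ennreal (\<alpha> ^ t) * stage_cost x a b t \<omega>) \<partial>P) \<le> limit_value x + ennreal \<epsilon>"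
proof -
  define e :: "nat \<Rightarrow> real" where "e t = \<epsilon> * (1 / 2) ^ Suc t" for t
  have e_pos: "0 < e t" for t using \<open>0 < \<epsilon>\<close> by (simp add: e_def)
  have "e sums (\<epsilon> * 1)" unfolding e_def by (intro sums_mult power_half_series)
  then have e_sum: "(\<Sum>t<N. e t) \<le> \<epsilon>" for N
    using e_pos sum_le_suminf[of e "{..<N}"] by (auto simp: sums_iff less_imp_le)
  let ?g = "greedy_state e x"
  define a where "a t \<omega> = order_up (near_best (e t) (?g t \<omega>))" for t \<omega>
  define b where "b t \<omega> = order_down (near_best (e t) (?g t \<omega>))" for t \<omega>
  have g_eq: "?g t \<omega> = plan_state x a b t \<omega>" for t \<omega>
    by (induction t) (simp_all add: a_def b_def)
  have orders: "(\<lambda>\<omega>. order_up (near_best (e t) (z \<omega>))) \<in> borel_measurable N"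
    "(\<lambda>\<omega>. order_down (near_best (e t) (z \<omega>))) \<in> borel_measurable N"
    if "z \<in> measurable N states" for z N t
    by (rule measurable_compose[OF measurable_compose[OF that near_best_measurable]], simp)+
  have g_meas: "?g t \<in> measurable (path_filtration (real t * period)) states" for t
  proof (induction t)
    case 0
    have "?g 0 = (\<lambda>_. x)" by (simp add: fun_eq_iff)
    then show ?case using x by simp
  next
    case (Suc t)
    have "?g (Suc t) = (\<lambda>\<omega>. next_state n (?g t \<omega>) (order_up (near_best (e t) (?g t \<omega>)))
        (order_down (near_best (e t) (?g t \<omega>))) (demand t \<omega>))"
      by (simp add: fun_eq_iff)
    then show ?case using step_measurable[OF Suc orders[OF Suc]] by (simp only:)
  qed
  have a: "adapted a" and b: "adapted b"
    using orders[OF g_meas] by (auto simp: adapted_def a_def[abs_def] b_def[abs_def])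
  let ?z = "plan_state x a b"
  note [measurable] = stage_cost_measurable[OF x a b]
  have [measurable]: "(\<lambda>\<omega>. limit_value (?z k \<omega>)) \<in> borel_measurable P" for k
    by (rule measurable_compose[OF path_filtration_measurable_P[OF plan_state_measurable[OF x a b]]
        regular_measurable[OF regular_limit_value]])
  have step: "(\<integral>\<^sup>+ \<omega>. ennreal (\<alpha> ^ k) * stage_cost x a b k \<omega> + ennreal (\<alpha> ^ Suc k) * limit_value (?z (Suc k) \<omega>) \<partial>P)
      \<le> (\<integral>\<^sup>+ \<omega>. ennreal (\<alpha> ^ k) * limit_value (?z k \<omega>) \<partial>P) + ennreal (e k)" for k
  proof -
    have "(\<integral>\<^sup>+ \<omega>. ennreal (\<alpha> ^ k) * stage_cost x a b k \<omega> + ennreal (\<alpha> ^ Suc k) * limit_value (?z (Suc k) \<omega>) \<partial>P)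
        = (\<integral>\<^sup>+ \<omega>. ennreal (\<alpha> ^ k) * (stage_cost x a b k \<omega> + ennreal \<alpha> * limit_value (?z (Suc k) \<omega>)) \<partial>P)"
      using \<alpha>_bounds by (intro nn_integral_cong)
        (simp add: distrib_left mult.assoc[symmetric] ennreal_mult[symmetric] mult.commute del: plan_state.simps)
    also have "\<dots> = ennreal (\<alpha> ^ k) * (\<integral>\<^sup>+ \<omega>. stage_value limit_value (?z k \<omega>) (a k \<omega>) (b k \<omega>) \<partial>P)"
      unfolding nn_integral_stage_value[OF regular_limit_value x a b]
      by (intro nn_integral_cmult) (simp del: plan_state.simps)
    also have "\<dots> \<le> ennreal (\<alpha> ^ k) * (\<integral>\<^sup>+ \<omega>. limit_value (?z k \<omega>) + ennreal (e k) \<partial>P)"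
      unfolding a_def b_def g_eq[symmetric] using near_best[OF e_pos]
      by (intro mult_left_mono nn_integral_mono) auto
    also have "\<dots> = ennreal (\<alpha> ^ k) * (\<integral>\<^sup>+ \<omega>. limit_value (?z k \<omega>) \<partial>P) + ennreal (\<alpha> ^ k) * ennreal (e k)"
      by (subst nn_integral_add) (auto simp: distrib_left)
    also have "\<dots> \<le> (\<integral>\<^sup>+ \<omega>. ennreal (\<alpha> ^ k) * limit_value (?z k \<omega>) \<partial>P) + ennreal (e k)"
    proof (intro add_mono)
      have "\<alpha> ^ k * e k \<le> 1 * e k"
        using \<alpha>_bounds e_pos[of k] by (intro mult_right_mono power_le_one) auto
      then show "ennreal (\<alpha> ^ k) * ennreal (e k) \<le> ennreal (e k)"
        using \<alpha>_bounds e_pos[of k] by (subst ennreal_mult[symmetric]) (auto intro!: ennreal_leI)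
    qed (subst nn_integral_cmult, simp_all)
    finally show ?thesis .
  qed
  have partial: "(\<Sum>t<N. \<integral>\<^sup>+ \<omega>. ennreal (\<alpha> ^ t) * stage_cost x a b t \<omega> \<partial>P)
      + (\<integral>\<^sup>+ \<omega>. ennreal (\<alpha> ^ N) * limit_value (?z N \<omega>) \<partial>P) \<le> limit_value x + ennreal (\<Sum>t<N. e t)" for N
  proof (induction N)
    case 0 then show ?case by simp
  next
    case (Suc N)
    let ?S = "\<Sum>t<N. \<integral>\<^sup>+ \<omega>. ennreal (\<alpha> ^ t) * stage_cost x a b t \<omega> \<partial>P"
    have "(\<Sum>t<Suc N. \<integral>\<^sup>+ \<omega>. ennreal (\<alpha> ^ t) * stage_cost x a b t \<omega> \<partial>P)
        + (\<integral>\<^sup>+ \<omega>. ennreal (\<alpha> ^ Suc N) * limit_value (?z (Suc N) \<omega>) \<partial>P)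
        = ?S + (\<integral>\<^sup>+ \<omega>. ennreal (\<alpha> ^ N) * stage_cost x a b N \<omega> + ennreal (\<alpha> ^ Suc N) * limit_value (?z (Suc N) \<omega>) \<partial>P)"
      by (subst nn_integral_add) (simp_all add: add.assoc del: plan_state.simps power_Suc)
    also have "\<dots> \<le> ?S + ((\<integral>\<^sup>+ \<omega>. ennreal (\<alpha> ^ N) * limit_value (?z N \<omega>) \<partial>P) + ennreal (e N))"
      by (intro add_left_mono step)
    also have "\<dots> \<le> limit_value x + ennreal (\<Sum>t<N. e t) + ennreal (e N)"
      using add_right_mono[OF Suc, of "ennreal (e N)"] by (simp add: add.assoc)
    also have "\<dots> = limit_value x + ennreal (\<Sum>t<Suc N. e t)"
      using e_pos by (simp add: add.assoc ennreal_plus[symmetric] sum_nonneg less_imp_le del: ennreal_plus)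
    finally show ?case .
  qed
  have "(\<integral>\<^sup>+ \<omega>. (\<Sum>t. ennreal (\<alpha> ^ t) * stage_cost x a b t \<omega>) \<partial>P)
      = (\<Sum>t. \<integral>\<^sup>+ \<omega>. ennreal (\<alpha> ^ t) * stage_cost x a b t \<omega> \<partial>P)"
    by (intro nn_integral_suminf) simp
  also have "\<dots> \<le> limit_value x + ennreal \<epsilon>"
  proof (rule suminf_le_const[OF summableI])
    fix N
    have "(\<Sum>t<N. \<integral>\<^sup>+ \<omega>. ennreal (\<alpha> ^ t) * stage_cost x a b t \<omega> \<partial>P) \<le> limit_value x + ennreal (\<Sum>t<N. e t)"
      by (rule order_trans[OF _ partial]) simp
    also have "\<dots> \<le> limit_value x + ennreal \<epsilon>"
      by (intro add_left_mono ennreal_leI e_sum)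
    finally show "(\<Sum>t<N. \<integral>\<^sup>+ \<omega>. ennreal (\<alpha> ^ t) * stage_cost x a b t \<omega> \<partial>P) \<le> limit_value x + ennreal \<epsilon>" .
  qed
  finally show thesis using that a b by blast
qed

section \<open>The cost of a plan as a discounted integral\<close>

text \<open>The index of the last review time that is not after \<open>u\<close>; negative times are assigned the index
  \<open>0\<close>, at which
  no order has been accumulated yet.\<close>

definition review :: "real \<Rightarrow> nat" where "review u = nat \<lfloor>u / period\<rfloor>"

lemma review_bounds:
  assumes "0 \<le> u"
  shows "real (review u) * period \<le> u" "u < real (review u) * period + period"
proof -
  have "0 \<le> \<lfloor>u / period\<rfloor>" using assms period_pos by simp
  then have r: "real (review u) = of_int \<lfloor>u / period\<rfloor>" by (simp add: review_def)
  have "real (review u) \<le> u / period" "u / period < real (review u) + 1" unfolding r by linarith+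
  then show "real (review u) * period \<le> u" "u < real (review u) * period + period"
    using period_pos by (auto simp: field_simps)
qed

lemma review_eq:
  assumes "real k * period \<le> u" "u < real k * period + period"
  shows "review u = k"
proof -
  have "\<lfloor>u / period\<rfloor> = int k"
    using assms period_pos by (intro floor_unique) (auto simp: field_simps)
  then show ?thesis by (simp add: review_def)
qed

lemma review_ge_iff: "0 \<le> u \<Longrightarrow> t \<le> review u \<longleftrightarrow> real t * period \<le> u"
  using period_pos by (auto simp: review_def le_nat_iff le_floor_iff field_simps)

lemma review_neg: "u < 0 \<Longrightarrow> review u = 0"
  using period_pos by (simp add: review_def divide_less_0_iff floor_less_zero less_imp_le)

lemma review_mono: "u \<le> v \<Longrightarrow> review u \<le> review v"
  using period_pos by (auto simp: review_def intro!: nat_mono floor_mono divide_right_mono)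

lemma review_lead_time: "review (u - l) = review u - n"
proof -
  have "(u - l) / period = u / period - of_int (int n)"
    using n_pos l_pos by (simp add: period_def diff_divide_distrib left_diff_distrib)
  then have "\<lfloor>(u - l) / period\<rfloor> = \<lfloor>u / period\<rfloor> - int n" by (simp only: floor_diff_of_int)
  then show ?thesis by (simp add: review_def nat_diff_distrib')
qed

lemma review_measurable [measurable]: "review \<in> measurable borel (count_space UNIV)"
  unfolding review_def[abs_def] by measurable

text \<open>The order of period \<open>k\<close> itself is excluded: it is placed at the review time \<open>k\<close> but affects the
  state only from the next review time on.\<close>

definition cumulated :: "(nat \<Rightarrow> 'a \<Rightarrow> real) \<Rightarrow> nat \<Rightarrow> 'a \<Rightarrow> real" where
  "cumulated a k \<omega> = (\<Sum>s<k. a s \<omega>)"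

lemma cumulated_simps [simp]:
  "cumulated a 0 \<omega> = 0" "cumulated a (Suc k) \<omega> = cumulated a k \<omega> + a k \<omega>"
  by (simp_all add: cumulated_def)

text \<open>The truncated difference \<open>k - n\<close> is intended: the upward order of period \<open>s\<close> reaches the
  inventory level at the review time with index \<open>s + 1 + n\<close>, and none has done so when \<open>k \<le> n\<close>.\<close>

definition level ::
  "(real \<Rightarrow> real) \<Rightarrow> (nat \<Rightarrow> (real \<Rightarrow> real) \<Rightarrow> real) \<Rightarrow> (nat \<Rightarrow> (real \<Rightarrow> real) \<Rightarrow> real)
     \<Rightarrow> nat \<Rightarrow> (real \<Rightarrow> real) \<Rightarrow> real" where
  "level X a b k \<omega> = X (real k * period) + (\<omega> (real k * period) - \<omega> 0)
     + cumulated a (k - n) \<omega> - cumulated b k \<omega>"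

text \<open>The closed form of the state recursion.  In the last component the initial state is evaluated
  beyond the lead time, where it is constant.\<close>

lemma plan_state_eq:
  assumes X: "X \<in> initial_states l" and "i < n"
  shows "plan_state (sampled_state l n X) a b t \<omega> i
    = X (real (t + i + 1) * period) + (\<omega> (real t * period) - \<omega> 0)
      + cumulated a (t + i + 1 - n) \<omega> - cumulated b t \<omega>"
  using \<open>i < n\<close>
proof (induction t arbitrary: i)
  case 0
  then have "cumulated a (0 + i + 1 - n) \<omega> = 0" by (simp add: cumulated_def)
  with 0 show ?case by (simp add: sampled_state_def period_def)
next
  case (Suc t)
  have dem: "demand t \<omega> = \<omega> (real (Suc t) * period) - \<omega> (real t * period)"
    by (simp add: demand_def algebra_simps)
  show ?case
  proof (cases "i = n - 1")
    case True
    have late: "X (real (t + n + j) * period) = X l" for j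
    proof -
      have "l = real n * period" using n_pos by (simp add: period_def)
      also have "\<dots> \<le> real (t + n + j) * period" using period_pos by (intro mult_right_mono) auto
      finally show ?thesis by (rule initial_state_late[OF X])
    qed
    have "t + (n - 1) + 1 = t + n + 0" "Suc t + i + 1 = t + n + 1" "Suc t + i + 1 - n = Suc t" "t + (n - 1) + 1 - n = t"
      using True n_pos by auto
    then show ?thesis
      using True Suc.IH[of "n - 1"] n_pos late[of 0] late[of 1] by (simp add: next_state_def dem)
  next
    case False
    then have "i + 1 < n" using Suc.prems by simp
    then show ?thesis
      using False Suc.IH[of "i + 1"] Suc.prems by (simp add: next_state_def dem)
  qed
qed

lemma plan_level:
  assumes "X \<in> initial_states l"
  shows "plan_state (sampled_state l n X) a b t \<omega> 0 - b t \<omega> + demand t \<omega> = level X a b (Suc t) \<omega>"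
  using plan_state_eq[OF assms n_pos, of a b t \<omega>]
  by (simp add: level_def demand_def algebra_simps)

text \<open>An order placed at time \<open>t\<close> at unit cost \<open>c\<close> is charged as the rate \<open>\<gamma> * c\<close> from \<open>t\<close> onwards, so
  the order of the current period is already included here, in contrast to \<open>level\<close>.  The periodic
  system charges no holding cost during the first period.\<close>

definition plan_rate ::
  "(real \<Rightarrow> real) \<Rightarrow> (nat \<Rightarrow> (real \<Rightarrow> real) \<Rightarrow> real) \<Rightarrow> (nat \<Rightarrow> (real \<Rightarrow> real) \<Rightarrow> real)
     \<Rightarrow> (real \<Rightarrow> real) \<Rightarrow> real \<Rightarrow> real" where
  "plan_rate X a b \<omega> u =
     \<gamma> * (kup * cumulated a (Suc (review u)) \<omega> + kdn * cumulated b (Suc (review u)) \<omega>)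
     + (if review u = 0 then 0 else h (level X a b (review u) \<omega>))"

lemma plan_cost_eq_discounted:
  assumes X: "X \<in> initial_states l" and nonneg: "\<And>t. 0 \<le> a t \<omega>" "\<And>t. 0 \<le> b t \<omega>"
  shows "(\<Sum>t. ennreal (\<alpha> ^ t) * stage_cost (sampled_state l n X) a b t \<omega>)
    = discounted \<gamma> (\<lambda>u. ennreal (plan_rate X a b \<omega> u))"
proof -
  let ?c = "\<lambda>t. \<gamma> * (kup * a t \<omega> + kdn * b t \<omega>)"
  let ?H = "\<lambda>t. h (level X a b (Suc t) \<omega>)"
  let ?I = "\<lambda>t. {real (Suc t) * period ..< real (Suc t) * period + period}"
  define f :: "nat \<Rightarrow> real \<Rightarrow> ennreal" where
    "f t u = ennreal (?c t) * indicator {real t * period..} u + ennreal (?H t) * indicator (?I t) u" for t u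
  have c: "0 \<le> ?c t" for t
    using nonneg \<gamma>_pos kup_pos kdn_pos by simp
  have "ennreal (\<alpha> ^ t) * stage_cost (sampled_state l n X) a b t \<omega> = discounted \<gamma> (f t)" for t
  proof -
    have "discounted \<gamma> (f t) = ennreal (?c t) * ennreal (exp (- \<gamma> * (real t * period)) / \<gamma>)
      + ennreal (?H t) * ennreal ((exp (- \<gamma> * (real (Suc t) * period)) - exp (- \<gamma> * (real (Suc t) * period + period))) / \<gamma>)"
      unfolding f_def using \<gamma>_pos period_pos
      by (subst discounted_add, simp, simp, subst discounted_indicator_atLeast, simp, simp,
          subst discounted_indicator_interval) auto
    also have "exp (- \<gamma> * (real t * period)) = \<alpha> ^ t"
      by (rule \<alpha>_power[symmetric])
    also have "exp (- \<gamma> * (real (Suc t) * period)) - exp (- \<gamma> * (real (Suc t) * period + period)) = \<alpha> ^ t * \<alpha> * (1 - \<alpha>)"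
    proof -
      have "exp (- \<gamma> * (real (Suc t) * period + period)) = exp (- \<gamma> * (real (Suc t) * period)) * \<alpha>"
        by (simp add: \<alpha>_def exp_add[symmetric] algebra_simps)
      then show ?thesis unfolding \<alpha>_power[symmetric] by (simp add: algebra_simps)
    qed
    also have "ennreal (?c t) * ennreal (\<alpha> ^ t / \<gamma>) = ennreal (\<alpha> ^ t) * ennreal (kup * a t \<omega> + kdn * b t \<omega>)"
      using nonneg \<gamma>_pos kup_pos kdn_pos \<alpha>_bounds c[of t]
      by (simp add: ennreal_mult[symmetric] mult.commute del: ennreal_plus)
    also have "ennreal (?H t) * ennreal (\<alpha> ^ t * \<alpha> * (1 - \<alpha>) / \<gamma>)
        = ennreal (\<alpha> ^ t) * (ennreal \<alpha> * period_hold (level X a b (Suc t) \<omega>))"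
      using \<gamma>_pos \<alpha>_bounds by (simp add: period_hold_def ennreal_mult[symmetric] mult_ac)
    finally show ?thesis
      by (simp add: stage_cost_def plan_level[OF X] distrib_left)
  qed
  then have "(\<Sum>t. ennreal (\<alpha> ^ t) * stage_cost (sampled_state l n X) a b t \<omega>) = discounted \<gamma> (\<lambda>u. \<Sum>t. f t u)"
    by (subst discounted_suminf) (auto simp: f_def[abs_def])
  also have "\<dots> = discounted \<gamma> (\<lambda>u. ennreal (plan_rate X a b \<omega> u))"
  proof (rule discounted_cong)
    fix u :: real assume u: "0 \<le> u"
    let ?k = "review u"
    have ind1: "indicator {real t * period..} u = (if t \<le> ?k then 1 else 0 :: ennreal)" for t
      using review_ge_iff[OF u, of t] by (simp add: indicator_def)
    have ind2: "indicator (?I t) u = (if ?k = Suc t then 1 else 0 :: ennreal)" for t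
      using review_bounds[OF u] review_eq[of "Suc t" u] by (auto simp: indicator_def)
    have f: "f t u = (if t \<le> ?k then ennreal (?c t) else 0) + (if ?k = Suc t then ennreal (?H t) else 0)" for t
      unfolding f_def ind1 ind2 by simp
    have "(\<Sum>t. f t u) = (\<Sum>t\<in>{..?k}. f t u)"
      by (rule suminf_finite) (auto simp: f)
    also have "\<dots> = (\<Sum>t\<in>{..?k}. ennreal (?c t)) + (\<Sum>t\<in>{..?k}. if ?k = Suc t then ennreal (?H t) else 0)"
      by (simp add: f sum.distrib)
    also have "(\<Sum>t\<in>{..?k}. ennreal (?c t)) = ennreal (\<Sum>t\<in>{..?k}. ?c t)"
      by (rule sum_ennreal) (rule c)
    also have "(\<Sum>t\<in>{..?k}. ?c t) = \<gamma> * (kup * cumulated a (Suc ?k) \<omega> + kdn * cumulated b (Suc ?k) \<omega>)"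
      unfolding cumulated_def lessThan_Suc_atMost by (simp only: sum_distrib_left sum.distrib[symmetric])
    also have "(\<Sum>t\<in>{..?k}. if ?k = Suc t then ennreal (?H t) else 0)
        = ennreal (if ?k = 0 then 0 else h (level X a b ?k \<omega>))"
    proof (cases ?k)
      case 0 then show ?thesis by simp
    next
      case (Suc j)
      have "(\<Sum>t\<in>{..?k}. if ?k = Suc t then ennreal (?H t) else 0) = (\<Sum>t\<in>{..?k}. if t = j then ennreal (?H j) else 0)"
        using Suc by (intro sum.cong) auto
      then show ?thesis using Suc by simp
    qed
    also have "ennreal (\<gamma> * (kup * cumulated a (Suc ?k) \<omega> + kdn * cumulated b (Suc ?k) \<omega>))
        + ennreal (if ?k = 0 then 0 else h (level X a b ?k \<omega>)) = ennreal (plan_rate X a b \<omega> u)"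
      unfolding plan_rate_def using nonneg kup_pos kdn_pos \<gamma>_pos
      by (subst ennreal_plus) (auto simp: cumulated_def intro!: mult_nonneg_nonneg add_nonneg_nonneg sum_nonneg)
    finally show "(\<Sum>t. f t u) = ennreal (plan_rate X a b \<omega> u)" .
  qed
  finally show ?thesis .
qed

end

section \<open>The continuous system and the discretisation error\<close>

lemma nn_integral_discounted_swap:
  assumes M: "sigma_finite_measure M"
    and f [measurable]: "(\<lambda>p. f (fst p) (snd p)) \<in> borel_measurable (borel \<Otimes>\<^sub>M M)"
  shows "(\<integral>\<^sup>+ \<omega>. discounted \<gamma> (\<lambda>u. f u \<omega>) \<partial>M) = discounted \<gamma> (\<lambda>u. \<integral>\<^sup>+ \<omega>. f u \<omega> \<partial>M)"
    and "(\<lambda>\<omega>. discounted \<gamma> (\<lambda>u. f u \<omega>)) \<in> borel_measurable M"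
proof -
  interpret M: sigma_finite_measure M by fact
  interpret pair_sigma_finite lborel M ..
  define g where "g p = ennreal (exp (- \<gamma> * fst p)) * f (fst p) (snd p) * indicator {0..} (fst p)" for p
  have g [measurable]: "g \<in> borel_measurable (lborel \<Otimes>\<^sub>M M)"
    unfolding g_def[abs_def] using f by (auto cong: measurable_cong_sets sets_pair_measure_cong)
  have disc: "discounted \<gamma> (\<lambda>u. f u \<omega>) = (\<integral>\<^sup>+ u. g (u, \<omega>) \<partial>lborel)" for \<omega>
    by (simp add: discounted_def g_def)
  have "discounted \<gamma> (\<lambda>u. \<integral>\<^sup>+ \<omega>. f u \<omega> \<partial>M) = (\<integral>\<^sup>+ u. (\<integral>\<^sup>+ \<omega>. g (u, \<omega>) \<partial>M) \<partial>lborel)"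
    unfolding discounted_def g_def fst_conv snd_conv
  proof (rule nn_integral_cong)
    fix u :: real
    have [measurable]: "f u \<in> borel_measurable M"
      using measurable_compose[OF measurable_Pair1'[of u borel M] f] by simp
    show "ennreal (exp (- \<gamma> * u)) * (\<integral>\<^sup>+ \<omega>. f u \<omega> \<partial>M) * indicator {0..} u
        = (\<integral>\<^sup>+ \<omega>. ennreal (exp (- \<gamma> * u)) * f u \<omega> * indicator {0..} u \<partial>M)"
      by (simp add: nn_integral_cmult nn_integral_multc)
  qed
  also have "\<dots> = (\<integral>\<^sup>+ \<omega>. (\<integral>\<^sup>+ u. g (u, \<omega>) \<partial>lborel) \<partial>M)"
    by (rule Fubini'[symmetric]) (simp add: split_beta')
  finally show "(\<integral>\<^sup>+ \<omega>. discounted \<gamma> (\<lambda>u. f u \<omega>) \<partial>M) = discounted \<gamma> (\<lambda>u. \<integral>\<^sup>+ \<omega>. f u \<omega> \<partial>M)"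
    by (simp add: disc)
  show "(\<lambda>\<omega>. discounted \<gamma> (\<lambda>u. f u \<omega>)) \<in> borel_measurable M"
  proof -
    have "(\<lambda>p. g (snd p, fst p)) \<in> borel_measurable (M \<Otimes>\<^sub>M lborel)"
      by (rule measurable_compose[OF _ g]) measurable
    then have "(\<lambda>\<omega>. \<integral>\<^sup>+ u. g (u, \<omega>) \<partial>lborel) \<in> borel_measurable M"
      by (intro lborel.borel_measurable_nn_integral) (simp add: split_beta')
    then show ?thesis by (simp add: disc)
  qed
qed

lemma section_measurable:
  assumes "(\<lambda>p. f (fst p) (snd p)) \<in> measurable (borel \<Otimes>\<^sub>M M) N" "\<omega> \<in> space M"
  shows "(\<lambda>u. f u \<omega>) \<in> measurable borel N"
  using measurable_compose[OF measurable_Pair2'[OF assms(2), of borel] assms(1)] by simp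

lemma initial_state_mono: "X \<in> initial_states l \<Longrightarrow> 0 \<le> u \<Longrightarrow> u \<le> v \<Longrightarrow> X u \<le> X v"
  unfolding initial_states_def by (intro mono_onD[of "{0..}" X]) auto

lemma initial_state_le:
  assumes "X \<in> initial_states l" "0 \<le> u"
  shows "X u \<le> X l"
proof (cases "u \<le> l")
  case True then show ?thesis using initial_state_mono assms by blast
next
  case False then show ?thesis using initial_state_late[OF assms(1), of u] by simp
qed

lemma initial_state_extended_mono: "X \<in> initial_states l \<Longrightarrow> mono (\<lambda>u. X (max 0 u))"
  by (rule monoI) (rule initial_state_mono, auto)

lemma initial_state_measurable: "X \<in> initial_states l \<Longrightarrow> (\<lambda>u. X (max 0 u)) \<in> borel_measurable borel"
  by (rule borel_measurable_mono[OF initial_state_extended_mono])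

lemma adjustment_processD:
  assumes "adjustment_process Y" "\<omega> \<in> path_space"
  shows "t < 0 \<Longrightarrow> Y t \<omega> = 0" "0 \<le> Y t \<omega>" "mono (\<lambda>t. Y t \<omega>)" "continuous (at_right t) (\<lambda>t. Y t \<omega>)"
  using assms by (auto simp: adjustment_process_def)

lemma adjustment_process_measurable:
  assumes Y: "adjustment_process Y" and le: "t \<le> s"
  shows "Y t \<in> borel_measurable (path_filtration s)"
proof (cases "0 \<le> t")
  case True
  then have "Y t \<in> borel_measurable (path_filtration t)" using Y by (simp add: adjustment_process_def)
  then show ?thesis by (rule path_filtration_measurable_mono[OF _ le])
next
  case False
  then have "Y t \<omega> = 0" if "\<omega> \<in> space (path_filtration s)" for \<omega>
    using that Y by (simp add: adjustment_process_def)
  then have "Y t \<in> borel_measurable (path_filtration s) \<longleftrightarrow> (\<lambda>_. 0 :: real) \<in> borel_measurable (path_filtration s)"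
    by (rule measurable_cong)
  then show ?thesis by simp
qed

context inventory
begin

text \<open>Initial state and path are evaluated at \<open>max 0 u\<close> to obtain a function that is jointly measurable
  in the path and in \<open>u\<close> on the whole real line; discounting only sees \<open>u \<ge> 0\<close>.\<close>

definition cost_rate ::
  "(real \<Rightarrow> real) \<Rightarrow> (real \<Rightarrow> (real \<Rightarrow> real) \<Rightarrow> real) \<Rightarrow> (real \<Rightarrow> (real \<Rightarrow> real) \<Rightarrow> real)
     \<Rightarrow> (real \<Rightarrow> real) \<Rightarrow> real \<Rightarrow> real" where
  "cost_rate X Yup Ydn \<omega> u =
     h (X (max 0 u) + \<omega> (max 0 u) + Yup (u - l) \<omega> - Ydn u \<omega>) + \<gamma> * (kup * Yup u \<omega> + kdn * Ydn u \<omega>)"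

lemma adjustment_jointly_measurable:
  assumes Y: "adjustment_process Y"
  shows "(\<lambda>p. Y (fst p - c) (snd p)) \<in> borel_measurable (borel \<Otimes>\<^sub>M P)"
proof -
  have J: "(\<lambda>p. Y (fst p) (snd p)) \<in> borel_measurable (borel \<Otimes>\<^sub>M P)"
    using adjustment_processD[OF Y] path_filtration_measurable_P[OF adjustment_process_measurable[OF Y order_refl]]
    by (intro right_continuous_jointly_measurable) auto
  have "(\<lambda>p. (fst p - c, snd p)) \<in> measurable (borel \<Otimes>\<^sub>M P) (borel \<Otimes>\<^sub>M P)" by measurable
  from measurable_compose[OF this J] show ?thesis by simp
qed

lemma cost_rate_jointly_measurable:
  assumes X: "X \<in> initial_states l" and up: "adjustment_process Yup" and dn: "adjustment_process Ydn"
  shows "(\<lambda>p. cost_rate X Yup Ydn (snd p) (fst p)) \<in> borel_measurable (borel \<Otimes>\<^sub>M P)"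
proof -
  note [measurable] = path_jointly_measurable adjustment_jointly_measurable[OF up, of l]
    adjustment_jointly_measurable[OF up, of 0, simplified] adjustment_jointly_measurable[OF dn, of 0, simplified]
    measurable_compose[OF measurable_fst initial_state_measurable[OF X]]
  show ?thesis unfolding cost_rate_def by measurable
qed

lemma policy_cost_eq:
  assumes X: "X \<in> initial_states l" and up: "adjustment_process Yup" and dn: "adjustment_process Ydn"
  shows "policy_cost l \<gamma> kup kdn h P X (Yup, Ydn)
    = (\<integral>\<^sup>+ \<omega>. discounted \<gamma> (\<lambda>u. ennreal (cost_rate X Yup Ydn \<omega> u)) \<partial>P)"
  unfolding policy_cost_def prod.case
proof (rule nn_integral_cong)
  fix \<omega> assume "\<omega> \<in> space P"
  then have \<omega>: "\<omega> \<in> path_space" by simp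
  note U = adjustment_processD[OF up \<omega>] and D = adjustment_processD[OF dn \<omega>]
  have [measurable]: "(\<lambda>u. Yup (u - l) \<omega>) \<in> borel_measurable borel"
      "(\<lambda>u. Yup u \<omega>) \<in> borel_measurable borel" "(\<lambda>u. Ydn u \<omega>) \<in> borel_measurable borel"
    using section_measurable[OF adjustment_jointly_measurable[OF up, of l] \<open>\<omega> \<in> space P\<close>]
      borel_measurable_mono[OF U(3)] borel_measurable_mono[OF D(3)] by simp_all
  have [measurable]: "(\<lambda>u. \<omega> (max 0 u)) \<in> borel_measurable borel"
    using section_measurable[OF path_jointly_measurable \<open>\<omega> \<in> space P\<close>] by simp
  note [measurable] = initial_state_measurable[OF X]
  have adj_up: "discounted_adjustment \<gamma> (\<lambda>t. Yup t \<omega>) = ennreal \<gamma> * discounted \<gamma> (\<lambda>u. ennreal (Yup u \<omega>))"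
    using U by (intro discounted_adjustment_eq \<gamma>_pos) auto
  have adj_dn: "discounted_adjustment \<gamma> (\<lambda>t. Ydn t \<omega>) = ennreal \<gamma> * discounted \<gamma> (\<lambda>u. ennreal (Ydn u \<omega>))"
    using D by (intro discounted_adjustment_eq \<gamma>_pos) auto
  let ?h = "\<lambda>u. h (X (max 0 u) + \<omega> (max 0 u) + Yup (u - l) \<omega> - Ydn u \<omega>)"
  have "(\<integral>\<^sup>+ t\<in>{0..}. ennreal (exp (- \<gamma> * t) * h (state l X (Yup, Ydn) \<omega> t 0)) \<partial>lborel)
      = discounted \<gamma> (\<lambda>u. ennreal (?h u))"
    unfolding discounted_def using l_pos
    by (intro nn_integral_cong) (auto simp: state_def ennreal_mult indicator_def min_def)
  moreover have "ennreal kup * discounted_adjustment \<gamma> (\<lambda>t. Yup t \<omega>) + ennreal kdn * discounted_adjustment \<gamma> (\<lambda>t. Ydn t \<omega>)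
      = discounted \<gamma> (\<lambda>u. ennreal (kup * \<gamma>) * ennreal (Yup u \<omega>) + ennreal (kdn * \<gamma>) * ennreal (Ydn u \<omega>))"
    unfolding adj_up adj_dn using kup_pos kdn_pos \<gamma>_pos
    by (subst discounted_add, simp, simp, subst discounted_cmult, simp, subst discounted_cmult)
      (simp_all add: ennreal_mult mult.assoc)
  moreover have "discounted \<gamma> (\<lambda>u. ennreal (?h u)) +
      discounted \<gamma> (\<lambda>u. ennreal (kup * \<gamma>) * ennreal (Yup u \<omega>) + ennreal (kdn * \<gamma>) * ennreal (Ydn u \<omega>))
      = discounted \<gamma> (\<lambda>u. ennreal (cost_rate X Yup Ydn \<omega> u))"
  proof (subst discounted_add[symmetric])
    have "ennreal (?h u) + (ennreal (kup * \<gamma>) * ennreal (Yup u \<omega>) + ennreal (kdn * \<gamma>) * ennreal (Ydn u \<omega>))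
        = ennreal (?h u + (kup * \<gamma> * Yup u \<omega> + kdn * \<gamma> * Ydn u \<omega>))" for u
      using U(2)[of u] D(2)[of u] kup_pos kdn_pos \<gamma>_pos by (simp add: ennreal_mult ennreal_plus)
    then show "discounted \<gamma> (\<lambda>u. ennreal (?h u) + (ennreal (kup * \<gamma>) * ennreal (Yup u \<omega>) + ennreal (kdn * \<gamma>) * ennreal (Ydn u \<omega>)))
        = discounted \<gamma> (\<lambda>u. ennreal (cost_rate X Yup Ydn \<omega> u))"
      by (simp add: cost_rate_def algebra_simps)
  qed simp_all
  ultimately show "(\<integral>\<^sup>+ t\<in>{0..}. ennreal (exp (- \<gamma> * t) * h (state l X (Yup, Ydn) \<omega> t 0)) \<partial>lborel)
      + (ennreal kup * discounted_adjustment \<gamma> (\<lambda>t. Yup t \<omega>) + ennreal kdn * discounted_adjustment \<gamma> (\<lambda>t. Ydn t \<omega>))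
      = discounted \<gamma> (\<lambda>u. ennreal (cost_rate X Yup Ydn \<omega> u))" by simp
qed

definition tracking_bound :: "(real \<Rightarrow> real) \<Rightarrow> real \<Rightarrow> real" where
  "tracking_bound X p = M / \<gamma> * ((1 - exp (- \<gamma> * p)) * (X l - X 0 + \<bar>X 0\<bar>) + (\<bar>\<mu>\<bar> * p + sqrt p * \<sigma>))"

end

context periodic_system
begin

text \<open>A bound, common to both comparisons, for the difference of the inventory levels that is due to
  freezing the initial state and the path at the last review time.  The path may start away from
  \<open>0\<close> on a null set.  The last term accounts for the first period, in which only the continuous
  system pays holding costs.\<close>

definition tracking_error :: "(real \<Rightarrow> real) \<Rightarrow> (real \<Rightarrow> real) \<Rightarrow> real \<Rightarrow> real" where
  "tracking_error X \<omega> u = (X (max 0 u) - X (real (review u) * period))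
     + \<bar>\<omega> (max 0 u) - \<omega> (real (review u) * period)\<bar> + \<bar>\<omega> 0\<bar> + (if review u = 0 then \<bar>X 0\<bar> else 0)"

lemma tracking_error_jointly_measurable:
  assumes X: "X \<in> initial_states l"
  shows "(\<lambda>p. tracking_error X (snd p) (fst p)) \<in> borel_measurable (borel \<Otimes>\<^sub>M P)"
proof -
  have grid: "real (review u) * period = max 0 (real (review u) * period)" for u
    using period_pos by simp
  have [measurable]: "(\<lambda>u. real (review u) * period) \<in> borel_measurable borel" by measurable
  have [measurable]: "(\<lambda>p::real \<times> (real \<Rightarrow> real). X (real (review (fst p)) * period)) \<in> borel_measurable (borel \<Otimes>\<^sub>M P)"
    by (subst grid) (rule measurable_compose[OF _ initial_state_measurable[OF X]], measurable)
  have "(\<lambda>p. (real (review (fst p)) * period, snd p)) \<in> measurable (borel \<Otimes>\<^sub>M P) (borel \<Otimes>\<^sub>M P)"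
    by measurable
  from measurable_compose[OF this path_jointly_measurable]
  have [measurable]: "(\<lambda>p. snd p (real (review (fst p)) * period)) \<in> borel_measurable (borel \<Otimes>\<^sub>M P)"
    by (simp add: grid[symmetric])
  have [measurable]: "(\<lambda>p. snd p 0) \<in> borel_measurable (borel \<Otimes>\<^sub>M P)"
    by (rule measurable_compose[OF measurable_snd coordinate_measurable_P]) simp
  note [measurable] = path_jointly_measurable measurable_compose[OF measurable_fst initial_state_measurable[OF X]]
  show ?thesis unfolding tracking_error_def by measurable
qed

lemma tracking_error_nonneg:
  assumes "X \<in> initial_states l" "0 \<le> u"
  shows "0 \<le> tracking_error X \<omega> u"
proof -
  have "X (real (review u) * period) \<le> X u"
    using review_bounds[OF assms(2)] period_pos by (intro initial_state_mono[OF assms(1)]) auto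
  then show ?thesis using assms(2) by (simp add: tracking_error_def max_def)
qed

text \<open>After exchanging expectation and discounted integral, the path contributes the mean absolute value
  of an increment over at most one period.  The lag of the initial state is at most
  \<open>f u - f (u - period)\<close> for a monotone function \<open>f\<close> with values between \<open>0\<close> and \<open>X l - X 0\<close>.\<close>

lemma expected_tracking_error_le:
  assumes X: "X \<in> initial_states l"
  shows "(\<integral>\<^sup>+ \<omega>. discounted \<gamma> (\<lambda>u. ennreal (M * tracking_error X \<omega> u)) \<partial>P) \<le> ennreal (tracking_bound X period)"
proof -
  define \<beta> where "\<beta> = \<bar>\<mu>\<bar> * period + sqrt period * \<sigma>"
  have \<beta>: "0 \<le> \<beta>" using period_pos sigma_pos by (simp add: \<beta>_def)
  define f where "f u = X (max 0 u) - X 0" for u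
  have f_mono: "mono f"
    unfolding f_def using initial_state_extended_mono[OF X] by (auto simp: mono_def)
  have f_neg: "f u = 0" if "u < 0" for u using that by (simp add: f_def)
  have [measurable]: "f \<in> borel_measurable borel" by (rule borel_measurable_mono[OF f_mono])
  have f_bounds: "0 \<le> f u" "f u \<le> X l - X 0" for u
    using initial_state_mono[OF X, of 0 "max 0 u"] initial_state_le[OF X, of "max 0 u"] by (auto simp: f_def)
  let ?b = "\<lambda>u. ennreal M * ennreal (f u - f (u - period)) + ennreal (M * \<bar>X 0\<bar>) * indicator {0..<period} u + ennreal (M * \<beta>)"
  have pointwise: "(\<integral>\<^sup>+ \<omega>. ennreal (M * tracking_error X \<omega> u) \<partial>P) \<le> ?b u" if u: "0 \<le> u" for u
  proof -
    let ?k = "real (review u) * period"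
    have k: "0 \<le> ?k" "?k \<le> u" "u < ?k + period" using review_bounds[OF u] period_pos by auto
    have [measurable]: "(\<lambda>\<omega>. \<omega> u) \<in> borel_measurable P" "(\<lambda>\<omega>. \<omega> ?k) \<in> borel_measurable P" "(\<lambda>\<omega>. \<omega> 0) \<in> borel_measurable P"
      by (rule coordinate_measurable_P[OF u] coordinate_measurable_P[OF k(1)] coordinate_measurable_P[OF order_refl])+
    have X_lag: "0 \<le> X u - X ?k" "X u - X ?k \<le> f u - f (u - period)"
    proof -
      have "max 0 (u - period) \<le> ?k" using k by simp
      then show "0 \<le> X u - X ?k" "X u - X ?k \<le> f u - f (u - period)"
        using initial_state_mono[OF X, of ?k u] initial_state_mono[OF X, of "max 0 (u - period)" ?k] k
        unfolding f_def max_absorb2[OF u] by simp_all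
    qed
    let ?e = "if review u = 0 then \<bar>X 0\<bar> else 0"
    have split: "ennreal (M * tracking_error X \<omega> u)
        = ennreal (M * (X u - X ?k)) + ennreal (M * ?e) + (ennreal M * ennreal \<bar>\<omega> u - \<omega> ?k\<bar> + ennreal M * ennreal \<bar>\<omega> 0\<bar>)" for \<omega>
    proof -
      have "M * tracking_error X \<omega> u = M * (X u - X ?k) + M * ?e + (M * \<bar>\<omega> u - \<omega> ?k\<bar> + M * \<bar>\<omega> 0\<bar>)"
        using u by (simp add: tracking_error_def max_def algebra_simps)
      then show ?thesis using X_lag M_pos by (simp add: ennreal_plus ennreal_mult)
    qed
    have "(\<integral>\<^sup>+ \<omega>. ennreal \<bar>\<omega> 0\<bar> \<partial>P) = (\<integral>\<^sup>+ \<omega>. 0 \<partial>P)"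
      by (rule nn_integral_cong_AE) (use start_AE in auto)
    then have zero: "(\<integral>\<^sup>+ \<omega>. ennreal \<bar>\<omega> 0\<bar> \<partial>P) = 0" by simp
    have "(\<integral>\<^sup>+ \<omega>. ennreal (M * tracking_error X \<omega> u) \<partial>P)
        = ennreal (M * (X u - X ?k)) + ennreal (M * ?e) + ennreal M * (\<integral>\<^sup>+ \<omega>. ennreal \<bar>\<omega> u - \<omega> ?k\<bar> \<partial>P)"
      unfolding split by (subst nn_integral_add, simp, simp, subst nn_integral_add)
        (simp_all add: nn_integral_cmult zero)
    also have "\<dots> \<le> ennreal (M * (X u - X ?k)) + ennreal (M * ?e) + ennreal M * ennreal \<beta>"
      unfolding \<beta>_def using k by (intro add_left_mono mult_left_mono expected_abs_increment_le) auto
    also have "\<dots> \<le> ?b u"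
    proof (intro add_mono)
      show "ennreal (M * (X u - X ?k)) \<le> ennreal M * ennreal (f u - f (u - period))"
        using X_lag M_pos by (subst ennreal_mult[symmetric]) (auto intro!: ennreal_leI)
      show "ennreal (M * ?e) \<le> ennreal (M * \<bar>X 0\<bar>) * indicator {0..<period} u"
        using k u by (auto simp: indicator_def)
      show "ennreal M * ennreal \<beta> \<le> ennreal (M * \<beta>)"
        using M_pos \<beta> by (simp add: ennreal_mult)
    qed
    finally show ?thesis .
  qed
  have "(\<integral>\<^sup>+ \<omega>. discounted \<gamma> (\<lambda>u. ennreal (M * tracking_error X \<omega> u)) \<partial>P)
      = discounted \<gamma> (\<lambda>u. \<integral>\<^sup>+ \<omega>. ennreal (M * tracking_error X \<omega> u) \<partial>P)"
    using tracking_error_jointly_measurable[OF X]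
    by (intro nn_integral_discounted_swap(1) sigma_finite_measure_axioms) measurable
  also have "\<dots> \<le> discounted \<gamma> ?b"
    by (rule discounted_mono) (rule pointwise)
  also have "\<dots> = ennreal M * discounted \<gamma> (\<lambda>u. ennreal (f u - f (u - period)))
      + ennreal (M * \<bar>X 0\<bar>) * ennreal ((1 - \<alpha>) / \<gamma>) + ennreal (M * \<beta>) * ennreal (1 / \<gamma>)"
    using discounted_indicator_interval[OF \<gamma>_pos order_refl, of period "ennreal (M * \<bar>X 0\<bar>)"] period_pos \<gamma>_pos
    by (subst discounted_add, simp, simp, subst discounted_add, simp, simp, subst discounted_cmult)
      (simp_all add: discounted_const \<alpha>_def)
  also have "\<dots> \<le> ennreal M * (ennreal (1 - \<alpha>) * ennreal ((X l - X 0) / \<gamma>))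
      + ennreal (M * \<bar>X 0\<bar>) * ennreal ((1 - \<alpha>) / \<gamma>) + ennreal (M * \<beta>) * ennreal (1 / \<gamma>)"
  proof (intro add_right_mono mult_left_mono)
    have "discounted \<gamma> (\<lambda>u. ennreal (f u)) \<le> discounted \<gamma> (\<lambda>u. ennreal (X l - X 0))"
      using f_bounds by (intro discounted_mono ennreal_leI) auto
    also have "\<dots> = ennreal ((X l - X 0) / \<gamma>)"
      using \<gamma>_pos f_bounds[of 0] by (simp add: discounted_const ennreal_mult[symmetric])
    finally have Df: "discounted \<gamma> (\<lambda>u. ennreal (f u)) \<le> ennreal ((X l - X 0) / \<gamma>)" .
    then have "discounted \<gamma> (\<lambda>u. ennreal (f u)) < \<infinity>" by (auto simp: less_top[symmetric] top_unique)
    then have "discounted \<gamma> (\<lambda>u. ennreal (f (u - 0) - f (u - 0 - period)))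
        \<le> ennreal (1 - exp (- \<gamma> * period)) * discounted \<gamma> (\<lambda>u. ennreal (f u))"
      using period_pos \<gamma>_pos by (intro discounted_increment f_mono f_neg) auto
    also have "\<dots> \<le> ennreal (1 - \<alpha>) * ennreal ((X l - X 0) / \<gamma>)"
      unfolding \<alpha>_def by (intro mult_left_mono Df) simp
    finally show "discounted \<gamma> (\<lambda>u. ennreal (f u - f (u - period))) \<le> ennreal (1 - \<alpha>) * ennreal ((X l - X 0) / \<gamma>)"
      by simp
  qed simp
  also have "\<dots> = ennreal (M * ((1 - \<alpha>) * ((X l - X 0) / \<gamma>)) + M * \<bar>X 0\<bar> * ((1 - \<alpha>) / \<gamma>) + M * \<beta> * (1 / \<gamma>))"
    using M_pos \<gamma>_pos \<alpha>_bounds \<beta> f_bounds[of 0]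
    by (simp add: ennreal_plus ennreal_mult del: times_divide_eq_left times_divide_eq_right)
  also have "M * ((1 - \<alpha>) * ((X l - X 0) / \<gamma>)) + M * \<bar>X 0\<bar> * ((1 - \<alpha>) / \<gamma>) + M * \<beta> * (1 / \<gamma>)
      = tracking_bound X period"
    unfolding tracking_bound_def \<alpha>_def[symmetric] \<beta>_def[symmetric] using \<gamma>_pos by (simp add: field_simps)
  finally show ?thesis .
qed

lemma discounted_lag:
  assumes Y: "adjustment_process Y" and \<omega>: "\<omega> \<in> path_space" and "0 \<le> b" "0 < c"
  shows "discounted \<gamma> (\<lambda>u. ennreal (Y (u - b) \<omega> - Y (u - b - c) \<omega>))
    \<le> ennreal ((1 - exp (- \<gamma> * c)) / \<gamma>) * discounted_adjustment \<gamma> (\<lambda>t. Y t \<omega>)"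
proof -
  note D = adjustment_processD[OF Y \<omega>]
  have pos: "0 < 1 - exp (- \<gamma> * c)" using \<gamma>_pos \<open>0 < c\<close> by simp
  have adj: "discounted_adjustment \<gamma> (\<lambda>t. Y t \<omega>) = ennreal \<gamma> * discounted \<gamma> (\<lambda>u. ennreal (Y u \<omega>))"
    using D by (intro discounted_adjustment_eq \<gamma>_pos) auto
  have "discounted \<gamma> (\<lambda>u. ennreal (Y (u - b) \<omega> - Y (u - b - c) \<omega>))
      \<le> ennreal (1 - exp (- \<gamma> * c)) * discounted \<gamma> (\<lambda>u. ennreal (Y u \<omega>))"
  proof (cases "discounted \<gamma> (\<lambda>u. ennreal (Y u \<omega>)) = \<infinity>")
    case True
    have "ennreal (1 - exp (- \<gamma> * c)) * \<infinity> = \<infinity>" using pos by (simp only: ennreal_mult_eq_top_iff infinity_ennreal_def ennreal_eq_0_iff not_le simp_thms)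
    then show ?thesis using True by simp
  next
    case False
    then show ?thesis
      using D assms \<gamma>_pos borel_measurable_mono[OF D(3)]
      by (intro discounted_increment[of "\<lambda>u. Y u \<omega>"]) (auto simp: less_top[symmetric])
  qed
  also have "\<dots> = ennreal ((1 - exp (- \<gamma> * c)) / \<gamma>) * discounted_adjustment \<gamma> (\<lambda>t. Y t \<omega>)"
    unfolding adj using pos \<gamma>_pos by (simp add: mult.assoc[symmetric] ennreal_mult[symmetric])
  finally show ?thesis .
qed

section \<open>Comparison of the two systems\<close>

lemma sampled_state_in_space: "sampled_state l n X \<in> space states"
  by (simp add: sampled_state_def space_PiM)

text \<open>The plan orders at each review time what the policy has ordered since the previous one.  Its
  cumulated orders at review time \<open>k\<close> are the values of the policy at time \<open>(k - 1) * period\<close>, which is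
  at most two periods before any time \<open>u\<close> that is assigned to \<open>k\<close>.\<close>

lemma plan_rate_le_cost_rate:
  assumes X: "X \<in> initial_states l" and up: "adjustment_process Yup" and dn: "adjustment_process Ydn"
    and \<omega>: "\<omega> \<in> path_space" and u: "0 \<le> u"
  defines "a \<equiv> \<lambda>t \<omega>. Yup (real t * period) \<omega> - Yup ((real t - 1) * period) \<omega>"
    and "b \<equiv> \<lambda>t \<omega>. Ydn (real t * period) \<omega> - Ydn ((real t - 1) * period) \<omega>"
  shows "plan_rate X a b \<omega> u \<le> cost_rate X Yup Ydn \<omega> u + M * tracking_error X \<omega> u
    + (M * (Yup (u - l) \<omega> - Yup (u - l - 2 * period) \<omega>) + M * (Ydn u \<omega> - Ydn (u - 2 * period) \<omega>))"
proof -
  note U = adjustment_processD[OF up \<omega>] and D = adjustment_processD[OF dn \<omega>]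
  have U_mono: "Yup s \<omega> \<le> Yup t \<omega>" if "s \<le> t" for s t using monoD[OF U(3) that] .
  have D_mono: "Ydn s \<omega> \<le> Ydn t \<omega>" if "s \<le> t" for s t using monoD[OF D(3) that] .
  have cum_a: "cumulated a j \<omega> = Yup ((real j - 1) * period) \<omega>" for j
    by (induction j) (simp_all add: a_def U(1) period_pos)
  have cum_b: "cumulated b j \<omega> = Ydn ((real j - 1) * period) \<omega>" for j
    by (induction j) (simp_all add: b_def D(1) period_pos)
  let ?k = "review u"
  let ?r = "real ?k * period"
  have r: "0 \<le> ?r" "?r \<le> u" "u < ?r + period" using review_bounds[OF u] period_pos by auto
  have controls: "\<gamma> * (kup * cumulated a (Suc ?k) \<omega> + kdn * cumulated b (Suc ?k) \<omega>) \<le> \<gamma> * (kup * Yup u \<omega> + kdn * Ydn u \<omega>)"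
    unfolding cum_a cum_b using r \<gamma>_pos kup_pos kdn_pos
    by (intro mult_left_mono add_mono U_mono D_mono) auto
  let ?S = "X (max 0 u) + \<omega> (max 0 u) + Yup (u - l) \<omega> - Ydn u \<omega>"
  have lags: "0 \<le> Yup (u - l) \<omega> - Yup (u - l - 2 * period) \<omega>" "0 \<le> Ydn u \<omega> - Ydn (u - 2 * period) \<omega>"
    using U_mono D_mono period_pos by simp_all
  have te: "0 \<le> tracking_error X \<omega> u" by (rule tracking_error_nonneg[OF X u])
  show ?thesis
  proof (cases "?k = 0")
    case True
    have "0 \<le> M * tracking_error X \<omega> u" "0 \<le> M * (Yup (u - l) \<omega> - Yup (u - l - 2 * period) \<omega>)"
      "0 \<le> M * (Ydn u \<omega> - Ydn (u - 2 * period) \<omega>)"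
      using te lags M_pos by (simp_all only: mult_nonneg_nonneg less_imp_le)
    then show ?thesis
      using controls h_nonneg[of ?S] unfolding plan_rate_def cost_rate_def if_P[OF True] by linarith
  next
    case False
    have lead: "real n * period = l" using n_pos by (simp add: period_def)
    have late_up: "cumulated a (?k - n) \<omega> \<le> Yup (u - l) \<omega>" "Yup (u - l - 2 * period) \<omega> \<le> cumulated a (?k - n) \<omega>"
    proof -
      show "cumulated a (?k - n) \<omega> \<le> Yup (u - l) \<omega>"
      proof (cases "n \<le> ?k")
        case True
        then have "(real (?k - n) - 1) * period = ?r - l - period"
          by (simp add: of_nat_diff left_diff_distrib lead)
        then show ?thesis unfolding cum_a using r period_pos by (intro U_mono) simp
      next
        case False
        then have "cumulated a (?k - n) \<omega> = 0" by simp
        then show ?thesis using U(2) by simp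
      qed
      show "Yup (u - l - 2 * period) \<omega> \<le> cumulated a (?k - n) \<omega>"
      proof (cases "n \<le> ?k")
        case True
        then have "(real (?k - n) - 1) * period = ?r - l - period"
          by (simp add: of_nat_diff left_diff_distrib lead)
        then show ?thesis unfolding cum_a using r period_pos by (intro U_mono) simp
      next
        case False
        then have "real (Suc ?k) * period \<le> real n * period" using period_pos by (intro mult_right_mono) auto
        then have "u < l" using r lead by (simp add: distrib_right)
        then have "Yup (u - l - 2 * period) \<omega> = 0" using period_pos by (intro U(1)) simp
        then show ?thesis using False by simp
      qed
    qed
    have late_dn: "cumulated b ?k \<omega> \<le> Ydn u \<omega>" "Ydn (u - 2 * period) \<omega> \<le> cumulated b ?k \<omega>"
      unfolding cum_b using r period_pos by (auto intro!: D_mono simp: left_diff_distrib)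
    have "h (level X a b ?k \<omega>) \<le> h ?S + M * \<bar>level X a b ?k \<omega> - ?S\<bar>" by (rule h_le)
    also have "\<bar>level X a b ?k \<omega> - ?S\<bar> \<le> tracking_error X \<omega> u
        + (Yup (u - l) \<omega> - Yup (u - l - 2 * period) \<omega>) + (Ydn u \<omega> - Ydn (u - 2 * period) \<omega>)"
    proof -
      have X_lag: "X ?r \<le> X (max 0 u)" using initial_state_mono[OF X r(1,2)] by (simp only: max_absorb2[OF u])
      show ?thesis
        using late_up late_dn X_lag unfolding level_def tracking_error_def if_not_P[OF False] by linarith
    qed
    finally have "h (level X a b ?k \<omega>) \<le> h ?S + (M * tracking_error X \<omega> u
        + M * (Yup (u - l) \<omega> - Yup (u - l - 2 * period) \<omega>) + M * (Ydn u \<omega> - Ydn (u - 2 * period) \<omega>))"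
      using M_pos by (simp add: distrib_left)
    then show ?thesis
      using controls False by (simp add: plan_rate_def cost_rate_def)
  qed
qed

lemma limit_value_le_policy_cost:
  assumes X: "X \<in> initial_states l" and \<pi>: "(Yup, Ydn) \<in> policies \<gamma> P"
  shows "limit_value (sampled_state l n X) \<le> policy_cost l \<gamma> kup kdn h P X (Yup, Ydn)
    + ennreal (tracking_bound X period)
    + ennreal (M * (1 - exp (- \<gamma> * (2 * period))) / \<gamma>)
      * (\<integral>\<^sup>+ \<omega>. discounted_adjustment \<gamma> (\<lambda>t. Yup t \<omega>) + discounted_adjustment \<gamma> (\<lambda>t. Ydn t \<omega>) \<partial>P)"
proof -
  have up: "adjustment_process Yup" and dn: "adjustment_process Ydn"
    using \<pi> by (auto simp: policies_def)
  \<comment> \<open>For \<open>t = 0\<close> the subtrahend is the policy at a negative time, that is \<open>0\<close>, so the first order is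
    the jump of the policy at time \<open>0\<close>.\<close>
  define a where "a = (\<lambda>t \<omega>. Yup (real t * period) \<omega> - Yup ((real t - 1) * period) \<omega>)"
  define b where "b = (\<lambda>t \<omega>. Ydn (real t * period) \<omega> - Ydn ((real t - 1) * period) \<omega>)"
  have le: "(real t - 1) * period \<le> real t * period" for t using period_pos by (simp add: left_diff_distrib)
  have adapted_diff: "adapted (\<lambda>t \<omega>. Y (real t * period) \<omega> - Y ((real t - 1) * period) \<omega>)"
    if Y: "adjustment_process Y" for Y
    unfolding adapted_def
    using adjustment_process_measurable[OF Y order_refl] adjustment_process_measurable[OF Y le]
      monoD[OF adjustment_processD(3)[OF Y] le]
    by (auto intro!: borel_measurable_diff)
  have a: "adapted a" and b: "adapted b" unfolding a_def b_def using up dn by (auto intro: adapted_diff)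
  let ?C = "\<lambda>\<omega>. discounted \<gamma> (\<lambda>u. ennreal (cost_rate X Yup Ydn \<omega> u))"
  let ?T = "\<lambda>\<omega>. discounted \<gamma> (\<lambda>u. ennreal (M * tracking_error X \<omega> u))"
  let ?A = "\<lambda>\<omega>. discounted_adjustment \<gamma> (\<lambda>t. Yup t \<omega>) + discounted_adjustment \<gamma> (\<lambda>t. Ydn t \<omega>)"
  let ?c = "(1 - exp (- \<gamma> * (2 * period))) / \<gamma>"
  have c: "0 \<le> ?c" using \<gamma>_pos period_pos by simp
  note C_joint = cost_rate_jointly_measurable[OF X up dn] and T_joint = tracking_error_jointly_measurable[OF X]
  have [measurable]: "?C \<in> borel_measurable P"
    by (rule nn_integral_discounted_swap(2)[OF sigma_finite_measure_axioms]) (use C_joint in measurable)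
  have [measurable]: "?T \<in> borel_measurable P"
    by (rule nn_integral_discounted_swap(2)[OF sigma_finite_measure_axioms]) (use T_joint in measurable)
  have adj_measurable: "(\<lambda>\<omega>. discounted_adjustment \<gamma> (\<lambda>t. Y t \<omega>)) \<in> borel_measurable P"
    if Y: "adjustment_process Y" for Y
  proof -
    have "discounted_adjustment \<gamma> (\<lambda>t. Y t \<omega>) = ennreal \<gamma> * discounted \<gamma> (\<lambda>u. ennreal (Y u \<omega>))"
      if "\<omega> \<in> space P" for \<omega>
      using adjustment_processD[OF Y, of \<omega>] that by (intro discounted_adjustment_eq \<gamma>_pos) auto
    moreover have "(\<lambda>\<omega>. ennreal \<gamma> * discounted \<gamma> (\<lambda>u. ennreal (Y u \<omega>))) \<in> borel_measurable P"
      using adjustment_jointly_measurable[OF Y, of 0]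
      by (intro borel_measurable_times_ennreal nn_integral_discounted_swap(2)[OF sigma_finite_measure_axioms]) auto
    ultimately show ?thesis by (subst measurable_cong) auto
  qed
  note [measurable] = adj_measurable[OF up] adj_measurable[OF dn]
  \<comment> \<open>The comparison holds path by path; expectations are taken only at the end.\<close>
  have pathwise: "(\<Sum>t. ennreal (\<alpha> ^ t) * stage_cost (sampled_state l n X) a b t \<omega>)
      \<le> ?C \<omega> + ?T \<omega> + ennreal (M * ?c) * ?A \<omega>" if "\<omega> \<in> space P" for \<omega>
  proof -
    have \<omega>: "\<omega> \<in> path_space" using that by simp
    note U = adjustment_processD[OF up \<omega>] and D = adjustment_processD[OF dn \<omega>]
    define lu where "lu u = Yup (u - l) \<omega> - Yup (u - l - 2 * period) \<omega>" for u
    define ld where "ld u = Ydn (u - 0) \<omega> - Ydn (u - 0 - 2 * period) \<omega>" for u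
    have nonneg: "0 \<le> a t \<omega>" "0 \<le> b t \<omega>" for t using a b \<omega> by (auto simp: adapted_def)
    have [measurable]: "(\<lambda>u. cost_rate X Yup Ydn \<omega> u) \<in> borel_measurable borel"
      "(\<lambda>u. tracking_error X \<omega> u) \<in> borel_measurable borel"
      using section_measurable[OF C_joint that] section_measurable[OF T_joint that] by simp_all
    have [measurable]: "(\<lambda>u. Yup (u - x) \<omega>) \<in> borel_measurable borel" "(\<lambda>u. Ydn (u - x) \<omega>) \<in> borel_measurable borel" for x
      using section_measurable[OF adjustment_jointly_measurable[OF up] that]
        section_measurable[OF adjustment_jointly_measurable[OF dn] that] by simp_all
    have [measurable]: "lu \<in> borel_measurable borel" "ld \<in> borel_measurable borel"
      unfolding lu_def[abs_def] ld_def[abs_def] diff_diff_eq by measurable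
    have "(\<Sum>t. ennreal (\<alpha> ^ t) * stage_cost (sampled_state l n X) a b t \<omega>)
        = discounted \<gamma> (\<lambda>u. ennreal (plan_rate X a b \<omega> u))"
      by (rule plan_cost_eq_discounted[OF X]) (rule nonneg)+
    also have "\<dots> \<le> discounted \<gamma> (\<lambda>u. ennreal (cost_rate X Yup Ydn \<omega> u) + ennreal (M * tracking_error X \<omega> u)
        + (ennreal M * ennreal (lu u) + ennreal M * ennreal (ld u)))"
    proof (rule discounted_mono)
      fix u :: real assume u: "0 \<le> u"
      have "0 \<le> lu u" "0 \<le> ld u"
        unfolding lu_def ld_def using monoD[OF U(3), of "u - l - 2 * period" "u - l"] monoD[OF D(3), of "u - 2 * period" u] period_pos by auto
      moreover have "0 \<le> cost_rate X Yup Ydn \<omega> u"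
        using U(2)[of u] D(2)[of u] \<gamma>_pos kup_pos kdn_pos by (simp add: cost_rate_def)
      moreover have "0 \<le> M * tracking_error X \<omega> u" using tracking_error_nonneg[OF X u] M_pos by simp
      moreover have "ennreal (plan_rate X a b \<omega> u)
          \<le> ennreal (cost_rate X Yup Ydn \<omega> u + M * tracking_error X \<omega> u + (M * lu u + M * ld u))"
        using plan_rate_le_cost_rate[OF X up dn \<omega> u] unfolding a_def b_def lu_def ld_def by (intro ennreal_leI) simp
      ultimately show "ennreal (plan_rate X a b \<omega> u) \<le> ennreal (cost_rate X Yup Ydn \<omega> u) + ennreal (M * tracking_error X \<omega> u)
        + (ennreal M * ennreal (lu u) + ennreal M * ennreal (ld u))"
        using M_pos by (simp only: ennreal_plus[symmetric] ennreal_mult[symmetric] less_imp_le add_nonneg_nonneg mult_nonneg_nonneg)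
    qed
    also have "\<dots> = ?C \<omega> + ?T \<omega> + (ennreal M * discounted \<gamma> (\<lambda>u. ennreal (lu u)) + ennreal M * discounted \<gamma> (\<lambda>u. ennreal (ld u)))"
      by (subst discounted_add, simp, simp, subst discounted_add, simp, simp, subst discounted_add, simp, simp,
          subst discounted_cmult, simp, subst discounted_cmult) simp_all
    also have "\<dots> \<le> ?C \<omega> + ?T \<omega> + (ennreal M * (ennreal ?c * discounted_adjustment \<gamma> (\<lambda>t. Yup t \<omega>))
        + ennreal M * (ennreal ?c * discounted_adjustment \<gamma> (\<lambda>t. Ydn t \<omega>)))"
      unfolding lu_def ld_def using discounted_lag[OF up \<omega>, of l "2 * period"] discounted_lag[OF dn \<omega>, of 0 "2 * period"] l_pos period_pos
      by (intro add_left_mono add_mono mult_left_mono) auto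
    also have "\<dots> = ?C \<omega> + ?T \<omega> + ennreal (M * ?c) * ?A \<omega>"
      using M_pos c by (subst ennreal_mult) (simp_all only: less_imp_le distrib_left mult.assoc)
    finally show ?thesis .
  qed
  have "limit_value (sampled_state l n X) \<le> (\<integral>\<^sup>+ \<omega>. (\<Sum>t. ennreal (\<alpha> ^ t) * stage_cost (sampled_state l n X) a b t \<omega>) \<partial>P)"
    by (rule limit_value_le_plan[OF sampled_state_in_space a b])
  also have "\<dots> \<le> (\<integral>\<^sup>+ \<omega>. ?C \<omega> + ?T \<omega> + ennreal (M * ?c) * ?A \<omega> \<partial>P)"
    by (intro nn_integral_mono pathwise)
  also have "\<dots> = (\<integral>\<^sup>+ \<omega>. ?C \<omega> \<partial>P) + (\<integral>\<^sup>+ \<omega>. ?T \<omega> \<partial>P) + ennreal (M * ?c) * (\<integral>\<^sup>+ \<omega>. ?A \<omega> \<partial>P)"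
    by (subst nn_integral_add, simp, simp, subst nn_integral_add, simp, simp, subst nn_integral_cmult) simp_all
  also have "\<dots> \<le> policy_cost l \<gamma> kup kdn h P X (Yup, Ydn) + ennreal (tracking_bound X period)
      + ennreal (M * ?c) * (\<integral>\<^sup>+ \<omega>. ?A \<omega> \<partial>P)"
    unfolding policy_cost_eq[OF X up dn] by (intro add_mono expected_tracking_error_le[OF X]) auto
  finally show ?thesis by simp
qed

lemma eventually_review_right: "eventually (\<lambda>v. review v = review u) (at_right u)"
proof -
  let ?e = "real (review u) * period + period"
  have "u < ?e"
    using review_bounds(2)[of u] period_pos by (cases "0 \<le> u") (auto simp: review_neg)
  moreover have "review v = review u" if "u < v" "v < ?e" for v
  proof (rule antisym)
    show "review u \<le> review v" using that by (intro review_mono) simp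
    show "review v \<le> review u"
    proof (cases "0 \<le> v")
      case True
      have "\<not> Suc (review u) \<le> review v"
        using that True by (subst review_ge_iff) (auto simp: distrib_right)
      then show ?thesis by simp
    qed (simp add: review_neg)
  qed
  ultimately show ?thesis by (auto simp: eventually_at_right intro!: exI[of _ ?e])
qed

lemma adjustment_process_cumulated:
  assumes a: "adapted a"
  shows "adjustment_process (\<lambda>u. cumulated a (review u))"
  unfolding adjustment_process_def
proof (intro conjI allI ballI impI)
  fix t :: real assume t: "0 \<le> t"
  show "cumulated a (review t) \<in> borel_measurable (path_filtration t)"
    unfolding cumulated_def[abs_def]
  proof (rule borel_measurable_sum)
    fix s assume "s \<in> {..<review t}"
    then have "real s * period \<le> t" using review_ge_iff[OF t, of s] by simp
    moreover have "a s \<in> borel_measurable (path_filtration (real s * period))"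
      using a by (simp add: adapted_def)
    ultimately show "a s \<in> borel_measurable (path_filtration t)"
      by (rule path_filtration_measurable_mono[rotated])
  qed
next
  fix \<omega> :: "real \<Rightarrow> real" and t :: real assume \<omega>: "\<omega> \<in> path_space"
  then have nonneg: "0 \<le> a s \<omega>" for s using a by (auto simp: adapted_def)
  show "0 \<le> cumulated a (review t) \<omega>" unfolding cumulated_def by (intro sum_nonneg nonneg)
  show "mono (\<lambda>t. cumulated a (review t) \<omega>)"
    unfolding cumulated_def using review_mono nonneg by (intro monoI sum_mono2) (auto intro: order_less_le_trans)
  have "eventually (\<lambda>v. cumulated a (review v) \<omega> = cumulated a (review t) \<omega>) (at_right t)"
    using eventually_review_right[of t] by eventually_elim simp
  then show "continuous (at_right t) (\<lambda>t. cumulated a (review t) \<omega>)"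
    unfolding continuous_within by (rule tendsto_eventually)
  show "cumulated a (review t) \<omega> = 0" if "t < 0" using that by (simp add: review_neg)
qed

text \<open>The step processes execute each order one period late.  This reproduces the inventory level of the
  periodic system at every review time, so that only the tracking error remains.\<close>

lemma cost_rate_le_plan_rate:
  assumes X: "X \<in> initial_states l" and u: "0 \<le> u"
    and nonneg: "\<And>t. 0 \<le> a t \<omega>" "\<And>t. 0 \<le> b t \<omega>"
  shows "cost_rate X (\<lambda>u. cumulated a (review u)) (\<lambda>u. cumulated b (review u)) \<omega> u
    \<le> plan_rate X a b \<omega> u + M * tracking_error X \<omega> u"
proof -
  let ?k = "review u"
  let ?r = "real ?k * period"
  have r: "0 \<le> ?r" "?r \<le> u" using review_bounds[OF u] period_pos by auto
  have X_lag: "X ?r \<le> X (max 0 u)" using initial_state_mono[OF X, of ?r "max 0 u"] r by simp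
  have controls: "\<gamma> * (kup * cumulated a ?k \<omega> + kdn * cumulated b ?k \<omega>)
      \<le> \<gamma> * (kup * cumulated a (Suc ?k) \<omega> + kdn * cumulated b (Suc ?k) \<omega>)"
    using \<gamma>_pos kup_pos kdn_pos nonneg by (intro mult_left_mono add_mono) auto
  let ?S = "X (max 0 u) + \<omega> (max 0 u) + cumulated a (review (u - l)) \<omega> - cumulated b ?k \<omega>"
  have "h ?S \<le> (if ?k = 0 then 0 else h (level X a b ?k \<omega>)) + M * tracking_error X \<omega> u"
  proof (cases "?k = 0")
    case True
    have "h ?S \<le> h 0 + M * \<bar>?S - 0\<bar>" by (rule h_le)
    also have "h 0 = 0" using holding by (simp add: holding_cost_def)
    also have "\<bar>?S - 0\<bar> \<le> tracking_error X \<omega> u"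
      using X_lag True by (simp add: review_lead_time tracking_error_def) linarith
    finally show ?thesis using True M_pos by simp
  next
    case False
    have "h ?S \<le> h (level X a b ?k \<omega>) + M * \<bar>?S - level X a b ?k \<omega>\<bar>" by (rule h_le)
    also have "\<bar>?S - level X a b ?k \<omega>\<bar> \<le> tracking_error X \<omega> u"
      using X_lag False by (simp add: review_lead_time tracking_error_def level_def)
    finally show ?thesis using False M_pos by simp
  qed
  then show ?thesis
    using controls by (simp add: cost_rate_def plan_rate_def)
qed

text \<open>The step processes of a near-optimal plan form an admissible policy: their discounted effort is at
  most a constant times the cost of the plan, as both unit costs are positive.\<close>

lemma optimal_cost_le_limit_value:
  assumes X: "X \<in> initial_states l"
  shows "optimal_cost l \<gamma> kup kdn h P X \<le> limit_value (sampled_state l n X) + ennreal (tracking_bound X period)"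
proof (rule ennreal_le_epsilon)
  fix \<epsilon> :: real
  assume fin: "limit_value (sampled_state l n X) + ennreal (tracking_bound X period) < top" and "0 < \<epsilon>"
  let ?x = "sampled_state l n X"
  obtain a b where a: "adapted a" and b: "adapted b"
    and opt: "(\<integral>\<^sup>+ \<omega>. (\<Sum>t. ennreal (\<alpha> ^ t) * stage_cost ?x a b t \<omega>) \<partial>P) \<le> limit_value ?x + ennreal \<epsilon>"
    by (rule near_optimal_plan[OF sampled_state_in_space \<open>0 < \<epsilon>\<close>])
  define Yup where "Yup = (\<lambda>u. cumulated a (review u))"
  define Ydn where "Ydn = (\<lambda>u. cumulated b (review u))"
  have up: "adjustment_process Yup" and dn: "adjustment_process Ydn"
    unfolding Yup_def Ydn_def using a b by (auto intro: adjustment_process_cumulated)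
  let ?J = "\<lambda>\<omega>. \<Sum>t. ennreal (\<alpha> ^ t) * stage_cost ?x a b t \<omega>"
  let ?T = "\<lambda>\<omega>. discounted \<gamma> (\<lambda>u. ennreal (M * tracking_error X \<omega> u))"
  have J [measurable]: "?J \<in> borel_measurable P"
    using stage_cost_measurable[OF sampled_state_in_space a b] by measurable
  note T_joint = tracking_error_jointly_measurable[OF X]
  have [measurable]: "?T \<in> borel_measurable P"
    by (rule nn_integral_discounted_swap(2)[OF sigma_finite_measure_axioms]) (use T_joint in measurable)
  have J_eq: "?J \<omega> = discounted \<gamma> (\<lambda>u. ennreal (plan_rate X a b \<omega> u))" if "\<omega> \<in> space P" for \<omega>
    using a b that by (intro plan_cost_eq_discounted[OF X]) (auto simp: adapted_def)
  have [measurable]: "(\<lambda>u. plan_rate X a b \<omega> u) \<in> borel_measurable borel" for \<omega>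
    unfolding plan_rate_def by (rule measurable_compose[OF review_measurable]) simp
  have rate_nonneg: "0 \<le> \<gamma> * (kup * cumulated a k \<omega> + kdn * cumulated b k \<omega>)" if "\<omega> \<in> space P" for \<omega> k
    using a b that \<gamma>_pos kup_pos kdn_pos
    by (intro mult_nonneg_nonneg add_nonneg_nonneg) (auto simp: adapted_def cumulated_def sum_nonneg)
  have rate_ge: "\<gamma> * (kup * cumulated a (review u) \<omega> + kdn * cumulated b (review u) \<omega>) \<le> plan_rate X a b \<omega> u"
    if "\<omega> \<in> space P" for \<omega> u
  proof -
    have "\<gamma> * (kup * cumulated a (review u) \<omega> + kdn * cumulated b (review u) \<omega>)
        \<le> \<gamma> * (kup * cumulated a (Suc (review u)) \<omega> + kdn * cumulated b (Suc (review u)) \<omega>)"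
      using \<gamma>_pos kup_pos kdn_pos a b that by (intro mult_left_mono add_mono) (auto simp: adapted_def)
    then show ?thesis by (simp add: plan_rate_def add_increasing2)
  qed
  have J_fin: "(\<integral>\<^sup>+ \<omega>. ?J \<omega> \<partial>P) < \<infinity>"
    using opt fin by (auto simp: less_top[symmetric] top_unique)
  have cost: "policy_cost l \<gamma> kup kdn h P X (Yup, Ydn) \<le> limit_value ?x + ennreal \<epsilon> + ennreal (tracking_bound X period)"
  proof -
    have "policy_cost l \<gamma> kup kdn h P X (Yup, Ydn) = (\<integral>\<^sup>+ \<omega>. discounted \<gamma> (\<lambda>u. ennreal (cost_rate X Yup Ydn \<omega> u)) \<partial>P)"
      by (rule policy_cost_eq[OF X up dn])
    also have "\<dots> \<le> (\<integral>\<^sup>+ \<omega>. ?J \<omega> + ?T \<omega> \<partial>P)"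
    proof (rule nn_integral_mono)
      fix \<omega> assume \<omega>: "\<omega> \<in> space P"
      have [measurable]: "(\<lambda>u. tracking_error X \<omega> u) \<in> borel_measurable borel"
        using section_measurable[OF T_joint \<omega>] .
      have "discounted \<gamma> (\<lambda>u. ennreal (cost_rate X Yup Ydn \<omega> u))
          \<le> discounted \<gamma> (\<lambda>u. ennreal (plan_rate X a b \<omega> u) + ennreal (M * tracking_error X \<omega> u))"
      proof (rule discounted_mono)
        fix u :: real assume u: "0 \<le> u"
        have "0 \<le> plan_rate X a b \<omega> u" using rate_nonneg[OF \<omega>, of "review u"] rate_ge[OF \<omega>, of u] by linarith
        moreover have "0 \<le> M * tracking_error X \<omega> u" using tracking_error_nonneg[OF X u] M_pos by simp
        ultimately show "ennreal (cost_rate X Yup Ydn \<omega> u) \<le> ennreal (plan_rate X a b \<omega> u) + ennreal (M * tracking_error X \<omega> u)"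
          using cost_rate_le_plan_rate[OF X u, of a \<omega> b] a b \<omega>
          by (subst ennreal_plus[symmetric]) (auto simp: adapted_def Yup_def Ydn_def simp del: ennreal_plus intro!: ennreal_leI)
      qed
      also have "\<dots> = ?J \<omega> + ?T \<omega>"
        unfolding J_eq[OF \<omega>] by (rule discounted_add) simp_all
      finally show "discounted \<gamma> (\<lambda>u. ennreal (cost_rate X Yup Ydn \<omega> u)) \<le> ?J \<omega> + ?T \<omega>" .
    qed
    also have "\<dots> = (\<integral>\<^sup>+ \<omega>. ?J \<omega> \<partial>P) + (\<integral>\<^sup>+ \<omega>. ?T \<omega> \<partial>P)" by (rule nn_integral_add) simp_all
    also have "\<dots> \<le> limit_value ?x + ennreal \<epsilon> + ennreal (tracking_bound X period)"
      by (intro add_mono opt expected_tracking_error_le[OF X])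
    finally show ?thesis .
  qed
  have "(Yup, Ydn) \<in> policies \<gamma> P"
  proof -
    let ?K = "1 / kup + 1 / kdn"
    have "(\<integral>\<^sup>+ \<omega>. discounted_adjustment \<gamma> (\<lambda>t. Yup t \<omega>) + discounted_adjustment \<gamma> (\<lambda>t. Ydn t \<omega>) \<partial>P)
        \<le> (\<integral>\<^sup>+ \<omega>. ennreal ?K * ?J \<omega> \<partial>P)"
    proof (rule nn_integral_mono)
      fix \<omega> assume \<omega>: "\<omega> \<in> space P"
      then have \<omega>': "\<omega> \<in> path_space" by simp
      note U = adjustment_processD[OF up \<omega>'] and D = adjustment_processD[OF dn \<omega>']
      have [measurable]: "(\<lambda>u. Yup u \<omega>) \<in> borel_measurable borel" "(\<lambda>u. Ydn u \<omega>) \<in> borel_measurable borel"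
        using borel_measurable_mono[OF U(3)] borel_measurable_mono[OF D(3)] by simp_all
      have "discounted_adjustment \<gamma> (\<lambda>t. Yup t \<omega>) + discounted_adjustment \<gamma> (\<lambda>t. Ydn t \<omega>)
          = discounted \<gamma> (\<lambda>u. ennreal \<gamma> * ennreal (Yup u \<omega>) + ennreal \<gamma> * ennreal (Ydn u \<omega>))"
        using U D by (subst (1 2) discounted_adjustment_eq[OF \<gamma>_pos])
          (auto simp: discounted_add discounted_cmult)
      also have "\<dots> \<le> discounted \<gamma> (\<lambda>u. ennreal ?K * ennreal (plan_rate X a b \<omega> u))"
      proof (rule discounted_mono)
        fix u :: real
        let ?p = "\<gamma> * (kup * Yup u \<omega> + kdn * Ydn u \<omega>)"
        have nn: "0 \<le> Yup u \<omega>" "0 \<le> Ydn u \<omega>" using U(2) D(2) by auto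
        have "\<gamma> * Yup u \<omega> \<le> 1 / kup * ?p" "\<gamma> * Ydn u \<omega> \<le> 1 / kdn * ?p"
          using nn \<gamma>_pos kup_pos kdn_pos by (simp_all add: field_simps)
        then have "\<gamma> * Yup u \<omega> + \<gamma> * Ydn u \<omega> \<le> ?K * ?p" by (simp only: distrib_right add_mono)
        also have "\<dots> \<le> ?K * plan_rate X a b \<omega> u"
          using rate_ge[OF \<omega>, of u] kup_pos kdn_pos unfolding Yup_def Ydn_def by (intro mult_left_mono) auto
        finally have "ennreal (\<gamma> * Yup u \<omega> + \<gamma> * Ydn u \<omega>) \<le> ennreal (?K * plan_rate X a b \<omega> u)" by (rule ennreal_leI)
        then show "ennreal \<gamma> * ennreal (Yup u \<omega>) + ennreal \<gamma> * ennreal (Ydn u \<omega>) \<le> ennreal ?K * ennreal (plan_rate X a b \<omega> u)"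
          using nn \<gamma>_pos kup_pos kdn_pos by (subst (asm) ennreal_mult') (auto simp: ennreal_plus ennreal_mult)
      qed
      also have "\<dots> = ennreal ?K * ?J \<omega>"
        unfolding J_eq[OF \<omega>] by (rule discounted_cmult) simp
      finally show "discounted_adjustment \<gamma> (\<lambda>t. Yup t \<omega>) + discounted_adjustment \<gamma> (\<lambda>t. Ydn t \<omega>) \<le> ennreal ?K * ?J \<omega>" .
    qed
    also have "\<dots> = ennreal ?K * (\<integral>\<^sup>+ \<omega>. ?J \<omega> \<partial>P)" by (rule nn_integral_cmult) simp
    also have "\<dots> < \<infinity>" using J_fin by (simp add: ennreal_mult_less_top)
    finally show ?thesis using up dn by (simp add: policies_def)
  qed
  then have "optimal_cost l \<gamma> kup kdn h P X \<le> policy_cost l \<gamma> kup kdn h P X (Yup, Ydn)"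
    unfolding optimal_cost_def by (rule INF_lower)
  also note cost
  finally show "optimal_cost l \<gamma> kup kdn h P X \<le> limit_value ?x + ennreal (tracking_bound X period) + ennreal \<epsilon>"
    by (simp add: ac_simps)
qed

end

theorem proposition4p2:
  fixes l \<gamma> \<mu> \<sigma> kup kdn M :: real
    and h X :: "real \<Rightarrow> real"
    and P :: "(real \<Rightarrow> real) measure"
  assumes "0 < l" and "0 < \<gamma>" and "0 < \<sigma>" and "0 < kup" and "0 < kdn" and "0 < M"
    and "brownian_law \<mu> \<sigma> P"
    and "holding_cost M h"
    and "X \<in> initial_states l"
  shows "(\<lambda>n. infinite_horizon_cost l \<gamma> \<mu> \<sigma> kup kdn h P n (sampled_state l n X))
           \<longlonglongrightarrow> optimal_cost l \<gamma> kup kdn h P X"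
proof -
  interpret inventory \<mu> \<sigma> P l \<gamma> kup kdn M h
    using assms by unfold_locales
  let ?V = "\<lambda>n. infinite_horizon_cost l \<gamma> \<mu> \<sigma> kup kdn h P n (sampled_state l n X)"
  let ?C = "optimal_cost l \<gamma> kup kdn h P X"
  let ?B = "\<lambda>n. tracking_bound X (l / real n)"
  let ?c = "\<lambda>n. M * (1 - exp (- \<gamma> * (2 * (l / real n)))) / \<gamma>"
  have step: "(\<lambda>n. l / real n) \<longlonglongrightarrow> 0" by (rule lim_const_over_n)
  have "?B \<longlonglongrightarrow> M / \<gamma> * ((1 - exp (- \<gamma> * 0)) * (X l - X 0 + \<bar>X 0\<bar>) + (\<bar>\<mu>\<bar> * 0 + sqrt 0 * \<sigma>))"
    unfolding tracking_bound_def by (intro tendsto_intros step)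
  then have B: "?B \<longlonglongrightarrow> 0" by simp
  have "?c \<longlonglongrightarrow> M * (1 - exp (- \<gamma> * (2 * 0))) / \<gamma>"
    using \<gamma>_pos by (intro tendsto_intros step) auto
  then have c: "?c \<longlonglongrightarrow> 0" by simp
  have lower: "?C \<le> ?V n + ennreal (?B n)" if "0 < n" for n
  proof -
    interpret periodic_system \<mu> \<sigma> P l \<gamma> kup kdn M h n by unfold_locales (rule that)
    show ?thesis
      unfolding infinite_horizon_cost_eq period_def[symmetric] by (rule optimal_cost_le_limit_value[OF assms(9)])
  qed
  have upper: "?V n \<le> policy_cost l \<gamma> kup kdn h P X (Yup, Ydn) + ennreal (?B n) + ennreal (?c n)
      * (\<integral>\<^sup>+ \<omega>. discounted_adjustment \<gamma> (\<lambda>t. Yup t \<omega>) + discounted_adjustment \<gamma> (\<lambda>t. Ydn t \<omega>) \<partial>P)"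
    if "0 < n" "(Yup, Ydn) \<in> policies \<gamma> P" for n Yup Ydn
  proof -
    interpret periodic_system \<mu> \<sigma> P l \<gamma> kup kdn M h n by unfold_locales (rule that)
    show ?thesis
      unfolding infinite_horizon_cost_eq period_def[symmetric]
      by (rule limit_value_le_policy_cost[OF assms(9) that(2)])
  qed
  show ?thesis
  proof (rule order_tendstoI)
    fix y assume y: "y < ?C"
    \<comment> \<open>\<open>?B n\<close> is added to \<open>y\<close> and not subtracted from the optimal cost, because subtraction in
      the extended reals would need finiteness of the costs.\<close>
    have "(\<lambda>n. y + ennreal (?B n)) \<longlonglongrightarrow> y + ennreal 0"
      by (intro tendsto_add tendsto_const tendsto_ennrealI B)
    then have "\<forall>\<^sub>F n in sequentially. y + ennreal (?B n) < ?C"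
      using y by (intro order_tendstoD) simp_all
    then show "\<forall>\<^sub>F n in sequentially. y < ?V n"
      using eventually_gt_at_top[of 0]
    proof eventually_elim
      case (elim n)
      show ?case
      proof (rule ccontr)
        assume "\<not> y < ?V n"
        then have "?V n + ennreal (?B n) \<le> y + ennreal (?B n)" by (intro add_right_mono) simp
        with elim(1) lower[OF elim(2)] show False by (meson leD order_trans)
      qed
    qed
  next
    fix y assume "?C < y"
    then obtain Yup Ydn where \<pi>: "(Yup, Ydn) \<in> policies \<gamma> P" and cost: "policy_cost l \<gamma> kup kdn h P X (Yup, Ydn) < y"
      unfolding optimal_cost_def INF_less_iff by auto
    let ?A = "\<integral>\<^sup>+ \<omega>. discounted_adjustment \<gamma> (\<lambda>t. Yup t \<omega>) + discounted_adjustment \<gamma> (\<lambda>t. Ydn t \<omega>) \<partial>P"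
    have "?A < \<infinity>" using \<pi> by (simp add: policies_def)
    then obtain A where A: "?A = ennreal A" "0 \<le> A" by (cases ?A) auto
    have "(\<lambda>n. policy_cost l \<gamma> kup kdn h P X (Yup, Ydn) + ennreal (?B n) + ennreal (?c n * A))
        \<longlonglongrightarrow> policy_cost l \<gamma> kup kdn h P X (Yup, Ydn) + ennreal 0 + ennreal (0 * A)"
      by (intro tendsto_add[OF tendsto_add[OF tendsto_const]] tendsto_ennrealI B tendsto_mult[OF c tendsto_const])
    then have "\<forall>\<^sub>F n in sequentially. policy_cost l \<gamma> kup kdn h P X (Yup, Ydn) + ennreal (?B n) + ennreal (?c n * A) < y"
      using cost by (intro order_tendstoD) simp_all
    then show "\<forall>\<^sub>F n in sequentially. ?V n < y"
      using eventually_gt_at_top[of 0]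
    proof eventually_elim
      case (elim n)
      have "?V n \<le> policy_cost l \<gamma> kup kdn h P X (Yup, Ydn) + ennreal (?B n) + ennreal (?c n * A)"
        using upper[OF elim(2) \<pi>] unfolding A(1) ennreal_mult''[OF A(2)] .
      then show ?case using elim(1) by (rule le_less_trans)
    qed
  qed
qed

end
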